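(* The fixed-point set $\mathrm{Fix}(\Pi)$ (with the subspace topology of $\Pi$) is homeomorphic to $\mathcal{A}$ equipped with the weak topology of $\ell^2$.
   Context: mm-spaces are triples $(X,d_X,\mu_X)$ with $(X,d_X)$ complete separable metric and $\mu_X$ a Borel probability measure, with $X=\operatorname{supp}\mu_X$. $\mathcal{X}$ is the set of their isomorphism classes under measure-preserving isometries. $\square$ is the box distance on $\mathcal{X}$: $\square(X,Y)$ is the infimum of $\varepsilon\ge0$ such that there exist Borel maps $\varphi,\psi$ from $[0,1)$ pushing Lebesgue measure to $\mu_X,\mu_Y$ and a Borel set $I_0$ of measure $\ge1-\varepsilon$ with $|d_X(\varphi(s),\varphi(t))-d_Y(\psi(s),\psi(t))|\le\varepsilon$ for all $s,t\in I_0$. $Y\prec X$ means there is a 1-Lipschitz $f\colon X\to Y$ with $f_*\mu_X=\mu_Y$. A pyramid is a nonempty $\square$-closed set $\mathcal{P}\subset\mathcal{X}$ that is downward closed under $\prec$ and such that any two elements are dominated by a common element of $\mathcal{P}$. $\Pi$ is the set of pyramids with the topology of weak convergence: $\mathcal{P}_n\to\mathcal{P}$ iff $\square(X,\mathcal{P}_n)\to0$ for all $X\in\mathcal{P}$ and $\liminf\square(X,\mathcal{P}_n)>0$ for all $X\notin\mathcal{P}$. This topology is metrizable and compact. $\mathbb{R}_+$ acts on $\Pi$ by $t\mathcal{P}=\{(X,t\,d_X,\mu_X):X\in\mathcal{P}\}$, and $\mathrm{Fix}(\Pi)$ is its fixed-point set. $\mathcal{A}$ is the set of monotone non-increasing sequences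 $\{a_i\}_{i\ge1}$ of nonnegative reals with $\sum_i a_i\le1$, viewed as a subset of $\ell^2$. *)

theory Defs
  imports "HOL-Analysis.Analysis" "HOL-Probability.Probability"
begin

text \<open>mm-spaces.  Every complete separable metric space has cardinality at most that of
the continuum, so every mm-space is isomorphic to one whose underlying set is a subset
of the type real (carrying an arbitrary metric, not the usual one).  We therefore
represent an mm-space as a triple (X, d, mu) with X :: real set, d a metric on X and mu
a Borel probability measure on (X,d).  Isomorphism classes are handled by working with
isomorphism-saturated sets of representatives (pyramids are automatically saturated,
being downward closed under domination).\<close>

type_synonym mm = "real set \<times> (real \<Rightarrow> real \<Rightarrow> real) \<times> real measure"

definition mm_pts :: "mm \<Rightarrow> real set" where "mm_pts X = fst X"
definition mm_dist :: "mm \<Rightarrow> real \<Rightarrow> real \<Rightarrow> real" where "mm_dist X = fst (snd X)"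
definition mm_meas :: "mm \<Rightarrow> real measure" where "mm_meas X = snd (snd X)"

definition borel_sets_of :: "'a topology \<Rightarrow> 'a set set" where
  "borel_sets_of T = sigma_sets (topspace T) {U. openin T U}"

definition mm_space :: "mm \<Rightarrow> bool" where
  "mm_space X \<longleftrightarrow>
     Metric_space (mm_pts X) (mm_dist X) \<and>
     Metric_space.mcomplete (mm_pts X) (mm_dist X) \<and>
     separable_space (Metric_space.mtopology (mm_pts X) (mm_dist X)) \<and>
     prob_space (mm_meas X) \<and>
     space (mm_meas X) = mm_pts X \<and>
     sets (mm_meas X) = borel_sets_of (Metric_space.mtopology (mm_pts X) (mm_dist X)) \<and>
     \<comment> \<open>X = supp mu: every point has open balls of positive measure\<close>
     (\<forall>x\<in>mm_pts X. \<forall>r>0. measure (mm_meas X) (Metric_space.mball (mm_pts X) (mm_dist X) x r) > 0)"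

definition mmX :: "mm set" where "mmX = {X. mm_space X}"

definition I01 :: "real measure" where "I01 = restrict_space lborel {0..<1}"

definition parametrization :: "(real \<Rightarrow> real) \<Rightarrow> mm \<Rightarrow> bool" where
  "parametrization \<phi> X \<longleftrightarrow> \<phi> \<in> measurable I01 (mm_meas X) \<and> distr I01 (mm_meas X) \<phi> = mm_meas X"

definition box :: "mm \<Rightarrow> mm \<Rightarrow> real" where
  "box X Y = Inf {\<epsilon>. \<epsilon> \<ge> 0 \<and> (\<exists>\<phi> \<psi> I0. parametrization \<phi> X \<and> parametrization \<psi> Y \<and>
       I0 \<in> sets I01 \<and> measure I01 I0 \<ge> 1 - \<epsilon> \<and>
       (\<forall>s\<in>I0. \<forall>t\<in>I0. \<bar>mm_dist X (\<phi> s) (\<phi> t) - mm_dist Y (\<psi> s) (\<psi> t)\<bar> \<le> \<epsilon>))}"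

definition box_set :: "mm \<Rightarrow> mm set \<Rightarrow> real" where
  "box_set X P = Inf (box X ` P)"

definition dominated :: "mm \<Rightarrow> mm \<Rightarrow> bool" where
  "dominated Y X \<longleftrightarrow> (\<exists>f. f ` mm_pts X \<subseteq> mm_pts Y \<and>
      (\<forall>x\<in>mm_pts X. \<forall>y\<in>mm_pts X. mm_dist Y (f x) (f y) \<le> mm_dist X x y) \<and>
      f \<in> measurable (mm_meas X) (mm_meas Y) \<and>
      distr (mm_meas X) (mm_meas Y) f = mm_meas Y)"

definition pyramid :: "mm set \<Rightarrow> bool" where
  "pyramid P \<longleftrightarrow> P \<subseteq> mmX \<and> P \<noteq> {} \<and>
     (\<forall>X\<in>mmX. (\<forall>\<epsilon>>0. \<exists>Y\<in>P. box X Y < \<epsilon>) \<longrightarrow> X \<in> P) \<and>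
     (\<forall>X\<in>P. \<forall>Y\<in>mmX. dominated Y X \<longrightarrow> Y \<in> P) \<and>
     (\<forall>X\<in>P. \<forall>Y\<in>P. \<exists>Z\<in>P. dominated X Z \<and> dominated Y Z)"

definition Pyr :: "mm set set" where "Pyr = {P. pyramid P}"

definition weak_conv :: "(nat \<Rightarrow> mm set) \<Rightarrow> mm set \<Rightarrow> bool" where
  "weak_conv Ps P \<longleftrightarrow>
     (\<forall>X\<in>P. (\<lambda>n. box_set X (Ps n)) \<longlonglongrightarrow> 0) \<and>
     (\<forall>X\<in>mmX - P. 0 < liminf (\<lambda>n. ereal (box_set X (Ps n))))"

text \<open>The topology of weak convergence on Pi: since it is metrizable (hence sequential),
it is the topology whose open sets are the sequentially open sets for weak convergence.\<close>
definition Pyr_topology :: "mm set topology" where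
  "Pyr_topology = topology (\<lambda>U. U \<subseteq> Pyr \<and>
     (\<forall>Ps P. (\<forall>n. Ps n \<in> Pyr) \<and> P \<in> U \<and> weak_conv Ps P \<longrightarrow> eventually (\<lambda>n. Ps n \<in> U) sequentially))"


lemma istopology_Pyr_topology_pred:
  "istopology (\<lambda>U. U \<subseteq> Pyr \<and>
     (\<forall>Ps P. (\<forall>n. Ps n \<in> Pyr) \<and> P \<in> U \<and> weak_conv Ps P \<longrightarrow> eventually (\<lambda>n. Ps n \<in> U) sequentially))"
  unfolding istopology_def
  apply (rule conjI)
   apply (auto 0 4 intro!: eventually_conj)[1]
  apply (auto 0 3 elim!: eventually_mono)
  done

definition scale_mm :: "real \<Rightarrow> mm \<Rightarrow> mm" where
  "scale_mm t X = (mm_pts X, \<lambda>x y. t * mm_dist X x y, mm_meas X)"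

definition Fix_Pyr :: "mm set set" where
  "Fix_Pyr = {P \<in> Pyr. \<forall>t>0. scale_mm t ` P = P}"

definition l2 :: "(nat \<Rightarrow> real) set" where "l2 = {x. summable (\<lambda>i. (x i)\<^sup>2)}"

definition l2_inner :: "(nat \<Rightarrow> real) \<Rightarrow> (nat \<Rightarrow> real) \<Rightarrow> real" where
  "l2_inner x y = (\<Sum>i. x i * y i)"

definition weak_l2_topology :: "(nat \<Rightarrow> real) topology" where
  "weak_l2_topology = topology_generated_by
     {{x \<in> l2. l2_inner x y \<in> U} | y U. y \<in> l2 \<and> open U}"

text \<open>The set A (indices shifted to start at 0).\<close>
definition A_seq :: "(nat \<Rightarrow> real) set" where
  "A_seq = {a. decseq a \<and> (\<forall>i. 0 \<le> a i) \<and> summable a \<and> (\<Sum>i. a i) \<le> 1}"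

end

(* Every fixed pyramid has the form pyr_of a, the set of all mm-spaces whose measure dominates a sum
   of point masses a_i. Rescaling X by a large factor makes arbitrary Lipschitz changes of its metric
   available, so a scale-invariant pyramid containing X contains every space dominating the atoms of
   X. Concretely, a space in pyr_of a is approximated in box distance by putting a new metric on any
   space with atom sequence close to a, because the diffuse part and the small atoms can be assigned
   to the cells of a finite partition at will. The same approximation shows that pointwise convergence
   a^n -> a implies weak convergence of the pyramids; the converse inclusion of limits comes from a
   reverse Fatou argument. On A the weak l^2-topology is the product topology, which is compact, and
   weak limits of pyramids are unique, so a |-> pyr_of a is a closed continuous bijection. *)
theory Submission
  imports Defs
begin

section \<open>Polish metric spaces and parametrizations\<close>

text \<open>Box distance compares parametrizations over [0,1), so the approximation takes place on
  the parameter interval: the atom of index i always occupies the interval from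
  \<open>psum a i\<close> to \<open>psum a (Suc i)\<close>, and for fixed i nearby sequences have
  nearly the same interval. Redistributing the diffuse part at will requires recovering the
  parameter from the point; hence \<open>param_exists\<close> supplies an almost everywhere left
  inverse for laws without atoms, and \<open>nice_param\<close> extends it across the atoms. Small
  atoms are controlled uniformly, since monotonicity forces a_i \<le> 1/(i+1) on all of A. Atoms may
  merge in limits and under domination, which is why \<open>pyr_of\<close> asks for domination of a
  sum of point masses and not for a given list of atoms. Merging raises the sorted partial sums, so
  inclusion of pyramids reverses the order of partial sums; these sums determine a, and their infima
  describe an unknown fixed pyramid. Openness of sets of pyramids is defined through sequences, so
  closedness of the map is checked by extracting convergent subsequences in A.\<close>

locale polish = Metric_space M d for M :: "'a set" and d :: "'a \<Rightarrow> 'a \<Rightarrow> real" +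
  assumes complete: mcomplete
    and separable: "separable_space mtopology"
    and nonempty: "M \<noteq> {}"
begin

definition dense_seq :: "nat \<Rightarrow> 'a" where
  "dense_seq = (SOME D. range D \<subseteq> M \<and> (\<forall>x\<in>M. \<forall>e>0. \<exists>n. d (D n) x < e))"

lemma dense_seq_props:
  "range dense_seq \<subseteq> M \<and> (\<forall>x\<in>M. \<forall>e>0. \<exists>n. d (dense_seq n) x < e)"
proof -
  obtain C where C: "countable C" "C \<subseteq> M" "mtopology closure_of C = M"
    using separable unfolding separable_space_def by auto
  have dense: "\<exists>c\<in>C. d c x < e" if "x \<in> M" "e > 0" for x e
  proof -
    have "x \<in> mtopology closure_of C" using C that by simp
    then show ?thesis
      using that unfolding metric_closure_of by (fastforce simp: commute)
  qed
  then have "C \<noteq> {}" using nonempty zero_less_one by blast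
  then obtain D :: "nat \<Rightarrow> 'a" where "range D = C"
    using C(1) by (metis uncountable_def)
  then have "range D \<subseteq> M \<and> (\<forall>x\<in>M. \<forall>e>0. \<exists>n. d (D n) x < e)"
    using dense C(2) by blast
  then show ?thesis unfolding dense_seq_def
    by (rule someI[where P = "\<lambda>D. range D \<subseteq> M \<and> (\<forall>x\<in>M. \<forall>e>0. \<exists>n. d (D n) x < e)"])
qed

lemma dense_seq_in [simp]: "dense_seq n \<in> M"
  using dense_seq_props by blast

lemma dense_seq_approx: "x \<in> M \<Longrightarrow> e > 0 \<Longrightarrow> \<exists>n. d (dense_seq n) x < e"
  using dense_seq_props by blast

definition borelM :: "'a measure" where "borelM = sigma M {U. openin mtopology U}"

lemma open_sub_Pow: "{U. openin mtopology U} \<subseteq> Pow M"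
  using openin_subset by fastforce

lemma space_borelM [simp]: "space borelM = M"
  by (simp add: borelM_def space_measure_of open_sub_Pow)

lemma sets_borelM: "sets borelM = borel_sets_of mtopology"
  unfolding borelM_def borel_sets_of_def using open_sub_Pow by (simp add: sets_measure_of)

lemma openin_sets: "openin mtopology U \<Longrightarrow> U \<in> sets borelM"
  unfolding borelM_def using open_sub_Pow by (simp add: sets_measure_of sigma_sets.Basic)

lemma closedin_sets: "closedin mtopology U \<Longrightarrow> U \<in> sets borelM"
  using openin_sets[of "M - U"] sets.compl_sets[of "M - U" borelM]
  by (metis closedin_def double_diff openin_sets sets.compl_sets space_borelM subset_refl topspace_mtopology)

lemma mball_sets [measurable, simp]: "mball x r \<in> sets borelM"
  by (simp add: openin_sets)

lemma mcball_sets [measurable, simp]: "mcball x r \<in> sets borelM"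
  by (simp add: closedin_sets)

lemma singleton_sets [simp]: "x \<in> M \<Longrightarrow> {x} \<in> sets borelM"
  by (simp add: closedin_sets closedin_Hausdorff_singleton Hausdorff_space_mtopology)

lemma countable_sets: "countable C \<Longrightarrow> C \<subseteq> M \<Longrightarrow> C \<in> sets borelM"
  by (meson sets.countable singleton_sets subset_eq)

definition base_ball :: "nat \<Rightarrow> 'a set" where
  "base_ball n = mball (dense_seq (fst (prod_decode n))) (1 / real (Suc (snd (prod_decode n))))"

lemma base_ball_encode: "base_ball (prod_encode (j,k)) = mball (dense_seq j) (1 / real (Suc k))"
  by (simp add: base_ball_def)

lemma openin_base_ball [simp]: "openin mtopology (base_ball n)"
  by (simp add: base_ball_def)

lemma openin_base_ballE:
  assumes "openin mtopology U" "x \<in> U"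
  obtains n where "x \<in> base_ball n" "base_ball n \<subseteq> U"
proof -
  have xM: "x \<in> M" using assms openin_mtopology by blast
  obtain r where r: "r > 0" "mball x r \<subseteq> U" using assms openin_mtopology by blast
  obtain k :: nat where k: "1 / real (Suc k) < r / 2"
    using r(1) nat_approx_posE by (metis half_gt_zero)
  obtain j where j: "d (dense_seq j) x < 1 / real (Suc k)"
    using dense_seq_approx[OF xM, of "1 / real (Suc k)"] by auto
  have "mball (dense_seq j) (1 / real (Suc k)) \<subseteq> mball x r"
    by (rule mball_subset) (use j k xM in auto)
  then show ?thesis
    using r j xM by (intro that[of "prod_encode (j,k)"]) (auto simp: base_ball_encode)
qed

lemma open_eq_Union_base_balls:
  assumes "openin mtopology U" shows "U = (\<Union>n\<in>{n. base_ball n \<subseteq> U}. base_ball n)"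
proof -
  have "x \<in> (\<Union>n\<in>{n. base_ball n \<subseteq> U}. base_ball n)" if "x \<in> U" for x
    by (rule openin_base_ballE[OF assms that]) blast
  then show ?thesis by blast
qed

text \<open>Every open set is a countable union of the balls \<open>base_ball n\<close>, so
  measurability of a map into M need only be tested on distances to fixed points. This test serves
  for the limits, products and subspaces built later.\<close>

lemma measurable_borelM_I:
  assumes "\<And>x. x \<in> space \<Omega> \<Longrightarrow> f x \<in> M"
    and "\<And>c r. c \<in> M \<Longrightarrow> {x\<in>space \<Omega>. d c (f x) < r} \<in> sets \<Omega>"
  shows "f \<in> measurable \<Omega> borelM"
  unfolding borelM_def
proof (rule measurable_measure_of[OF open_sub_Pow])
  show "f \<in> space \<Omega> \<rightarrow> M" using assms(1) by auto
  fix U assume "U \<in> {U. openin mtopology U}"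
  then have U: "openin mtopology U" by simp
  define S where "S = {n. base_ball n \<subseteq> U}"
  have "f -` U \<inter> space \<Omega> = f -` (\<Union>n\<in>S. base_ball n) \<inter> space \<Omega>"
    unfolding S_def using open_eq_Union_base_balls[OF U] by simp
  also have "\<dots> = (\<Union>n\<in>S. {x\<in>space \<Omega>. d (dense_seq (fst (prod_decode n))) (f x) < 1 / real (Suc (snd (prod_decode n)))})"
    using assms(1) unfolding base_ball_def by auto
  also have "\<dots> \<in> sets \<Omega>"
    by (rule sets.countable_UN') (auto intro: assms(2))
  finally show "f -` U \<inter> space \<Omega> \<in> sets \<Omega>" .
qed

lemma dist_measurable:
  assumes "c \<in> M" shows "d c \<in> borel_measurable borelM"
proof (rule borel_measurableI_less)
  fix y
  have "{x \<in> space borelM. d c x < y} = mball c y" using assms by auto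
  then show "{x \<in> space borelM. d c x < y} \<in> sets borelM" by simp
qed

end

lemma measurable_digit [measurable]:
  "Measurable.pred borel (\<lambda>y::real. odd \<lfloor>4 ^ Suc n * y\<rfloor>)"
proof -
  have "(\<lambda>y::real. \<lfloor>4 ^ Suc n * y\<rfloor>) \<in> measurable borel (count_space UNIV)"
    by measurable
  then show ?thesis by measurable
qed

text \<open>In base 4 with digits 0 and 1 the tail after digit n, scaled by 4^(n+1), is at most 1/3,
  so no carry occurs; the digits before n contribute a multiple of 4, so the parity of the floor is
  digit n. In base 2 the tail could reach 1.\<close>

lemma digit_of_sum:
  fixes b :: "nat \<Rightarrow> bool"
  shows "odd \<lfloor>4 ^ Suc n * (\<Sum>m. of_bool (b m) / 4 ^ Suc m :: real)\<rfloor> \<longleftrightarrow> b n"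
proof -
  define f where "f m = (of_bool (b m) / 4 ^ Suc m :: real)" for m
  have geo: "(\<lambda>m. (1/4::real) * (1/4) ^ m) sums ((1/4) * (1 / (1 - 1/4)))"
    by (intro sums_mult geometric_sums) auto
  have fle: "f m \<le> (1/4) * (1/4) ^ m" for m by (auto simp: f_def field_simps)
  have f0: "f m \<ge> 0" for m by (simp add: f_def)
  have sf: "summable f"
    by (rule summable_comparison_test'[OF sums_summable[OF geo], of 0]) (use fle f0 in auto)
  define t where "t = (\<Sum>m. f (m + Suc n))"
  have geo': "(\<lambda>m. (1/4) ^ Suc n * ((1/4::real) * (1/4) ^ m)) sums ((1/4) ^ Suc n * ((1/4) * (1 / (1 - 1/4))))"
    using sums_mult[OF geo] .
  have fle': "f (m + Suc n) \<le> (1/4) ^ Suc n * ((1/4) * (1/4) ^ m)" for m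
    using fle[of "m + Suc n"] by (simp add: power_add mult_ac)
  have "t \<le> (1/4) ^ Suc n * ((1/4) * (1 / (1 - 1/4)))"
    unfolding t_def using sf summable_ignore_initial_segment[OF sf, of "Suc n"]
    by (intro sums_le[OF _ summable_sums geo']) (use fle' in auto)
  then have t: "4 ^ Suc n * t \<le> 1/3" by (simp add: field_simps power_divide)
  have t0: "0 \<le> t" unfolding t_def
    by (intro suminf_nonneg summable_ignore_initial_segment sf f0)
  define k :: int where "k = (\<Sum>m<n. of_bool (b m) * 4 ^ (n - m))"
  have "4 ^ Suc n * (\<Sum>m<Suc n. f m) = (\<Sum>m<Suc n. of_bool (b m) * 4 ^ (n - m))"
    unfolding sum_distrib_left by (intro sum.cong) (auto simp: f_def power_diff field_simps)
  also have "\<dots> = of_int (k + of_bool (b n))" by (simp add: k_def)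
  finally have "4 ^ Suc n * suminf f = of_int (k + of_bool (b n)) + 4 ^ Suc n * t"
    using suminf_split_initial_segment[OF sf, of "Suc n"] by (simp add: t_def algebra_simps)
  then have "\<lfloor>4 ^ Suc n * suminf f\<rfloor> = k + of_bool (b n)"
    using t t0 by (intro floor_unique) auto
  moreover have "even k" unfolding k_def
    by (intro dvd_sum) (auto)
  ultimately show ?thesis by (simp add: f_def[abs_def])
qed

context polish begin

text \<open>A Borel injection into the reals that lists, as base-4 digits, the base balls
  containing a point, with a Borel left inverse that reads the point off as a limit of
  centres of such balls.\<close>

lemma real_coding:
  obtains g :: "'a \<Rightarrow> real" and h :: "real \<Rightarrow> 'a"
  where "g \<in> borel_measurable borelM" "h \<in> measurable borel borelM" "\<And>x. x \<in> M \<Longrightarrow> h (g x) = x"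
proof -
  define g where "g x = (\<Sum>n. of_bool (x \<in> base_ball n) / 4 ^ Suc n :: real)" for x
  have dig: "odd \<lfloor>4 ^ Suc n * g x\<rfloor> \<longleftrightarrow> x \<in> base_ball n" for n x
    unfolding g_def using digit_of_sum[of n "\<lambda>n. x \<in> base_ball n"] by simp
  have Bm: "base_ball n \<in> sets borelM" for n by (simp add: openin_sets)
  have gm: "g \<in> borel_measurable borelM"
    unfolding g_def
  proof (rule borel_measurable_suminf)
    fix n
    have "(\<lambda>x. of_bool (x \<in> base_ball n) / 4 ^ Suc n :: real) = (\<lambda>x. indicator (base_ball n) x / 4 ^ Suc n)"
      by (auto simp: indicator_def)
    then show "(\<lambda>x. of_bool (x \<in> base_ball n) / 4 ^ Suc n :: real) \<in> borel_measurable borelM"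
      using Bm by simp
  qed
  \<comment> \<open>For a code y = g x this is the index of a centre within 1/(k+1) of x, read off
    the digits; taking the \<open>LEAST\<close> one keeps the choice Borel.\<close>
  define sel :: "nat \<Rightarrow> real \<Rightarrow> nat" where "sel k y = (LEAST j. odd \<lfloor>4 ^ Suc (prod_encode (j,k)) * y\<rfloor>)" for k y
  have sel[measurable]: "sel k \<in> measurable borel (count_space UNIV)" for k
    unfolding sel_def by measurable
  define p where "p k y = dense_seq (sel k y)" for k y
  have pM[simp]: "p k y \<in> M" for k y by (simp add: p_def)
  have pd[measurable]: "(\<lambda>y. d c (p k y)) \<in> borel_measurable borel" for c k
    unfolding p_def by (rule measurable_compose[OF sel]) simp
  have pdd[measurable]: "(\<lambda>y. d (p l y) (p k y)) \<in> borel_measurable borel" for l k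
    unfolding p_def
    by (rule measurable_compose_countable[OF _ sel, of "\<lambda>i y. d (dense_seq i) (dense_seq (sel k y))"])
       (rule measurable_compose[OF sel], simp)
  have near: "d (p k (g x)) x < 1 / real (Suc k)" if "x \<in> M" for k x
  proof -
    have "\<exists>j. d (dense_seq j) x < 1 / real (Suc k)"
      by (rule dense_seq_approx[OF that]) simp
    then obtain j where "d (dense_seq j) x < 1 / real (Suc k)" ..
    then have "odd \<lfloor>4 ^ Suc (prod_encode (j,k)) * g x\<rfloor>"
      unfolding dig using that by (simp add: base_ball_encode)
    then have "odd \<lfloor>4 ^ Suc (prod_encode (sel k (g x),k)) * g x\<rfloor>"
      unfolding sel_def by (rule LeastI)
    then show ?thesis unfolding dig by (simp add: base_ball_encode p_def)
  qed
  \<comment> \<open>The Cauchy condition is phrased with quantifiers over naturals only, which makes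
    Z a Borel set. Outside Z the centres do not converge, and h will take a default value.\<close>
  define Z where "Z = {y. \<forall>m. \<exists>N. \<forall>k l. N \<le> k \<longrightarrow> N \<le> l \<longrightarrow> d (p k y) (p l y) < 1 / real (Suc m)}"
  have Zm[measurable]: "Z \<in> sets borel" unfolding Z_def by measurable
  have Zlim: "\<exists>l. limitin mtopology (\<lambda>k. p k y) l sequentially" if "y \<in> Z" for y
  proof -
    have "MCauchy (\<lambda>k. p k y)"
      unfolding MCauchy_def
    proof (intro conjI allI impI)
      show "range (\<lambda>k. p k y) \<subseteq> M" by auto
      fix e :: real assume "0 < e"
      then obtain m where "1 / real (Suc m) < e" using nat_approx_posE by metis
      then show "\<exists>N. \<forall>n n'. N \<le> n \<longrightarrow> N \<le> n' \<longrightarrow> d (p n y) (p n' y) < e"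
        using that unfolding Z_def by (smt (verit) mem_Collect_eq)
    qed
    then show ?thesis using complete unfolding mcomplete_def by blast
  qed
  define h where "h y = (if y \<in> Z then SOME l. limitin mtopology (\<lambda>k. p k y) l sequentially else dense_seq 0)" for y
  have hlim: "limitin mtopology (\<lambda>k. p k y) (h y) sequentially" if "y \<in> Z" for y
    using someI_ex[OF Zlim[OF that]] that by (simp add: h_def)
  have hM: "h y \<in> M" for y
    by (cases "y \<in> Z") (use hlim limitin_mspace in blast, simp add: h_def)
  have hd: "(\<lambda>k. d c (p k y)) \<longlonglongrightarrow> d c (h y)" if "y \<in> Z" "c \<in> M" for y c
  proof -
    have "(\<lambda>k. d (p k y) (h y)) \<longlonglongrightarrow> 0"
      using hlim[OF that(1)] unfolding limitin_metric_dist_null by blast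
    moreover have "\<bar>d c (p k y) - d c (h y)\<bar> \<le> d (p k y) (h y)" for k
      using mdist_reverse_triangle[of "p k y" c "h y"] hM that commute by simp
    ultimately show ?thesis
      by (intro Lim_transform_bound[of "\<lambda>k. d c (p k y) - d c (h y)", THEN LIM_zero_cancel]) auto
  qed
  have hm: "h \<in> measurable borel borelM"
  proof (rule measurable_borelM_I)
    fix c r assume c: "c \<in> M"
    \<comment> \<open>A distance to the limit point is a limit of real distances, so measurability
      of h reduces to that of \<open>lim\<close> for real sequences.\<close>
    have "d c (h y) = (if y \<in> Z then lim (\<lambda>k. d c (p k y)) else d c (dense_seq 0))" for y
    proof (cases "y \<in> Z")
      case True
      then show ?thesis using limI[OF hd[OF True c]] by simp
    qed (simp add: h_def)
    moreover have "(\<lambda>y. if y \<in> Z then lim (\<lambda>k. d c (p k y)) else d c (dense_seq 0)) \<in> borel_measurable borel"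
      by measurable
    ultimately have [measurable]: "(\<lambda>y. d c (h y)) \<in> borel_measurable borel" by presburger
    show "{x \<in> space borel. d c (h x) < r} \<in> sets borel" by measurable
  qed (rule hM)
  have hg: "h (g x) = x" if x: "x \<in> M" for x
  proof -
    have lim: "limitin mtopology (\<lambda>k. p k (g x)) x sequentially"
      unfolding limitin_metric
    proof (intro conjI allI impI)
      fix e :: real assume "0 < e"
      then obtain m where m: "1 / real (Suc m) < e" using nat_approx_posE by metis
      have "d (p k (g x)) x < e" if "k \<ge> m" for k
        using near[OF x, of k] m that frac_le[of 1 1 "real (Suc m)" "real (Suc k)"] by simp
      then show "\<forall>\<^sub>F k in sequentially. p k (g x) \<in> M \<and> d (p k (g x)) x < e"
        using eventually_sequentially by auto
    qed (rule x)
    have "MCauchy (\<lambda>k. p k (g x))"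
      by (rule convergent_imp_MCauchy[OF _ lim]) auto
    then have "g x \<in> Z" unfolding Z_def MCauchy_def by auto
    from hlim[OF this] lim show ?thesis
      using limitin_metric_unique by (metis trivial_limit_sequentially)
  qed
  show ?thesis using that[OF gm hm hg] by blast
qed

end

section \<open>Lebesgue measure on [0,1) and parametrizations of laws on Polish spaces\<close>

lemma space_I01 [simp]: "space I01 = {0..<1}"
  by (simp add: I01_def space_restrict_space)

lemma sets_I01: "A \<in> sets I01 \<longleftrightarrow> A \<in> sets borel \<and> A \<subseteq> {0..<1}"
  by (auto simp: I01_def sets_restrict_space_iff)

lemma emeasure_I01: "A \<in> sets I01 \<Longrightarrow> emeasure I01 A = emeasure lborel A"
  unfolding sets_I01 unfolding I01_def by (subst emeasure_restrict_space) auto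

lemma measure_I01: "A \<in> sets I01 \<Longrightarrow> measure I01 A = measure lborel A"
  by (simp add: measure_def emeasure_I01)

interpretation I01: prob_space I01
  by (rule prob_spaceI) (simp add: I01_def space_restrict_space emeasure_restrict_space)

lemma sets_I01_top [measurable, simp]: "{0..<1} \<in> sets I01"
  by (simp add: sets_I01)

lemma measurable_I01: "f \<in> measurable borel N \<Longrightarrow> f \<in> measurable I01 N"
  by (simp add: I01_def measurable_restrict_space1)

lemma I01_preimage:
  assumes "f \<in> measurable I01 N" "E \<in> sets N"
  shows "{s\<in>{0..<1}. f s \<in> E} \<in> sets I01"
  using measurable_sets[OF assms] by (simp add: vimage_def Int_def conj_commute)

lemma emeasure_distr_I01:
  assumes "f \<in> measurable I01 N" "E \<in> sets N"
  shows "emeasure (distr I01 N f) E = emeasure I01 {s\<in>{0..<1}. f s \<in> E}"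
  using assms by (subst emeasure_distr) (auto simp: vimage_def Int_def conj_commute)

lemma AE_I01_neq: "AE s in I01. s \<noteq> c"
proof (rule AE_I')
  show "{s \<in> space I01. \<not> s \<noteq> c} \<subseteq> {c} \<inter> {0..<1}" by auto
  have "{c} \<inter> {0..<1} \<in> sets I01" by (auto simp: sets_I01)
  then show "{c} \<inter> {0..<1} \<in> null_sets I01"
    by (auto simp: null_sets_def emeasure_I01 intro!: emeasure_lborel_countable)
qed

context polish begin

text \<open>Carry \<nu> to the line by the coding g, take the quantile function of the image law,
  and return by h. Without atoms the distribution function is continuous and undoes the quantile
  function, which gives the left inverse; it will allow subsets of a space to be prescribed by
  subsets of the parameter interval.\<close>

lemma param_exists:
  assumes "prob_space \<nu>" "sets \<nu> = sets borelM"
  shows "\<exists>\<phi>\<in>measurable I01 borelM. distr I01 borelM \<phi> = \<nu> \<and>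
    ((\<forall>x\<in>M. measure \<nu> {x} = 0) \<longrightarrow>
      (\<exists>k\<in>borel_measurable borelM. AE s in I01. k (\<phi> s) = s))"
proof -
  interpret \<nu>: prob_space \<nu> by fact
  obtain g :: "'a \<Rightarrow> real" and h :: "real \<Rightarrow> 'a"
    where gm0: "g \<in> borel_measurable borelM" and hm[measurable]: "h \<in> measurable borel borelM"
      and hg: "\<And>x. x \<in> M \<Longrightarrow> h (g x) = x"
    using real_coding by blast
  have sp: "space \<nu> = M" using sets_eq_imp_space_eq[OF assms(2)] by simp
  have gm: "g \<in> borel_measurable \<nu>" using gm0 measurable_cong_sets[OF assms(2) refl] by blast
  define G where "G = distr \<nu> borel g"
  interpret G: prob_space G unfolding G_def by (rule \<nu>.prob_space_distr[OF gm])
  interpret G: cdf_distribution G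
    unfolding cdf_distribution_def real_distribution_def real_distribution_axioms_def
    using G.prob_space_axioms by (auto simp: G_def)
  \<comment> \<open>The quantile function lives on the open interval; the parameter 0, a null set,
    gets a default value.\<close>
  define Q where "Q s = (if s \<in> {0<..<1} then Inf {x. s \<le> cdf G x} else 0)" for s
  have Qm: "Q \<in> borel_measurable borel"
    unfolding Q_def using G.measurable_CI by (subst (asm) measurable_restrict_space_iff) auto
  have Qm'[measurable]: "Q \<in> borel_measurable I01" by (rule measurable_I01[OF Qm])
  have QG: "distr I01 borel Q = G"
  proof (rule measure_eqI)
    fix A assume "A \<in> sets (distr I01 borel Q)"
    then have A: "A \<in> sets borel" by simp
    have S1: "{s\<in>{0..<1}. Q s \<in> A} \<in> sets I01"
      by (rule I01_preimage[OF Qm' A])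
    have S2: "{s\<in>{0<..<1}. Q s \<in> A} \<in> sets borel"
      using Qm A by measurable
    have "emeasure (distr I01 borel Q) A = emeasure I01 {s\<in>{0..<1}. Q s \<in> A}"
      by (rule emeasure_distr_I01[OF Qm' A])
    also have "\<dots> = emeasure lborel {s\<in>{0..<1}. Q s \<in> A}" by (rule emeasure_I01[OF S1])
    also have "\<dots> = emeasure lborel {s\<in>{0<..<1}. Q s \<in> A}"
    proof (rule emeasure_eq_AE)
      show "AE x in lborel. (x \<in> {s \<in> {0..<1}. Q s \<in> A}) = (x \<in> {s \<in> {0<..<1}. Q s \<in> A})"
        using AE_lborel_singleton[of 0] by eventually_elim auto
      show "{s \<in> {0..<1}. Q s \<in> A} \<in> sets lborel" using S1 by (auto simp: sets_I01)
      show "{s \<in> {0<..<1}. Q s \<in> A} \<in> sets lborel" using S2 by simp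
    qed
    also have "\<dots> = emeasure (distr (restrict_space lborel {0<..<1}) borel (\<lambda>s. Inf {x. s \<le> cdf G x})) A"
    proof -
      have *: "(\<lambda>s. Inf {x. s \<le> cdf G x}) -` A \<inter> {0<..<1} = {s \<in> {0<..<1}. Q s \<in> A}"
        by (auto simp: Q_def)
      have m: "(\<lambda>s. Inf {x. s \<le> cdf G x}) \<in> borel_measurable (restrict_space lborel {0<..<1})"
        using G.measurable_CI by (simp add: measurable_cong_sets[OF sets_restrict_space_cong[OF sets_lborel] refl])
      show ?thesis
        by (subst emeasure_distr[OF m A])
          (use * in \<open>simp add: space_restrict_space\<close>, subst emeasure_restrict_space, auto)
    qed
    finally show "emeasure (distr I01 borel Q) A = emeasure G A"
      by (simp add: G.distr_I_eq_M)
  qed (simp add: G_def)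
  define \<phi> where "\<phi> s = h (Q s)" for s
  have \<phi>m: "\<phi> \<in> measurable I01 borelM" unfolding \<phi>_def by measurable
  have "distr I01 borelM \<phi> = distr (distr I01 borel Q) borelM h"
    by (subst distr_distr) (auto simp: \<phi>_def[abs_def] o_def)
  also have "\<dots> = distr \<nu> borelM (h \<circ> g)"
    unfolding QG G_def by (rule distr_distr[OF hm gm])
  also have "\<dots> = distr \<nu> \<nu> (\<lambda>x. x)"
    by (rule distr_cong) (use hg sp assms(2) in auto)
  finally have law: "distr I01 borelM \<phi> = \<nu>" by (simp add: distr_id)
  have "\<exists>k\<in>borel_measurable borelM. AE s in I01. k (\<phi> s) = s" if diff: "\<forall>x\<in>M. measure \<nu> {x} = 0"
  proof
    show "(\<lambda>x. cdf G (g x)) \<in> borel_measurable borelM"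
      using gm0 by measurable
    \<comment> \<open>As g is injective on M, the preimage of y is empty or one point, which has
      measure 0 by assumption.\<close>
    have "measure G {y} = 0" for y
    proof -
      have "measure G {y} = measure \<nu> (g -` {y} \<inter> M)"
        unfolding G_def using gm sp by (subst measure_distr) auto
      also have "g -` {y} \<inter> M \<subseteq> {h y} \<inter> M" using hg by auto
      then have "measure \<nu> (g -` {y} \<inter> M) = 0"
        using diff subset_singleton_iff[of "g -` {y} \<inter> M" "h y"] by (cases "h y \<in> M") fastforce+
      finally show ?thesis .
    qed
    then have cont: "isCont (cdf G) x" for x using G.isCont_cdf by blast
    \<comment> \<open>Left of the quantile the distribution function is at most s, and by continuity
      it cannot jump above s at the quantile itself.\<close>
    have CQ: "cdf G (Q s) = s" if s: "s \<in> {0<..<1}" for s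
    proof (rule antisym)
      have eq: "s \<le> cdf G x \<longleftrightarrow> Q s \<le> x" for x
        using G.pseudoinverse'[rule_format, OF s, of x] s by (simp add: Q_def)
      then show "s \<le> cdf G (Q s)" by simp
      have ev: "\<forall>\<^sub>F x in at_left (Q s). cdf G x \<le> s"
      proof (rule eventually_mono)
        show "\<forall>\<^sub>F x in at_left (Q s). x \<in> {Q s - 1<..<Q s}"
          by (rule eventually_at_left_real) simp
        fix x assume "x \<in> {Q s - 1<..<Q s}"
        then have "\<not> Q s \<le> x" by simp
        then show "cdf G x \<le> s" using eq[of x] by simp
      qed
      have "(cdf G \<longlongrightarrow> cdf G (Q s)) (at_left (Q s))"
        using cont[of "Q s"] unfolding isCont_def by (rule filterlim_mono[OF _ order_refl]) (simp add: at_le)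
      then show "cdf G (Q s) \<le> s"
        by (rule tendsto_upperbound[OF _ ev]) simp
    qed
    have "AE y in G. g (h y) = y"
      unfolding G_def
    proof (subst AE_distr_iff[OF gm])
      have "(\<lambda>y. g (h y)) \<in> borel_measurable borel" using gm0 by measurable
      then show "{y \<in> space borel. g (h y) = y} \<in> sets borel" by measurable
      show "AE x in \<nu>. g (h (g x)) = g x" using hg sp by (intro AE_I2) auto
    qed
    then have "AE s in I01. g (h (Q s)) = Q s"
      unfolding QG[symmetric] by (rule AE_distrD[OF Qm'])
    then show "AE s in I01. cdf G (g (\<phi> s)) = s"
      using AE_I01_neq[of 0] AE_space
    proof eventually_elim
      case (elim s)
      then show ?case using CQ[of s] by (simp add: \<phi>_def)
    qed
  qed
  then show ?thesis using \<phi>m law by blast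
qed

end

section \<open>Parametrizations adapted to atoms\<close>

text \<open>The atom of index i will be parametrized by the i-th of these consecutive intervals.
  With this fixed layout, parametrizations of spaces with close atom sequences match up index by
  index.\<close>

definition psum :: "(nat \<Rightarrow> real) \<Rightarrow> nat \<Rightarrow> real" where "psum a k = (\<Sum>i<k. a i)"
definition stepint :: "(nat \<Rightarrow> real) \<Rightarrow> nat \<Rightarrow> real set" where
  "stepint a i = {psum a i..<psum a (Suc i)}"
definition stepidx :: "(nat \<Rightarrow> real) \<Rightarrow> real \<Rightarrow> nat" where
  "stepidx a s = (LEAST k. s < psum a (Suc k))"

lemma psum_0 [simp]: "psum a 0 = 0" by (simp add: psum_def)
lemma psum_Suc: "psum a (Suc k) = psum a k + a k" by (simp add: psum_def)

context
  fixes a :: "nat \<Rightarrow> real"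
  assumes a: "a \<in> A_seq"
begin

lemma A_seq_nonneg: "0 \<le> a i" and A_seq_summable: "summable a"
  and A_seq_total: "suminf a \<le> 1" and A_seq_antimono: "i \<le> j \<Longrightarrow> a j \<le> a i"
  using a by (auto simp: A_seq_def decseq_def)

lemma psum_mono: "i \<le> j \<Longrightarrow> psum a i \<le> psum a j"
  unfolding psum_def by (rule sum_mono2) (auto simp: A_seq_nonneg)

lemma psum_nonneg: "0 \<le> psum a i"
  unfolding psum_def by (simp add: A_seq_nonneg sum_nonneg)

lemma psum_le: "psum a i \<le> suminf a"
  unfolding psum_def by (rule sum_le_suminf) (auto simp: A_seq_nonneg A_seq_summable)

lemma psum_le_1: "psum a i \<le> 1"
  using psum_le A_seq_total order_trans by blast

text \<open>By monotonicity i + 1 entries are at least a i, and their sum is at most 1. The bound is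
  uniform over \<open>A_seq\<close>, so one finite set of indices contains the large atoms of all
  sequences at once.\<close>

lemma A_seq_le_inverse: "a i \<le> 1 / real (Suc i)"
proof -
  have "real (Suc i) * a i = (\<Sum>j<Suc i. a i)" by simp
  also have "\<dots> \<le> psum a (Suc i)"
    unfolding psum_def by (rule sum_mono) (auto intro: A_seq_antimono)
  finally show ?thesis using psum_le_1[of "Suc i"] by (simp add: field_simps)
qed

lemma A_seq_le_1: "a i \<le> 1"
  by (rule order_trans[OF A_seq_le_inverse]) auto

lemma psum_lim: "psum a \<longlonglongrightarrow> suminf a"
  unfolding psum_def using A_seq_summable by (rule summable_LIMSEQ)

lemma stepidx_less: "s < suminf a \<Longrightarrow> s < psum a (Suc (stepidx a s))"
  unfolding stepidx_def
proof (rule LeastI_ex)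
  assume "s < suminf a"
  then have "\<forall>\<^sub>F n in sequentially. s < psum a n" using psum_lim order_tendstoD(1) by blast
  then obtain N where "\<And>n. n \<ge> N \<Longrightarrow> s < psum a n" unfolding eventually_sequentially by blast
  then show "\<exists>k. s < psum a (Suc k)" using le_Suc_eq by blast
qed

lemma stepidx_eq: "s \<in> stepint a i \<Longrightarrow> stepidx a s = i"
  unfolding stepidx_def stepint_def
proof (rule Least_equality)
  assume s: "s \<in> {psum a i..<psum a (Suc i)}"
  then show "s < psum a (Suc i)" by simp
  fix k assume "s < psum a (Suc k)"
  then have "psum a i < psum a (Suc k)" using s by simp
  then show "i \<le> k" using psum_mono[of "Suc k" i] by force
qed

lemma stepint_cover: "0 \<le> s \<Longrightarrow> s < suminf a \<Longrightarrow> s \<in> stepint a (stepidx a s)"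
proof -
  assume s: "0 \<le> s" "s < suminf a"
  have "psum a (stepidx a s) \<le> s"
  proof (cases "stepidx a s")
    case (Suc k)
    then have "\<not> s < psum a (Suc k)" unfolding stepidx_def using not_less_Least by (metis lessI)
    then show ?thesis using Suc by simp
  qed (use s in simp)
  then show ?thesis using stepidx_less s unfolding stepint_def by simp
qed

lemma stepint_iff: "s \<in> stepint a i \<longleftrightarrow> 0 \<le> s \<and> s < suminf a \<and> stepidx a s = i"
proof
  assume s: "s \<in> stepint a i"
  then show "0 \<le> s \<and> s < suminf a \<and> stepidx a s = i"
    using stepidx_eq[OF s] psum_nonneg[of i] psum_le[of "Suc i"] by (auto simp: stepint_def)
qed (use stepint_cover in auto)

lemma disjoint_stepint: "disjoint_family (stepint a)"
  unfolding disjoint_family_on_def using stepidx_eq by (metis disjoint_iff)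

lemma stepint_sets [measurable]: "stepint a i \<in> sets I01"
  unfolding sets_I01 stepint_def using psum_nonneg[of i] psum_le_1[of "Suc i"] by auto

lemma emeasure_stepint: "emeasure I01 (stepint a i) = ennreal (a i)"
  using psum_mono[of i "Suc i"] by (simp add: emeasure_I01 stepint_sets) (simp add: stepint_def psum_Suc)

lemma measure_stepint: "measure I01 (stepint a i) = a i"
  using emeasure_stepint[of i] A_seq_nonneg by (simp add: measure_def)

lemma measurable_stepidx [measurable]: "stepidx a \<in> measurable borel (count_space UNIV)"
  unfolding stepidx_def by measurable

end

lemma emeasure_lborel_affine_vimage:
  fixes t r :: real
  assumes r: "r > 0" and A: "A \<in> sets borel"
  shows "emeasure lborel ((\<lambda>x. (x - t) / r) -` A) = ennreal r * emeasure lborel A"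
proof -
  have A': "(\<lambda>x. (x - t) / r) -` A \<in> sets borel"
    using measurable_sets[of "\<lambda>x::real. (x - t) / r" borel borel A] A by simp
  have "emeasure lborel ((\<lambda>x. (x - t) / r) -` A) =
      emeasure (density (distr lborel borel (\<lambda>x. t + r * x)) (\<lambda>_. ennreal \<bar>r\<bar>)) ((\<lambda>x. (x - t) / r) -` A)"
    using lborel_real_affine[of r t] r by simp
  also have "\<dots> = ennreal r * emeasure (distr lborel borel (\<lambda>x. t + r * x)) ((\<lambda>x. (x - t) / r) -` A)"
    using r A' by (subst emeasure_density_const) auto
  also have "emeasure (distr lborel borel (\<lambda>x. t + r * x)) ((\<lambda>x. (x - t) / r) -` A) = emeasure lborel A"
    using A' by (subst emeasure_distr) (use r in \<open>auto simp: vimage_def\<close>)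
  finally show ?thesis .
qed

text \<open>Pulling back along the affine map of [t,1) onto [0,1) multiplies Lebesgue measure by r.
  This places a parametrization of a normalized remainder on the interval left free by the
  atoms.\<close>

lemma I01_rescaled_preimage:
  assumes r: "r > 0" "t \<ge> 0" "t + r = 1" and f: "f \<in> measurable I01 N" and E: "E \<in> sets N"
  shows "{s\<in>{t..<1}. f ((s - t) / r) \<in> E} \<in> sets I01"
    and "emeasure I01 {s\<in>{t..<1}. f ((s - t) / r) \<in> E} = ennreal r * emeasure I01 {s\<in>{0..<1}. f s \<in> E}"
proof -
  have S: "{s\<in>{0..<1}. f s \<in> E} \<in> sets I01" by (rule I01_preimage[OF f E])
  then have S': "{s\<in>{0..<1}. f s \<in> E} \<in> sets borel" by (auto simp: sets_I01)
  have eq: "{s\<in>{t..<1}. f ((s - t) / r) \<in> E} = (\<lambda>x. (x - t) / r) -` {s\<in>{0..<1}. f s \<in> E}"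
    using r by (auto simp: field_simps)
  have "{s\<in>{t..<1}. f ((s - t) / r) \<in> E} \<in> sets borel"
    unfolding eq using measurable_sets[of "\<lambda>x::real. (x - t) / r" borel borel, OF _ S'] by simp
  then show T: "{s\<in>{t..<1}. f ((s - t) / r) \<in> E} \<in> sets I01" using r by (auto simp: sets_I01)
  show "emeasure I01 {s\<in>{t..<1}. f ((s - t) / r) \<in> E} = ennreal r * emeasure I01 {s\<in>{0..<1}. f s \<in> E}"
    unfolding emeasure_I01[OF S] emeasure_I01[OF T] unfolding eq
    by (rule emeasure_lborel_affine_vimage[OF r(1) S'])
qed

text \<open>The measure dominates the sum of the point masses a i at x i. Several indices may share
  a point, so the condition is stated for finite sets of indices.\<close>

definition atoms_fit :: "'a measure \<Rightarrow> (nat \<Rightarrow> real) \<Rightarrow> (nat \<Rightarrow> 'a) \<Rightarrow> bool" where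
  "atoms_fit \<mu> a x \<longleftrightarrow> (\<forall>i. x i \<in> space \<mu>) \<and>
     (\<forall>I p. finite I \<longrightarrow> (\<forall>i\<in>I. x i = p) \<longrightarrow> sum a I \<le> measure \<mu> {p})"

text \<open>A complete list of the atoms without repetition. Where a i = 0 the point x i is left
  unconstrained and may even lie outside the space.\<close>

definition atoms_exact :: "'a measure \<Rightarrow> (nat \<Rightarrow> real) \<Rightarrow> (nat \<Rightarrow> 'a) \<Rightarrow> bool" where
  "atoms_exact \<mu> a x \<longleftrightarrow> inj_on x {i. 0 < a i} \<and> (\<forall>i. 0 < a i \<longrightarrow> x i \<in> space \<mu> \<and> measure \<mu> {x i} = a i) \<and>
     (\<forall>p\<in>space \<mu> - x ` {i. 0 < a i}. measure \<mu> {p} = 0)"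

text \<open>Zero entries do not change a sum, so only nonempty sets of indices with positive entries
  need testing; then p is one of the listed points, hence a point of the space.\<close>

lemma atoms_fit_I:
  assumes a: "a \<in> A_seq" and x: "\<And>i. x i \<in> space \<mu>"
    and le: "\<And>I p. finite I \<Longrightarrow> I \<noteq> {} \<Longrightarrow> (\<And>i. i \<in> I \<Longrightarrow> 0 < a i \<and> x i = p) \<Longrightarrow> sum a I \<le> measure \<mu> {p}"
  shows "atoms_fit \<mu> a x"
  unfolding atoms_fit_def
proof (intro conjI allI impI x)
  fix I p assume I: "finite I" "\<forall>i\<in>I. x i = p"
  have "sum a I = sum a {i\<in>I. 0 < a i}"
    using I(1) A_seq_nonneg[OF a] by (intro sum.mono_neutral_right) (auto simp: order_less_le)
  also have "\<dots> \<le> measure \<mu> {p}"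
  proof (cases "{i\<in>I. 0 < a i} = {}")
    case True
    then show ?thesis by (simp only: sum.empty measure_nonneg)
  next
    case False
    then show ?thesis by (rule le[rotated]) (use I in simp_all)
  qed
  finally show "sum a I \<le> measure \<mu> {p}" .
qed

context polish begin

lemma sum_atoms_le:
  assumes "prob_space \<mu>" "sets \<mu> = sets borelM" "atoms_fit \<mu> a x" "E \<in> sets \<mu>" "finite I" "\<And>i. i \<in> I \<Longrightarrow> x i \<in> E"
  shows "sum a I \<le> measure \<mu> E"
proof -
  interpret prob_space \<mu> by fact
  have sp: "space \<mu> = M" using sets_eq_imp_space_eq[OF assms(2)] by simp
  have xM: "x i \<in> M" for i using assms(3) sp by (simp add: atoms_fit_def)
  have "sum a I = (\<Sum>p\<in>x ` I. sum a {i\<in>I. x i = p})"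
    using sum.image_gen[OF \<open>finite I\<close>] by blast
  also have "\<dots> \<le> (\<Sum>p\<in>x ` I. measure \<mu> {p})"
    using assms(3,5) by (intro sum_mono) (simp add: atoms_fit_def)
  also have "\<dots> = measure \<mu> (x ` I)"
    by (rule finite_measure_eq_sum_singleton[symmetric]) (use assms xM in auto)
  also have "\<dots> \<le> measure \<mu> E"
    using assms by (intro finite_measure_mono) auto
  finally show ?thesis .
qed

text \<open>On [0,t), with t the total of a, the step map with value x i on interval i produces a
  measure N below \<mu>; the remainder \<mu> - N has mass 1 - t and is parametrized on [t,1) after
  rescaling. If the list of atoms is exact, the remainder is diffuse, so the parameter can be
  recovered there, and on an atom the left end of its interval is returned.\<close>

lemma nice_param:
  assumes \<mu>: "prob_space \<mu>" "sets \<mu> = sets borelM" and a: "a \<in> A_seq" and x: "atoms_fit \<mu> a x"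
  shows "\<exists>\<phi>\<in>measurable I01 borelM. distr I01 borelM \<phi> = \<mu> \<and>
    (\<forall>i. \<forall>s\<in>stepint a i. \<phi> s = x i) \<and>
    (atoms_exact \<mu> a x \<longrightarrow> (\<exists>k\<in>borel_measurable borelM.
       (\<forall>i. \<forall>s\<in>stepint a i. k (\<phi> s) = psum a i) \<and> (AE s in I01. suminf a \<le> s \<longrightarrow> k (\<phi> s) = s)))"
proof -
  interpret prob_space \<mu> by fact
  have sp: "space \<mu> = M" using sets_eq_imp_space_eq[OF \<mu>(2)] by simp
  have xM[simp]: "x i \<in> M" for i using x sp by (simp add: atoms_fit_def)
  define t where "t = suminf a"
  have t0: "0 \<le> t" unfolding t_def using psum_nonneg[OF a, of 0] psum_le[OF a, of 0] by simp
  have t1: "t \<le> 1" unfolding t_def using A_seq_total[OF a] .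
  define st where "st s = x (stepidx a s)" for s
  have st[measurable]: "st \<in> measurable borel borelM"
    unfolding st_def by (rule measurable_compose[OF measurable_stepidx[OF a]]) simp
  note st' = measurable_I01[OF st]
  define N where "N = distr (density I01 (indicator {0..<t})) borelM st"
  have T: "{0..<t} \<in> sets I01" using t1 by (auto simp: sets_I01)
  have NE: "emeasure N E = emeasure I01 {s\<in>{0..<t}. st s \<in> E}"
    and NE': "{s\<in>{0..<t}. st s \<in> E} \<in> sets I01" if E: "E \<in> sets borelM" for E
  proof -
    have S: "{s\<in>{0..<1}. st s \<in> E} \<in> sets I01" by (rule I01_preimage[OF st' E])
    have eq: "{s\<in>{0..<t}. st s \<in> E} = {s\<in>{0..<1}. st s \<in> E} \<inter> {0..<t}" using t1 by auto
    show "{s\<in>{0..<t}. st s \<in> E} \<in> sets I01" unfolding eq using S T by blast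
    have "emeasure N E = emeasure (density I01 (indicator {0..<t})) {s\<in>{0..<1}. st s \<in> E}"
      unfolding N_def using st' E by (subst emeasure_distr) (auto simp: vimage_def Int_def conj_commute)
    also have "\<dots> = emeasure I01 {s\<in>{0..<t}. st s \<in> E}"
      unfolding eq using S T by (subst emeasure_density)
        (auto simp flip: indicator_inter_arith intro!: arg_cong[where f = "emeasure I01"])
    finally show "emeasure N E = emeasure I01 {s\<in>{0..<t}. st s \<in> E}" .
  qed
  have Nsum: "emeasure N E = (\<Sum>i. ennreal (if x i \<in> E then a i else 0))" if E: "E \<in> sets borelM" for E
  proof -
    define J where "J i = (if x i \<in> E then stepint a i else {})" for i
    have "{s\<in>{0..<t}. st s \<in> E} = (\<Union>i. J i)"
      using stepint_iff[OF a] by (auto simp: J_def st_def t_def split: if_splits)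
    then have "emeasure N E = emeasure I01 (\<Union>i. J i)" using NE[OF E] by simp
    also have "\<dots> = (\<Sum>i. emeasure I01 (J i))"
      using disjoint_stepint[OF a] stepint_sets[OF a]
      by (intro suminf_emeasure[symmetric]) (auto simp: J_def disjoint_family_on_def)
    also have "\<dots> = (\<Sum>i. ennreal (if x i \<in> E then a i else 0))"
      by (rule suminf_cong) (simp add: J_def emeasure_stepint[OF a])
    finally show ?thesis .
  qed
  have Nle: "emeasure N E \<le> emeasure \<mu> E" if E: "E \<in> sets \<mu>" for E
  proof -
    have "(\<Sum>i<n. ennreal (if x i \<in> E then a i else 0)) \<le> emeasure \<mu> E" for n
    proof -
      have "(\<Sum>i<n. ennreal (if x i \<in> E then a i else 0)) = ennreal (\<Sum>i<n. if x i \<in> E then a i else 0)"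
        by (rule sum_ennreal) (simp add: A_seq_nonneg[OF a])
      also have "(\<Sum>i<n. if x i \<in> E then a i else 0) = sum a {i\<in>{..<n}. x i \<in> E}"
        by (rule sum.inter_filter[symmetric]) simp
      also have "\<dots> \<le> measure \<mu> E"
        by (rule sum_atoms_le[OF \<mu> x E]) auto
      finally show ?thesis by (simp add: emeasure_eq_measure ennreal_leI)
    qed
    then show ?thesis
      using Nsum[of E] E \<mu>(2) suminf_eq_SUP by (simp add: SUP_le_iff suminf_eq_SUP)
  qed
  \<comment> \<open>The part of the law that the step map does not produce. It has mass 1 - t and
    may still contain atoms when the fit is not exact.\<close>
  define \<nu> where "\<nu> = diff_measure \<mu> N"
  have setsN: "sets N = sets borelM" by (simp add: N_def)
  have NM: "emeasure N M = ennreal t"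
  proof -
    have "{s\<in>{0..<t}. st s \<in> M} = {0..<t}" by (auto simp: st_def)
    then show ?thesis using NE[of M] sets.top[of borelM] T t0 by (simp add: emeasure_I01)
  qed
  have fN: "finite_measure N"
    by (rule finite_measureI) (use NM sets_eq_imp_space_eq[OF setsN] in simp)
  have \<nu>E: "emeasure \<nu> E = emeasure \<mu> E - emeasure N E" if "E \<in> sets borelM" for E
    unfolding \<nu>_def using fN finite_measure_axioms Nle that \<mu>(2) setsN
    by (intro emeasure_diff_measure) auto
  have \<nu>sum: "emeasure N E + emeasure \<nu> E = emeasure \<mu> E" if "E \<in> sets borelM" for E
    unfolding \<nu>E[OF that] using Nle[of E] that \<mu>(2) by (simp add: add_diff_inverse_ennreal)
  have sets\<nu>: "sets \<nu> = sets borelM" by (simp add: \<nu>_def \<mu>)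
  have sp\<nu>: "space \<nu> = M" by (simp add: \<nu>_def sp)
  have stJ: "st s = x i" if "s \<in> stepint a i" for s i
    using that stepidx_eq[OF a] by (simp add: st_def)
  define W where "W = x ` {i. 0 < a i}"
  have W: "countable W" "W \<subseteq> M" by (auto simp: W_def)
  note Wm = countable_sets[OF W]
  \<comment> \<open>Overriding k1 on the countable set W preserves measurability. For an exact list
    of atoms the \<open>LEAST\<close> index is the only one.\<close>
  define kk where "kk k1 p = (if p \<in> W then psum a (LEAST i. 0 < a i \<and> x i = p) else k1 p)"
    for k1 :: "'a \<Rightarrow> real" and p
  have kkm: "kk k1 \<in> borel_measurable borelM" if "k1 \<in> borel_measurable borelM" for k1
    by (rule measurable_discrete_difference[OF that W(1)])
      (use W in \<open>auto simp: kk_def\<close>)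
  have kkJ: "kk k1 (x i) = psum a i" if "s \<in> stepint a i" "atoms_exact \<mu> a x" for k1 i s
  proof -
    have ai: "0 < a i" using that(1) by (auto simp: stepint_def psum_Suc)
    then have "(LEAST j. 0 < a j \<and> x j = x i) = i"
      using that(2) unfolding atoms_exact_def inj_on_def by (intro Least_equality) auto
    then show ?thesis using ai by (auto simp: kk_def W_def)
  qed
  show ?thesis
  \<comment> \<open>For t = 1 the remainder has mass 0 and cannot be normalized, so the step map
    alone must serve.\<close>
  proof (cases "t = 1")
    case True
    have law: "distr I01 borelM st = \<mu>"
    proof (rule measure_eqI)
      fix E assume "E \<in> sets (distr I01 borelM st)"
      then have E: "E \<in> sets borelM" by simp
      have "emeasure \<nu> M = 0"
        using \<nu>E[of M] sets.top[of borelM] NM True emeasure_space_1 sp by simp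
      then have "emeasure \<nu> E = 0"
        using emeasure_mono[of E M \<nu>] sets.sets_into_space[OF E] sets.top[of \<nu>] sp\<nu> by simp
      then have "emeasure N E = emeasure \<mu> E" using \<nu>sum[OF E] by simp
      then show "emeasure (distr I01 borelM st) E = emeasure \<mu> E"
        using NE[OF E] True emeasure_distr_I01[OF st' E] by simp
    qed (simp add: \<mu>)
    have "AE s in I01. suminf a \<le> s \<longrightarrow> kk (\<lambda>_. 0) (st s) = s"
      by (rule AE_I2) (use True t_def in auto)
    moreover have "kk (\<lambda>_. 0) \<in> borel_measurable borelM" by (rule kkm) simp
    moreover have "\<forall>i. \<forall>s\<in>stepint a i. kk (\<lambda>_. 0) (st s) = psum a i" if "atoms_exact \<mu> a x"
      using kkJ[OF _ that] stJ by simp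
    ultimately show ?thesis using st' law stJ by blast
  next
    case False
    define r where "r = 1 - t"
    have r: "r > 0" "t + r = 1" using False t1 by (auto simp: r_def)
    define \<nu>' where "\<nu>' = scale_measure (ennreal (1 / r)) \<nu>"
    have \<nu>M: "emeasure \<nu> M = ennreal r"
      using \<nu>E[of M] sets.top[of borelM] NM emeasure_space_1 sp t0 t1
      by (simp add: r_def ennreal_minus flip: ennreal_1)
    have \<nu>': "prob_space \<nu>'" "sets \<nu>' = sets borelM"
    proof
      show "emeasure \<nu>' (space \<nu>') = 1"
        using r \<nu>M by (simp add: \<nu>'_def space_scale_measure sp\<nu> flip: ennreal_mult)
    qed (simp add: \<nu>'_def sets\<nu>)
    have \<nu>'E: "ennreal r * emeasure \<nu>' E = emeasure \<nu> E" for E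
    proof -
      have "ennreal r * (ennreal (1 / r) * emeasure \<nu> E) = emeasure \<nu> E"
        unfolding mult.assoc[symmetric] using r by (simp flip: ennreal_mult)
      then show ?thesis by (simp add: \<nu>'_def)
    qed
    obtain \<phi>0 where \<phi>0: "\<phi>0 \<in> measurable I01 borelM" "distr I01 borelM \<phi>0 = \<nu>'"
      and k0: "\<forall>x\<in>M. measure \<nu>' {x} = 0 \<Longrightarrow>
        \<exists>k\<in>borel_measurable borelM. AE s in I01. k (\<phi>0 s) = s"
      using param_exists[OF \<nu>'] by blast
    have \<phi>0E: "emeasure I01 {s\<in>{0..<1}. \<phi>0 s \<in> E} = emeasure \<nu>' E" if "E \<in> sets borelM" for E
      using emeasure_distr_I01[OF \<phi>0(1) that] by (simp add: \<phi>0(2))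
    define \<phi> where "\<phi> s = (if s < t then st s else \<phi>0 ((s - t) / r))" for s
    have S: "{s\<in>{0..<1}. \<phi> s \<in> E} = {s\<in>{0..<t}. st s \<in> E} \<union> {s\<in>{t..<1}. \<phi>0 ((s - t) / r) \<in> E}" for E
      using t0 t1 by (auto simp: \<phi>_def)
    note R = I01_rescaled_preimage[OF r(1) t0 r(2) \<phi>0(1)]
    have "st s \<in> M" for s by (simp add: st_def)
    moreover have "\<phi>0 ((s - t) / r) \<in> M" if "t \<le> s" "s < 1" for s
      using measurable_space[OF \<phi>0(1), of "(s - t) / r"] r that by (simp add: field_simps)
    ultimately have \<phi>M: "\<phi> s \<in> M" if "s \<in> {0..<1}" for s
      using that by (auto simp: \<phi>_def)
    have \<phi>m: "\<phi> \<in> measurable I01 borelM"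
    proof (rule measurableI)
      fix E assume E: "E \<in> sets borelM"
      have "\<phi> -` E \<inter> space I01 = {s\<in>{0..<1}. \<phi> s \<in> E}" by auto
      then show "\<phi> -` E \<inter> space I01 \<in> sets I01"
        unfolding S using NE'[OF E] R(1)[OF E] by simp
    qed (use \<phi>M in simp)
    have law: "distr I01 borelM \<phi> = \<mu>"
    proof (rule measure_eqI)
      fix E assume "E \<in> sets (distr I01 borelM \<phi>)"
      then have E: "E \<in> sets borelM" by simp
      have "emeasure (distr I01 borelM \<phi>) E = emeasure I01 {s\<in>{0..<1}. \<phi> s \<in> E}"
        by (rule emeasure_distr_I01[OF \<phi>m E])
      also have "\<dots> = emeasure I01 {s\<in>{0..<t}. st s \<in> E} + emeasure I01 {s\<in>{t..<1}. \<phi>0 ((s - t) / r) \<in> E}"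
        unfolding S using NE'[OF E] R(1)[OF E] by (intro plus_emeasure[symmetric]) auto
      also have "\<dots> = emeasure N E + emeasure \<nu> E"
        by (simp only: NE[OF E] R(2)[OF E] \<phi>0E[OF E] \<nu>'E)
      finally show "emeasure (distr I01 borelM \<phi>) E = emeasure \<mu> E"
        using \<nu>sum[OF E] by simp
    qed (simp add: \<mu>)
    have \<phi>J: "\<phi> s = x i" if "s \<in> stepint a i" for s i
      using stJ[OF that] that stepint_iff[OF a, of s i] by (simp add: \<phi>_def t_def)
    have "\<exists>k\<in>borel_measurable borelM.
       (\<forall>i. \<forall>s\<in>stepint a i. k (\<phi> s) = psum a i) \<and> (AE s in I01. suminf a \<le> s \<longrightarrow> k (\<phi> s) = s)"
      if ex: "atoms_exact \<mu> a x"
    proof -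
      have \<nu>0: "emeasure \<nu> {p} = 0" if p: "p \<in> M" for p
      proof (cases "p \<in> W")
        case True
        then obtain i where i: "0 < a i" "x i = p" by (auto simp: W_def)
        have "emeasure \<mu> {p} = ennreal (a i)"
          using ex i by (auto simp: atoms_exact_def emeasure_eq_measure)
        also have "ennreal (a i) = (\<Sum>j\<in>{i}. ennreal (if x j \<in> {p} then a j else 0))" using i by simp
        also have "\<dots> \<le> emeasure N {p}"
          unfolding Nsum[OF singleton_sets[OF p]] by (rule sum_le_suminf) auto
        finally show ?thesis using \<nu>E[OF singleton_sets[OF p]] by (simp add: diff_eq_0_ennreal emeasure_eq_measure)
      next
        case False
        then have "emeasure \<mu> {p} = 0"
          using ex p by (auto simp: atoms_exact_def emeasure_eq_measure W_def sp)
        then show ?thesis using \<nu>E[OF singleton_sets[OF p]] by simp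
      qed
      then have "\<forall>x\<in>M. measure \<nu>' {x} = 0" by (simp add: \<nu>'_def measure_def)
      then obtain k1 where k1: "k1 \<in> borel_measurable borelM" "AE s in I01. k1 (\<phi>0 s) = s"
        using k0 by blast
      \<comment> \<open>The remainder does not charge the atoms, so the override on W spoils the
        left inverse only on a null set of parameters.\<close>
      have "emeasure \<nu>' W = 0"
      proof -
        have "emeasure \<nu> W = (\<integral>\<^sup>+p. emeasure \<nu> {p} \<partial>count_space W)"
          by (rule emeasure_countable_singleton) (use W sets\<nu> in auto)
        also have "\<dots> = (\<integral>\<^sup>+p. 0 \<partial>count_space W)"
          by (rule nn_integral_cong) (use \<nu>0 W in auto)
        finally show ?thesis by (simp add: \<nu>'_def)
      qed
      then have AEW: "AE s in I01. \<phi>0 s \<notin> W"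
        by (intro AE_I'[of "{s\<in>{0..<1}. \<phi>0 s \<in> W}"])
          (use I01_preimage[OF \<phi>0(1) Wm] \<phi>0E[OF Wm] in auto)
      define k where "k = kk (\<lambda>p. t + r * k1 p)"
      have km: "k \<in> borel_measurable borelM" unfolding k_def by (rule kkm) (use k1 in measurable)
      obtain B where B: "B \<in> sets I01" "emeasure I01 B = 0" "{s\<in>{0..<1}. \<not> (k1 (\<phi>0 s) = s \<and> \<phi>0 s \<notin> W)} \<subseteq> B"
        using AE_conjI[OF k1(2) AEW] by (rule AE_E) auto
      have id: "(\<lambda>s. s) \<in> measurable I01 I01" by simp
      have "B \<inter> {0..<1} = B" using B(1) by (auto simp: sets_I01)
      then have B0: "emeasure I01 {s\<in>{t..<1}. (s - t) / r \<in> B} = 0"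
        using I01_rescaled_preimage(2)[OF r(1) t0 r(2) id B(1)] B(2)
        by (simp add: Int_def conj_commute)
      have "AE s in I01. suminf a \<le> s \<longrightarrow> k (\<phi> s) = s"
      proof (rule AE_I')
        show "{s\<in>{t..<1}. (s - t) / r \<in> B} \<in> null_sets I01"
          using B0 I01_rescaled_preimage(1)[OF r(1) t0 r(2) id B(1)] by auto
        show "{s \<in> space I01. \<not> (suminf a \<le> s \<longrightarrow> k (\<phi> s) = s)} \<subseteq> {s\<in>{t..<1}. (s - t) / r \<in> B}"
        proof safe
          fix s assume s: "s \<in> space I01" "suminf a \<le> s" "k (\<phi> s) \<noteq> s"
          then show "s \<in> {t..<1}" by (simp add: t_def)
          show "(s - t) / r \<in> B"
          proof (rule ccontr)
            assume nB: "(s - t) / r \<notin> B"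
            have in01: "(s - t) / r \<in> {0..<1}" using s r by (simp add: t_def field_simps)
            then have *: "k1 (\<phi>0 ((s - t) / r)) = (s - t) / r" "\<phi>0 ((s - t) / r) \<notin> W"
              using B(3) nB by auto
            have "k (\<phi> s) = t + r * ((s - t) / r)"
              using s * by (simp add: \<phi>_def k_def kk_def t_def)
            then show False using s r by simp
          qed
        qed
      qed
      moreover have "\<forall>i. \<forall>s\<in>stepint a i. k (\<phi> s) = psum a i"
        using kkJ[OF _ ex] \<phi>J by (simp add: k_def)
      ultimately show ?thesis using km by blast
    qed
    then show ?thesis using \<phi>m law \<phi>J by blast
  qed
qed

end

section \<open>Box distance and the pyramids of atoms\<close>

lemma mm_space_iff:
  "mm_space X \<longleftrightarrow> polish (mm_pts X) (mm_dist X) \<and> prob_space (mm_meas X) \<and>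
     sets (mm_meas X) = sets (polish.borelM (mm_pts X) (mm_dist X)) \<and>
     (\<forall>x\<in>mm_pts X. \<forall>r>0. measure (mm_meas X) (Metric_space.mball (mm_pts X) (mm_dist X) x r) > 0)"
  (is "_ \<longleftrightarrow> ?R")
proof
  assume X: "mm_space X"
  then interpret prob_space "mm_meas X" by (simp add: mm_space_def)
  have "mm_pts X \<noteq> {}" using X not_empty by (simp add: mm_space_def)
  then have P: "polish (mm_pts X) (mm_dist X)"
    using X by (simp add: mm_space_def polish_def polish_axioms_def)
  then show ?R using X polish.sets_borelM[OF P] by (simp add: mm_space_def)
next
  assume R: ?R
  then have P: "polish (mm_pts X) (mm_dist X)" by simp
  have "space (mm_meas X) = mm_pts X"
    using R sets_eq_imp_space_eq[of "mm_meas X"] polish.space_borelM[OF P] by metis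
  then show "mm_space X"
    using R P polish.sets_borelM[OF P] by (simp add: mm_space_def polish_def polish_axioms_def)
qed

locale mm =
  fixes X :: mm
  assumes mm_space: "mm_space X"
begin

sublocale polish "mm_pts X" "mm_dist X"
  using mm_space by (simp add: mm_space_iff)

sublocale prob_space "mm_meas X"
  using mm_space by (simp add: mm_space_iff)

lemma sets_meas: "sets (mm_meas X) = sets borelM"
  using mm_space by (simp add: mm_space_iff)

lemma space_meas [simp]: "space (mm_meas X) = mm_pts X"
  using sets_eq_imp_space_eq[OF sets_meas] by simp

lemma parametrization_iff:
  "parametrization \<phi> X \<longleftrightarrow> \<phi> \<in> measurable I01 borelM \<and> distr I01 borelM \<phi> = mm_meas X"
  unfolding parametrization_def using measurable_cong_sets[OF refl sets_meas, of I01]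
    distr_cong[OF refl sets_meas, of I01 \<phi> \<phi>] by simp

lemma parametrization_exists: "\<exists>\<phi>. parametrization \<phi> X"
  using param_exists[OF prob_space_axioms sets_meas] parametrization_iff by blast

lemma mball_pos: "x \<in> mm_pts X \<Longrightarrow> r > 0 \<Longrightarrow> 0 < prob (mball x r)"
  using mm_space by (simp add: mm_space_iff)

end

lemma parametrization_measure:
  assumes "parametrization \<phi> X" "E \<in> sets (mm_meas X)"
  shows "{s\<in>{0..<1}. \<phi> s \<in> E} \<in> sets I01" "measure (mm_meas X) E = measure I01 {s\<in>{0..<1}. \<phi> s \<in> E}"
proof -
  have \<phi>: "\<phi> \<in> measurable I01 (mm_meas X)" and d: "distr I01 (mm_meas X) \<phi> = mm_meas X"
    using assms(1) by (auto simp: parametrization_def)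
  show "{s\<in>{0..<1}. \<phi> s \<in> E} \<in> sets I01" by (rule I01_preimage[OF \<phi> assms(2)])
  show "measure (mm_meas X) E = measure I01 {s\<in>{0..<1}. \<phi> s \<in> E}"
    using emeasure_distr_I01[OF \<phi> assms(2)] by (simp add: d measure_def)
qed

lemma parametrization_image_measure:
  assumes "parametrization \<phi> X" "E \<in> sets (mm_meas X)" "S \<in> sets I01" "\<And>s. s \<in> S \<Longrightarrow> \<phi> s \<in> E"
  shows "measure I01 S \<le> measure (mm_meas X) E"
  unfolding parametrization_measure(2)[OF assms(1,2)]
  using assms(3,4) parametrization_measure(1)[OF assms(1,2)]
  by (intro I01.finite_measure_mono) (auto simp: sets_I01)

definition box_rel :: "real \<Rightarrow> mm \<Rightarrow> mm \<Rightarrow> bool" where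
  "box_rel \<epsilon> X Y \<longleftrightarrow> \<epsilon> \<ge> 0 \<and> (\<exists>\<phi> \<psi> I0. parametrization \<phi> X \<and> parametrization \<psi> Y \<and>
       I0 \<in> sets I01 \<and> measure I01 I0 \<ge> 1 - \<epsilon> \<and>
       (\<forall>s\<in>I0. \<forall>t\<in>I0. \<bar>mm_dist X (\<phi> s) (\<phi> t) - mm_dist Y (\<psi> s) (\<psi> t)\<bar> \<le> \<epsilon>))"

lemma box_eq: "box X Y = Inf {\<epsilon>. box_rel \<epsilon> X Y}"
  unfolding box_def box_rel_def by simp

lemma box_rel_mono: "box_rel e X Y \<Longrightarrow> e \<le> e' \<Longrightarrow> box_rel e' X Y"
  unfolding box_rel_def by (smt (verit, best))

lemma box_rel_nonneg: "box_rel e X Y \<Longrightarrow> 0 \<le> e"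
  by (simp add: box_rel_def)

lemma box_bdd: "bdd_below {\<epsilon>. box_rel \<epsilon> X Y}"
  by (rule bdd_belowI[of _ 0]) (simp add: box_rel_nonneg)

lemma box_le: "box_rel e X Y \<Longrightarrow> box X Y \<le> e"
  unfolding box_eq by (rule cInf_lower) (auto simp: box_bdd)

text \<open>With error 1 the set \<open>I0\<close> may be empty, so any two parametrizations are
  witnesses. Hence the infimum defining \<open>box\<close> runs over a nonempty set.\<close>

lemma box_rel_1:
  assumes "mm_space X" "mm_space Y" shows "box_rel 1 X Y"
proof -
  interpret X: mm X by standard fact
  interpret Y: mm Y by standard fact
  obtain \<phi> \<psi> where "parametrization \<phi> X" "parametrization \<psi> Y"
    using X.parametrization_exists Y.parametrization_exists by blast
  then show ?thesis unfolding box_rel_def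
    by (intro conjI exI[of _ \<phi>] exI[of _ \<psi>] exI[of _ "{}"]) auto
qed

lemma box_nonneg:
  assumes "mm_space X" "mm_space Y" shows "0 \<le> box X Y"
  unfolding box_eq using box_rel_1[OF assms] by (intro cInf_greatest) (auto simp: box_rel_nonneg)

lemma box_rel_of_less:
  assumes "mm_space X" "mm_space Y" "box X Y < e" shows "box_rel e X Y"
proof -
  have "{\<epsilon>. box_rel \<epsilon> X Y} \<noteq> {}" using box_rel_1[OF assms(1,2)] by blast
  from cInf_lessD[OF this] assms(3) obtain e' where "box_rel e' X Y" "e' < e"
    unfolding box_eq by blast
  then show ?thesis using box_rel_mono[of e' X Y e] by simp
qed

lemma box_rel_refl:
  assumes "mm_space X" shows "box_rel 0 X X"
proof -
  interpret X: mm X by standard fact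
  obtain \<phi> where "parametrization \<phi> X" using X.parametrization_exists by blast
  then show ?thesis unfolding box_rel_def
    by (intro conjI exI[of _ \<phi>] exI[of _ "{0..<1}"]) (auto simp: measure_I01)
qed

definition pyr_of :: "(nat \<Rightarrow> real) \<Rightarrow> mm set" where
  "pyr_of a = {X \<in> mmX. \<exists>x. atoms_fit (mm_meas X) a x}"

lemma pyr_of_mm: "X \<in> pyr_of a \<Longrightarrow> mm_space X"
  by (simp add: pyr_of_def mmX_def)

lemma pyr_of_param:
  assumes a: "a \<in> A_seq" and X: "X \<in> pyr_of a"
  obtains \<phi> x where "\<phi> \<in> measurable I01 (polish.borelM (mm_pts X) (mm_dist X))" "parametrization \<phi> X"
    "\<And>i s. s \<in> stepint a i \<Longrightarrow> \<phi> s = x i"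
proof -
  interpret X: mm X by standard (rule pyr_of_mm[OF X])
  obtain x where x: "atoms_fit (mm_meas X) a x" using X by (auto simp: pyr_of_def)
  show ?thesis
    using X.nice_param[OF X.prob_space_axioms X.sets_meas a x] X.parametrization_iff that by blast
qed

text \<open>The atoms of the approximating spaces become, through the parametrizations, sets of
  small diameter in the limit space; by the reverse Fatou lemma such sets have a common
  point along a subsequence, and these points carry the limiting atoms.\<close>

lemma pyr_of_limit:
  assumes a: "a \<in> A_seq" and b: "\<And>n. b n \<in> A_seq" and lim: "\<And>i. (\<lambda>n. b n i) \<longlonglongrightarrow> a i"
    and X: "mm_space X" and Y: "\<And>n. Y n \<in> pyr_of (b n)"
    and box: "\<And>n. box_rel (e n) X (Y n)" and e: "e \<longlonglongrightarrow> 0"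
  shows "X \<in> pyr_of a"
proof -
  interpret X: mm X by standard fact
  interpret Y: mm "Y n" for n by standard (rule pyr_of_mm[OF Y])
  have e0: "0 \<le> e n" for n using box box_rel_nonneg by blast
  have "\<exists>y. atoms_fit (mm_meas (Y n)) (b n) y" for n using Y[of n] by (simp add: pyr_of_def)
  then obtain y where y: "\<And>n. atoms_fit (mm_meas (Y n)) (b n) (y n)" by metis
  define Q where "Q n \<phi> \<psi> I0 \<longleftrightarrow> parametrization \<phi> X \<and> parametrization \<psi> (Y n) \<and>
       I0 \<in> sets I01 \<and> measure I01 I0 \<ge> 1 - e n \<and>
       (\<forall>s\<in>I0. \<forall>t\<in>I0. \<bar>mm_dist X (\<phi> s) (\<phi> t) - mm_dist (Y n) (\<psi> s) (\<psi> t)\<bar> \<le> e n)" for n \<phi> \<psi> I0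
  have "\<forall>n. \<exists>\<phi> \<psi> I0. Q n \<phi> \<psi> I0"
    using box unfolding box_rel_def Q_def by blast
  then obtain \<phi> \<psi> I where Q: "\<And>n. Q n (\<phi> n) (\<psi> n) (I n)" by metis
  then have \<phi>: "parametrization (\<phi> n) X" and \<psi>: "parametrization (\<psi> n) (Y n)"
    and I: "I n \<in> sets I01" "measure I01 (I n) \<ge> 1 - e n"
    and near: "s \<in> I n \<Longrightarrow> t \<in> I n \<Longrightarrow>
      \<bar>mm_dist X (\<phi> n s) (\<phi> n t) - mm_dist (Y n) (\<psi> n s) (\<psi> n t)\<bar> \<le> e n" for n s t
    unfolding Q_def by auto
  have yM: "y n i \<in> mm_pts (Y n)" for n i using y[of n] by (simp add: atoms_fit_def)
  have I01sub: "I n \<subseteq> {0..<1}" for n using I(1)[of n] by (simp add: sets_I01)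
  have \<phi>M: "\<phi> n s \<in> mm_pts X" if "s \<in> {0..<1}" for n s
    using \<phi>[of n] that measurable_space[of "\<phi> n" I01 "mm_meas X" s] by (simp add: parametrization_def)
  \<comment> \<open>Stated for a finite set of indices at once: atoms with different indices may
    coincide in Y n or merge in the limit, and their masses must add up.\<close>
  have Ksets: "{s\<in>I n. \<psi> n s \<in> y n ` K} \<in> sets I01" and
    Kmeas: "sum (b n) K - e n \<le> measure I01 {s\<in>I n. \<psi> n s \<in> y n ` K}" if K: "finite K" for n K
  proof -
    have yK: "y n ` K \<in> sets (mm_meas (Y n))"
      unfolding Y.sets_meas using K yM by (intro Y.countable_sets) (auto simp: countable_finite)
    have S: "{s\<in>{0..<1}. \<psi> n s \<in> y n ` K} \<in> sets I01"
      by (rule parametrization_measure(1)[OF \<psi> yK])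
    have eq: "{s\<in>I n. \<psi> n s \<in> y n ` K} = {s\<in>{0..<1}. \<psi> n s \<in> y n ` K} \<inter> I n"
      using I01sub[of n] by auto
    show "{s\<in>I n. \<psi> n s \<in> y n ` K} \<in> sets I01" unfolding eq using S I(1) by blast
    have "sum (b n) K \<le> measure (mm_meas (Y n)) (y n ` K)"
      by (rule Y.sum_atoms_le[OF Y.prob_space_axioms Y.sets_meas y yK K]) auto
    also have "\<dots> = measure I01 {s\<in>{0..<1}. \<psi> n s \<in> y n ` K}"
      by (rule parametrization_measure(2)[OF \<psi> yK])
    also have "\<dots> \<le> measure I01 ({s\<in>{0..<1}. \<psi> n s \<in> y n ` K} \<inter> I n \<union> ({0..<1} - I n))"
      using S I(1) by (intro I01.finite_measure_mono) auto
    also have "\<dots> \<le> measure I01 {s\<in>I n. \<psi> n s \<in> y n ` K} + measure I01 ({0..<1} - I n)"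
      unfolding eq using S I(1) by (intro measure_Un_le) auto
    also have "measure I01 ({0..<1} - I n) \<le> e n"
      using I01.prob_compl[OF I(1), of n] I(2)[of n] by simp
    finally show "sum (b n) K - e n \<le> measure I01 {s\<in>I n. \<psi> n s \<in> y n ` K}" by simp
  qed
  \<comment> \<open>Good parameters sent to atom i of Y n. Their images in X are at mutual distance
    at most e n, so they lie in the closed ball \<open>Cb n i\<close> about one of them; the centre
    defaults to \<open>\<phi> n 0\<close> if there are none.\<close>
  define B where "B n i = {s\<in>I n. \<psi> n s = y n i}" for n i
  define c where "c n i = (if B n i = {} then \<phi> n 0 else \<phi> n (SOME t. t \<in> B n i))" for n i
  define Cb where "Cb n i = X.mcball (c n i) (e n)" for n i
  have cM: "c n i \<in> mm_pts X" for n i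
  proof (cases "B n i = {}")
    case False
    then have "(SOME t. t \<in> B n i) \<in> B n i" by (simp add: some_in_eq)
    then have "(SOME t. t \<in> B n i) \<in> {0..<1}" using I01sub[of n] unfolding B_def by blast
    then show ?thesis using \<phi>M False by (simp add: c_def)
  qed (simp add: c_def \<phi>M)
  have Cbs: "Cb n i \<in> X.events" for n i by (simp add: Cb_def X.sets_meas)
  have BC: "\<phi> n s \<in> Cb n i" if s: "s \<in> B n i" for n i s
  proof -
    define t where "t = (SOME t. t \<in> B n i)"
    have t: "t \<in> B n i" unfolding t_def using s by (rule someI)
    then have "c n i = \<phi> n t" using s by (auto simp: c_def t_def)
    moreover have "mm_dist X (\<phi> n t) (\<phi> n s) \<le> e n"
      using near[of t n s] s t Y.mdist_zero[OF yM, of n i] by (auto simp: B_def)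
    ultimately show ?thesis
      using cM[of n i] \<phi>M[of s n] s I01sub[of n] by (auto simp: Cb_def B_def)
  qed
  have Cbm: "b n i - e n \<le> X.prob (Cb n i)" for n i
  proof -
    have "b n i - e n \<le> measure I01 (B n i)" using Kmeas[of "{i}" n] by (simp add: B_def)
    also have "\<dots> \<le> X.prob (Cb n i)"
      using Ksets[of "{i}" n] by (intro parametrization_image_measure[OF \<phi>[of n] Cbs] BC) (auto simp: B_def)
    finally show ?thesis .
  qed
  define P where "P i s \<longleftrightarrow> (0 < a i \<longrightarrow> (\<exists>x. \<forall>k. x \<in> Cb (s k) i))" for i and s :: "nat \<Rightarrow> nat"
  interpret subseqs P
  proof
    fix i and s :: "nat \<Rightarrow> nat" assume s: "strict_mono s"
    show "\<exists>r'. strict_mono r' \<and> P i (s \<circ> r')"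
    proof (cases "0 < a i")
      case False
      then show ?thesis using strict_mono_id by (auto simp: P_def)
    next
      case True
      \<comment> \<open>The sets U m decrease and eventually keep measure at least a i / 2, so their
        intersection is nonempty: some x lies in infinitely many of the balls.\<close>
      define U where "U m = (\<Union>k\<in>{m..}. Cb (s k) i)" for m
      have Us: "U m \<in> X.events" for m unfolding U_def using Cbs by (intro sets.countable_UN') auto
      have "(\<lambda>k. b (s k) i - e (s k)) \<longlonglongrightarrow> a i - 0"
        using LIMSEQ_subseq_LIMSEQ[OF lim s, of i] LIMSEQ_subseq_LIMSEQ[OF e s]
        by (intro tendsto_diff) (auto simp: o_def)
      then have ev: "\<forall>\<^sub>F k in sequentially. b (s k) i - e (s k) > a i / 2"
        using True by (intro order_tendstoD(1)) auto
      have "\<forall>\<^sub>F m in sequentially. X.prob (U m) \<ge> a i / 2"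
        using ev
      proof eventually_elim
        case (elim k)
        have "b (s k) i - e (s k) \<le> X.prob (Cb (s k) i)" by (rule Cbm)
        also have "\<dots> \<le> X.prob (U k)"
          using Us by (intro X.finite_measure_mono) (auto simp: U_def)
        finally show ?case using elim by simp
      qed
      moreover have "(\<lambda>m. X.prob (U m)) \<longlonglongrightarrow> X.prob (\<Inter>m. U m)"
        using Us by (intro X.finite_Lim_measure_decseq) (auto simp: decseq_def U_def intro: order_trans)
      ultimately have "X.prob (\<Inter>m. U m) \<ge> a i / 2"
        by (intro tendsto_lowerbound[of "\<lambda>m. X.prob (U m)" _ sequentially]) auto
      then have "(\<Inter>m. U m) \<noteq> {}" using True by auto
      then obtain x where "\<forall>m. x \<in> U m" by blast
      then have "\<exists>\<^sub>\<infinity>k. x \<in> Cb (s k) i" unfolding INFM_nat_le U_def by auto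
      then have "infinite {k. x \<in> Cb (s k) i}" by (simp add: INFM_iff_infinite)
      from infinite_enumerate[OF this] obtain r :: "nat \<Rightarrow> nat"
        where "strict_mono r" "\<forall>n. x \<in> Cb (s (r n)) i" by auto
      then show ?thesis by (auto simp: P_def)
    qed
  qed
  define D where "D = diagseq"
  have D: "strict_mono D" unfolding D_def by (rule subseq_diagseq)
  \<comment> \<open>The diagonal sequence is a subsequence of the i-th choice only from position i +
    1 on; hence the shift.\<close>
  have "P i (D \<circ> (+) (Suc i))" for i
    unfolding D_def by (rule diagseq_holds) (auto simp: P_def)
  then have Dx: "0 < a i \<Longrightarrow> \<exists>x. \<forall>k. x \<in> Cb (D (Suc i + k)) i" for i
    by (simp add: P_def)
  define x0 where "x0 i = (SOME x. \<forall>k. x \<in> Cb (D (Suc i + k)) i)" for i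
  have x0: "x0 i \<in> Cb (D k) i" if "0 < a i" "k \<ge> Suc i" for i k
    using someI_ex[OF Dx[OF that(1)]] le_add_diff_inverse[OF that(2)] unfolding x0_def by metis
  define x where "x i = (if 0 < a i then x0 i else c 0 0)" for i
  have xM: "x i \<in> mm_pts X" for i
    using x0[of i "Suc i"] cM by (auto simp: x_def Cb_def)
  have "atoms_fit (mm_meas X) a x"
  proof (rule atoms_fit_I[OF a])
    show "x i \<in> space (mm_meas X)" for i using xM by simp
    fix K' p assume K': "finite K'" "K' \<noteq> {}" and K'x: "\<And>i. i \<in> K' \<Longrightarrow> 0 < a i \<and> x i = p"
    then have pM: "p \<in> mm_pts X" using xM by blast
    show "sum a K' \<le> X.prob {p}"
    proof -
      define N where "N = Suc (Max K')"
      \<comment> \<open>Both p and the image points are within e n of the same centre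
        \<open>c n i\<close>, which gives the radius 2 * e n.\<close>
      have ball: "sum (b n) K' - e n \<le> X.prob (X.mcball p (2 * e n))" if n: "n = D k" "k \<ge> N" for n k
      proof -
        have "sum (b n) K' - e n \<le> measure I01 {s\<in>I n. \<psi> n s \<in> y n ` K'}" by (rule Kmeas[OF K'(1)])
        also have "\<dots> \<le> X.prob (X.mcball p (2 * e n))"
        proof (rule parametrization_image_measure[OF \<phi> _ Ksets[OF K'(1)]])
          fix s assume "s \<in> {s\<in>I n. \<psi> n s \<in> y n ` K'}"
          then obtain i where i: "i \<in> K'" "s \<in> B n i" by (auto simp: B_def)
          have "i \<le> Max K'" using i(1) K' by simp
          then have "k \<ge> Suc i" using n(2) by (simp add: N_def)
          then have "p \<in> Cb n i" using x0[of i k] K'x[OF i(1)] n by (auto simp: x_def)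
          then show "\<phi> n s \<in> X.mcball p (2 * e n)"
            using BC[OF i(2)] X.triangle[of p "c n i" "\<phi> n s"] pM
            by (auto simp: Cb_def X.commute)
        qed (simp add: X.sets_meas)
        finally show ?thesis .
      qed
      have lowb: "sum a K' \<le> X.prob (X.mcball p (1 / real (Suc m)))" for m
      proof -
        have "(\<lambda>k. sum (b (D k)) K' - e (D k)) \<longlonglongrightarrow> sum a K' - 0"
          using LIMSEQ_subseq_LIMSEQ[OF lim D] LIMSEQ_subseq_LIMSEQ[OF e D]
          by (intro tendsto_diff tendsto_sum) (auto simp: o_def)
        moreover have "\<forall>\<^sub>F k in sequentially. sum (b (D k)) K' - e (D k) \<le> X.prob (X.mcball p (1 / real (Suc m)))"
        proof -
          have "\<forall>\<^sub>F k in sequentially. e (D k) < 1 / (2 * real (Suc m))"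
            using LIMSEQ_subseq_LIMSEQ[OF e D] by (intro order_tendstoD(2)[of _ 0]) (auto simp: o_def)
          then show ?thesis using eventually_ge_at_top[of N]
          proof eventually_elim
            case (elim k)
            have "X.prob (X.mcball p (2 * e (D k))) \<le> X.prob (X.mcball p (1 / real (Suc m)))"
              using elim(1) by (intro X.finite_measure_mono X.mcball_subset_concentric)
                (auto simp: X.sets_meas field_simps)
            then show ?case using ball[OF refl elim(2)] by simp
          qed
        qed
        ultimately have "sum a K' - 0 \<le> X.prob (X.mcball p (1 / real (Suc m)))"
          by (rule tendsto_upperbound) simp
        then show ?thesis by simp
      qed
      have "(\<Inter>m. X.mcball p (1 / real (Suc m))) = {p}"
      proof (intro equalityI subsetI)
        fix q assume q: "q \<in> (\<Inter>m. X.mcball p (1 / real (Suc m)))"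
        then have qM: "q \<in> mm_pts X" and le: "\<And>m. mm_dist X p q \<le> 1 / real (Suc m)" by auto
        have "mm_dist X p q \<le> 0"
        proof (rule ccontr)
          assume "\<not> mm_dist X p q \<le> 0"
          then obtain m where "1 / real (Suc m) < mm_dist X p q" using nat_approx_posE by (metis not_le)
          then show False using le[of m] by simp
        qed
        then show "q \<in> {p}" using X.zero[OF pM qM] X.nonneg[of p q] by auto
      qed (use pM in auto)
      moreover have "(\<lambda>m. X.prob (X.mcball p (1 / real (Suc m)))) \<longlonglongrightarrow> X.prob (\<Inter>m. X.mcball p (1 / real (Suc m)))"
      proof (intro X.finite_Lim_measure_decseq)
        show "range (\<lambda>m. X.mcball p (1 / real (Suc m))) \<subseteq> X.events" by (auto simp: X.sets_meas)
        show "decseq (\<lambda>m. X.mcball p (1 / real (Suc m)))"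
          unfolding decseq_def
          by (intro allI impI X.mcball_subset_concentric frac_le) auto
      qed
      ultimately have "(\<lambda>m. X.prob (X.mcball p (1 / real (Suc m)))) \<longlonglongrightarrow> X.prob {p}"
        by simp
      then show ?thesis by (rule LIMSEQ_le_const) (use lowb in blast)
    qed
  qed
  then show ?thesis using X by (auto simp: pyr_of_def mmX_def)
qed

section \<open>Lipschitz maps, supports of laws and changes of metric\<close>

lemma polish_lipschitz_measurable:
  assumes "polish M d" "polish N d'" "\<And>x. x \<in> M \<Longrightarrow> f x \<in> N"
    and lip: "\<And>x y. x \<in> M \<Longrightarrow> y \<in> M \<Longrightarrow> d' (f x) (f y) \<le> d x y"
  shows "f \<in> measurable (polish.borelM M d) (polish.borelM N d')"
proof -
  interpret A: polish M d by fact
  interpret B: polish N d' by fact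
  show ?thesis
  proof (rule B.measurable_borelM_I)
    fix c r assume c: "c \<in> N"
    have "openin A.mtopology {x\<in>M. d' c (f x) < r}"
      unfolding A.openin_mtopology
    proof (intro conjI allI impI)
      fix x assume x: "x \<in> {x\<in>M. d' c (f x) < r}"
      have "A.mball x (r - d' c (f x)) \<subseteq> {x\<in>M. d' c (f x) < r}"
      proof
        fix y assume y: "y \<in> A.mball x (r - d' c (f x))"
        have "d' c (f y) \<le> d' c (f x) + d' (f x) (f y)"
          using B.triangle c assms(3) x y by simp
        then show "y \<in> {x\<in>M. d' c (f x) < r}" using lip[of x y] x y by auto
      qed
      then show "\<exists>s>0. A.mball x s \<subseteq> {x\<in>M. d' c (f x) < r}"
        using x by (intro exI[of _ "r - d' c (f x)"]) auto
    qed auto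
    from A.openin_sets[OF this] show "{x \<in> space A.borelM. d' c (f x) < r} \<in> A.borelM"
      by simp
  qed (use assms(3) in simp)
qed

context polish begin

lemma second_countable_mtopology: "second_countable mtopology"
  unfolding second_countable_def
proof (intro exI[of _ "range base_ball"] conjI allI impI)
  show "countable (range base_ball)" by simp
  show "\<forall>V\<in>range base_ball. openin mtopology V" by auto
  show "\<exists>V\<in>range base_ball. x \<in> V \<and> V \<subseteq> U" if Ux: "openin mtopology U \<and> x \<in> U" for U x
  proof -
    obtain n where "x \<in> base_ball n" "base_ball n \<subseteq> U"
      using openin_base_ballE[OF conjunct1[OF Ux] conjunct2[OF Ux]] .
    then show ?thesis by blast
  qed
qed

text \<open>Separability by itself is not hereditary, second countability is; hence the detour
  through a countable base.\<close>

lemma closed_subspace_polish: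
  assumes "closedin mtopology S" "S \<noteq> {}"
  shows "polish S d"
proof -
  interpret Submetric M d S
    by standard (use assms closedin_subset[of mtopology S] in simp)
  have "separable_space (subtopology mtopology S)"
    by (intro second_countable_imp_separable_space second_countable_subtopology second_countable_mtopology)
  then show ?thesis
    using closedin_mcomplete_imp_mcomplete[OF assms(1) complete] assms(2) mtopology_submetric
    by (unfold_locales) auto
qed

end

text \<open>The witness is the support of the law of \<Phi>, with \<Phi> changed on a null set.\<close>

lemma mm_space_of_map:
  assumes "polish M D" and \<Phi>: "\<Phi> \<in> measurable I01 (polish.borelM M D)"
  shows "\<exists>Z \<phi>. mm_space Z \<and> mm_pts Z \<subseteq> M \<and> mm_dist Z = D \<and> parametrization \<phi> Z \<and> (AE s in I01. \<phi> s = \<Phi> s)"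
proof -
  interpret polish M D by fact
  have \<Phi>M: "\<Phi> s \<in> M" if "s \<in> {0..<1}" for s using measurable_space[OF \<Phi>, of s] that by simp
  define mu where "mu E = measure I01 {s\<in>{0..<1}. \<Phi> s \<in> E}" for E
  have pre: "{s\<in>{0..<1}. \<Phi> s \<in> E} \<in> sets I01" if "E \<in> sets borelM" for E
    by (rule I01_preimage[OF \<Phi> that])
  have mu_mono: "mu E \<le> mu E'" if "E \<subseteq> E'" "E' \<in> sets borelM" for E E'
    unfolding mu_def using that pre[OF that(2)] by (intro I01.finite_measure_mono) auto
  define S where "S = {c\<in>M. \<forall>r>0. 0 < mu (mball c r)}"
  have nullball: "\<exists>r>0. mu (mball c r) = 0" if "c \<in> M" "c \<notin> S" for c
    using that unfolding S_def mu_def by (fastforce simp: not_less zero_less_measure_iff)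
  have clo: "closedin mtopology S"
    unfolding closedin_metric
  proof (intro conjI allI impI)
    fix c assume c: "c \<in> M - S"
    then obtain r where r: "r > 0" "mu (mball c r) = 0" using nullball by blast
    have "y \<notin> S" if y: "y \<in> mball c r" for y
    proof
      assume "y \<in> S"
      moreover have "r - D c y > 0" using y by simp
      ultimately have "0 < mu (mball y (r - D c y))" by (auto simp: S_def)
      also have "\<dots> \<le> mu (mball c r)"
        by (rule mu_mono, rule mball_subset) (use c y in \<open>auto simp: commute\<close>)
      finally show False using r by simp
    qed
    then show "\<exists>r>0. disjnt S (mball c r)" using r by (auto simp: disjnt_iff)
  qed (auto simp: S_def)
  \<comment> \<open>A point outside S has a null ball around it and so lies in one of the countably
    many null base balls; almost every parameter avoids all of these.\<close>
  have "AE s in I01. \<forall>n\<in>{n. mu (base_ball n) = 0}. \<Phi> s \<notin> base_ball n"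
  proof (rule AE_ball_countable')
    fix n assume "n \<in> {n. mu (base_ball n) = 0}"
    then show "AE s in I01. \<Phi> s \<notin> base_ball n"
      using pre[OF openin_sets[OF openin_base_ball], of n]
      by (intro AE_I'[of "{s\<in>{0..<1}. \<Phi> s \<in> base_ball n}"])
        (auto simp: mu_def null_sets_def I01.emeasure_eq_measure)
  qed simp
  then have AES: "AE s in I01. \<Phi> s \<in> S"
    using AE_space
  proof eventually_elim
    case (elim s)
    then have sM: "\<Phi> s \<in> M" using \<Phi>M by simp
    show ?case
    proof (rule ccontr)
      assume "\<Phi> s \<notin> S"
      then obtain r where r: "r > 0" "mu (mball (\<Phi> s) r) = 0" using nullball sM by blast
      have "\<Phi> s \<in> mball (\<Phi> s) r" using r sM by simp
      then obtain n where n: "\<Phi> s \<in> base_ball n" "base_ball n \<subseteq> mball (\<Phi> s) r"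
        by (rule openin_base_ballE[OF openin_mball])
      have "mu (base_ball n) \<le> 0" using mu_mono[OF n(2)] r by simp
      then have "mu (base_ball n) = 0" by (simp add: mu_def order_antisym)
      then show False using elim n by blast
    qed
  qed
  then have "S \<noteq> {}" using I01.AE_False by (metis AE_cong empty_iff)
  then obtain z0 where z0: "z0 \<in> S" by blast
  have pS: "polish S D" by (rule closed_subspace_polish[OF clo \<open>S \<noteq> {}\<close>])
  interpret S: polish S D by (rule pS)
  have SM: "S \<subseteq> M" by (auto simp: S_def)
  define \<phi> where "\<phi> s = (if \<Phi> s \<in> S then \<Phi> s else z0)" for s
  have AE\<phi>: "AE s in I01. \<phi> s = \<Phi> s" using AES by eventually_elim (simp add: \<phi>_def)
  have \<phi>m: "\<phi> \<in> measurable I01 S.borelM"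
  proof (rule S.measurable_borelM_I)
    fix c r assume c: "c \<in> S"
    have Sm: "S \<in> sets borelM" by (rule closedin_sets[OF clo])
    have "{s \<in> space I01. D c (\<phi> s) < r} = {s\<in>{0..<1}. \<Phi> s \<in> S \<inter> mball c r} \<union>
        {s\<in>{0..<1}. \<Phi> s \<in> (if D c z0 < r then M - S else {})}"
      using c SM \<Phi>M by (auto simp: \<phi>_def)
    also have "\<dots> \<in> sets I01"
      using Sm sets.compl_sets[OF Sm] by (intro sets.Un pre) auto
    finally show "{s \<in> space I01. D c (\<phi> s) < r} \<in> sets I01" .
  qed (use z0 in \<open>simp add: \<phi>_def\<close>)
  define Z where "Z = (S, D, distr I01 S.borelM \<phi>)"
  have [simp]: "mm_pts Z = S" "mm_dist Z = D" "mm_meas Z = distr I01 S.borelM \<phi>"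
    by (simp_all add: Z_def mm_pts_def mm_dist_def mm_meas_def)
  have "mm_space Z"
    unfolding mm_space_iff
  proof (intro conjI ballI allI impI)
    show "prob_space (mm_meas Z)" using I01.prob_space_distr[OF \<phi>m] by simp
    fix x r assume x: "x \<in> mm_pts Z" and r: "0 < (r::real)"
    have m1: "{s\<in>{0..<1}. \<phi> s \<in> S.mball x r} \<in> sets I01" by (rule I01_preimage[OF \<phi>m]) simp
    have "measure (mm_meas Z) (S.mball x r) = measure I01 {s\<in>{0..<1}. \<phi> s \<in> S.mball x r}"
      using emeasure_distr_I01[OF \<phi>m] by (simp add: measure_def)
    also have "\<dots> = mu (mball x r)"
      unfolding mu_def
    proof (rule I01.finite_measure_eq_AE)
      show "AE s in I01. (s \<in> {s\<in>{0..<1}. \<phi> s \<in> S.mball x r}) = (s \<in> {s\<in>{0..<1}. \<Phi> s \<in> mball x r})"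
        using AES by eventually_elim (use x SM in \<open>auto simp: \<phi>_def\<close>)
    qed (use m1 pre[OF mball_sets] in blast)+
    finally show "0 < measure (mm_meas Z) (Metric_space.mball (mm_pts Z) (mm_dist Z) x r)"
      using x r by (simp add: S_def)
  qed (simp_all add: pS)
  moreover have "parametrization \<phi> Z"
    using \<phi>m distr_cong[of I01 I01 "distr I01 S.borelM \<phi>" S.borelM \<phi> \<phi>]
    by (simp add: parametrization_def)
  ultimately show ?thesis using SM AE\<phi> by (intro exI[of _ Z] exI[of _ \<phi>]) simp
qed

text \<open>The two metrics are uniformly equivalent. They have the same topology, hence the same
  Borel sets; Cauchy sequences of the new metric are Cauchy for the old one, so completeness
  transfers; and each new ball contains an old one, so the support is still everything.\<close>

lemma mm_space_remetric:
  assumes X: "mm_space X" and d': "Metric_space (mm_pts X) d'"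
    and fwd: "\<And>e. e > 0 \<Longrightarrow> \<exists>\<delta>>0. \<forall>x\<in>mm_pts X. \<forall>y\<in>mm_pts X. mm_dist X x y < \<delta> \<longrightarrow> d' x y < e"
    and bwd: "\<And>e. e > 0 \<Longrightarrow> \<exists>\<delta>>0. \<forall>x\<in>mm_pts X. \<forall>y\<in>mm_pts X. d' x y < \<delta> \<longrightarrow> mm_dist X x y < e"
  shows "mm_space (mm_pts X, d', mm_meas X)"
proof -
  interpret X: mm X by standard fact
  interpret N: Metric_space "mm_pts X" d' by fact
  have ballN: "\<exists>\<delta>>0. X.mball x \<delta> \<subseteq> N.mball x e" if "e > 0" for x e
    using fwd[OF that] by fastforce
  have ballX: "\<exists>\<delta>>0. N.mball x \<delta> \<subseteq> X.mball x e" if "e > 0" for x e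
    using bwd[OF that] by fastforce
  have top: "N.mtopology = X.mtopology"
    unfolding topology_eq N.openin_mtopology X.openin_mtopology
    using ballN ballX by (meson order_trans)
  have "X.MCauchy s" if "N.MCauchy s" for s
    unfolding X.MCauchy_def
  proof (intro conjI allI impI)
    show "range s \<subseteq> mm_pts X" using that N.MCauchy_def by blast
    then have sM: "s n \<in> mm_pts X" for n by auto
    fix e :: real assume "0 < e"
    from bwd[OF this] obtain \<delta> where \<delta>: "\<delta> > 0" "\<And>x y. x \<in> mm_pts X \<Longrightarrow> y \<in> mm_pts X \<Longrightarrow> d' x y < \<delta> \<Longrightarrow> mm_dist X x y < e"
      by blast
    then show "\<exists>N. \<forall>n n'. N \<le> n \<longrightarrow> N \<le> n' \<longrightarrow> mm_dist X (s n) (s n') < e"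
      using that sM unfolding N.MCauchy_def by meson
  qed
  then have "N.mcomplete" using X.complete unfolding N.mcomplete_def X.mcomplete_def top by blast
  moreover have "0 < X.prob (N.mball x r)" if x: "x \<in> mm_pts X" and r: "r > 0" for x r
  proof -
    obtain \<delta> where \<delta>: "\<delta> > 0" "X.mball x \<delta> \<subseteq> N.mball x r" using ballN[OF r] by blast
    have "N.mball x r \<in> X.events"
      using N.openin_mball[of x r] top by (simp add: X.sets_meas X.openin_sets)
    then have "X.prob (X.mball x \<delta>) \<le> X.prob (N.mball x r)"
      using \<delta> by (intro X.finite_measure_mono) auto
    then show ?thesis using X.mball_pos[OF x \<delta>(1)] by simp
  qed
  ultimately show ?thesis
    using X d' top by (simp add: mm_space_def mm_pts_def mm_dist_def mm_meas_def)
qed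

lemma scale_mm_space:
  assumes "mm_space X" "t > 0" shows "mm_space (scale_mm t X)"
proof -
  interpret X: mm X by standard fact
  show ?thesis unfolding scale_mm_def
  proof (rule mm_space_remetric[OF assms(1)])
    show "Metric_space (mm_pts X) (\<lambda>x y. t * mm_dist X x y)"
      using assms(2) X.triangle by unfold_locales (auto simp: X.commute simp flip: distrib_left)
    fix e :: real assume e: "e > 0"
    show "\<exists>\<delta>>0. \<forall>x\<in>mm_pts X. \<forall>y\<in>mm_pts X. mm_dist X x y < \<delta> \<longrightarrow> t * mm_dist X x y < e"
      using e assms(2) by (intro exI[of _ "e / t"]) (auto simp: field_simps)
    show "\<exists>\<delta>>0. \<forall>x\<in>mm_pts X. \<forall>y\<in>mm_pts X. t * mm_dist X x y < \<delta> \<longrightarrow> mm_dist X x y < e"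
      using e assms(2) by (intro exI[of _ "e * t"]) (auto simp: field_simps)
  qed
qed

lemma scale_mm_simps [simp]:
  "mm_pts (scale_mm t X) = mm_pts X" "mm_meas (scale_mm t X) = mm_meas X"
  "mm_dist (scale_mm t X) x y = t * mm_dist X x y"
  by (simp_all add: scale_mm_def mm_pts_def mm_meas_def mm_dist_def)

lemma scale_mm_scale_mm: "t > 0 \<Longrightarrow> scale_mm t (scale_mm (1 / t) X) = X"
  unfolding scale_mm_def by (cases X) (simp add: mm_pts_def mm_meas_def mm_dist_def)

text \<open>Membership in \<open>pyr_of a\<close> constrains only the measure, which scaling leaves
  alone.\<close>

lemma scale_pyr_of:
  assumes "t > 0" shows "scale_mm t ` pyr_of a = pyr_of a"
proof -
  have sub: "scale_mm t X \<in> pyr_of a" if "X \<in> pyr_of a" "t > 0" for t X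
    using that scale_mm_space by (auto simp: pyr_of_def mmX_def)
  have "X \<in> scale_mm t ` pyr_of a" if "X \<in> pyr_of a" for X
    using sub[OF that, of "1 / t"] assms scale_mm_scale_mm[OF assms, of X] by (metis image_eqI zero_less_divide_1_iff)
  then show ?thesis using sub assms by blast
qed

text \<open>All points x i with the same image p lie in the preimage of p, whose mass is that of p;
  atoms merged by the map therefore add up.\<close>

lemma pyr_of_dominated:
  assumes a: "a \<in> A_seq" and X: "X \<in> pyr_of a" and Y: "mm_space Y" "dominated Y X"
  shows "Y \<in> pyr_of a"
proof -
  interpret X: mm X by standard (rule pyr_of_mm[OF X])
  interpret Y: mm Y by standard fact
  obtain f where f: "f \<in> measurable (mm_meas X) (mm_meas Y)" "distr (mm_meas X) (mm_meas Y) f = mm_meas Y"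
    and fM: "f ` mm_pts X \<subseteq> mm_pts Y"
    using Y(2) unfolding dominated_def by blast
  obtain x where x: "atoms_fit (mm_meas X) a x" using X by (auto simp: pyr_of_def)
  have xM: "x i \<in> mm_pts X" for i using x by (simp add: atoms_fit_def)
  have "atoms_fit (mm_meas Y) a (f \<circ> x)"
    unfolding atoms_fit_def
  proof (intro conjI allI impI)
    show "(f \<circ> x) i \<in> space (mm_meas Y)" for i using xM fM by auto
    fix I p assume I: "finite I" "\<forall>i\<in>I. (f \<circ> x) i = p"
    show "sum a I \<le> Y.prob {p}"
    proof (cases "I = {}")
      case False
      then have "p \<in> mm_pts Y" using I xM fM by force
      then have p: "{p} \<in> Y.events" by (simp add: Y.sets_meas)
      have "sum a I \<le> X.prob (f -` {p} \<inter> mm_pts X)"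
        using I xM measurable_sets[OF f(1) p]
        by (intro X.sum_atoms_le[OF X.prob_space_axioms X.sets_meas x]) auto
      also have "\<dots> = Y.prob {p}"
        using measure_distr[OF f(1) p] by (simp add: f(2))
      finally show ?thesis .
    qed simp
  qed
  then show ?thesis using Y by (auto simp: pyr_of_def mmX_def)
qed

section \<open>Model spaces with given atoms, and directedness\<close>

lemma AE_stepint_ex:
  assumes a: "a \<in> A_seq" and ai: "0 < a i" and P: "AE s in I01. P s"
  shows "\<exists>s\<in>stepint a i. P s"
proof (rule ccontr)
  assume n: "\<not> ?thesis"
  have "AE s in I01. s \<notin> stepint a i" using P by (rule AE_mp) (use n in auto)
  then have "measure I01 (stepint a i) = 0"
    using stepint_sets[OF a, of i] by (simp add: I01.prob_eq_0)
  then show False using measure_stepint[OF a, of i] ai by simp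
qed

lemma measurable_eq_sets_I01:
  assumes "f \<in> borel_measurable borel"
  shows "{s\<in>{0..<1}. f s = (p::real)} \<in> sets I01"
  using I01_preimage[OF measurable_I01[OF assms], of "{p}"] by simp

text \<open>The intervals are disjoint of lengths a i, so a point receives at least the total length
  of the intervals sent to it. The almost everywhere form matches the output of
  \<open>mm_space_of_map\<close>.\<close>

lemma pyr_of_I:
  assumes a: "a \<in> A_seq" and X: "mm_space X" and \<phi>: "parametrization \<phi> X"
    and x: "\<And>i. AE s in I01. s \<in> stepint a i \<longrightarrow> \<phi> s = x i"
  shows "X \<in> pyr_of a"
proof -
  interpret X: mm X by standard fact
  have \<phi>M: "\<phi> s \<in> mm_pts X" if "s \<in> {0..<1}" for s
    using \<phi> that measurable_space[of \<phi> I01 "mm_meas X" s] by (simp add: parametrization_def)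
  have xM: "x i \<in> mm_pts X" if ai: "0 < a i" for i
  proof -
    have "\<exists>s\<in>stepint a i. \<phi> s = x i"
      using AE_stepint_ex[OF a ai x[of i]] by blast
    then obtain s where "s \<in> stepint a i" "\<phi> s = x i" by blast
    then show ?thesis using \<phi>M[of s] stepint_sets[OF a, of i] by (auto simp: sets_I01)
  qed
  \<comment> \<open>For a i = 0 the interval is empty and x i is arbitrary; some point of the space
    replaces it.\<close>
  define x' where "x' i = (if 0 < a i then x i else \<phi> 0)" for i
  have "atoms_fit (mm_meas X) a x'"
  proof (rule atoms_fit_I[OF a])
    show "x' i \<in> space (mm_meas X)" for i using xM \<phi>M by (simp add: x'_def)
    fix K' p assume K': "finite K'" "K' \<noteq> {}" and K'x: "\<And>i. i \<in> K' \<Longrightarrow> 0 < a i \<and> x' i = p"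
    show "sum a K' \<le> X.prob {p}"
    proof -
      have xp: "x i = p" if "i \<in> K'" for i using K'x[OF that] by (auto simp: x'_def)
      have p: "{p} \<in> X.events" using K'(2) K'x xp xM X.sets_meas X.singleton_sets by blast
      have "sum a K' = (\<Sum>i\<in>K'. measure I01 (stepint a i))" by (simp add: measure_stepint[OF a])
      also have "\<dots> = measure I01 (\<Union>i\<in>K'. stepint a i)"
        using K'(1) disjoint_stepint[OF a] stepint_sets[OF a]
        by (intro I01.finite_measure_finite_Union[symmetric]) (auto simp: disjoint_family_on_def)
      also have "\<dots> \<le> measure I01 {s\<in>{0..<1}. \<phi> s \<in> {p}}"
      proof (rule I01.finite_measure_mono_AE)
        have "AE s in I01. \<forall>i\<in>K'. s \<in> stepint a i \<longrightarrow> \<phi> s = x i"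
          using K'(1) x by (intro AE_ball_countable') (auto simp: countable_finite)
        then show "AE s in I01. s \<in> (\<Union>i\<in>K'. stepint a i) \<longrightarrow> s \<in> {s\<in>{0..<1}. \<phi> s \<in> {p}}"
          using AE_space by eventually_elim (use xp in auto)
        show "{s\<in>{0..<1}. \<phi> s \<in> {p}} \<in> sets I01"
          by (rule parametrization_measure(1)[OF \<phi> p])
      qed
      also have "\<dots> = X.prob {p}" by (rule parametrization_measure(2)[OF \<phi> p, symmetric])
      finally show ?thesis .
    qed
  qed
  then show ?thesis using X by (auto simp: pyr_of_def mmX_def)
qed

text \<open>Take the law on the line with mass a i at -(i+1) and Lebesgue measure on the part of
  [0,1) from \<open>suminf a\<close> on, and restrict to its support. Negative integers keep the
  atoms distinct and apart from the diffuse part.\<close>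

lemma exact_space_exists:
  assumes a: "a \<in> A_seq"
  shows "\<exists>W w. mm_space W \<and> atoms_exact (mm_meas W) a w"
proof -
  have UP: "polish (UNIV :: real set) dist"
  proof
    show "Met_TC.mcomplete TYPE(real)"
      by (simp add: complete_UNIV)
    have "second_countable (euclidean :: real topology)"
    proof -
      obtain B :: "real set set" where B: "countable B" "\<And>C. C \<in> B \<Longrightarrow> open C"
        "\<And>S. open S \<Longrightarrow> \<exists>U. U \<subseteq> B \<and> S = \<Union>U"
        using univ_second_countable by blast
      have "\<exists>V\<in>B. x \<in> V \<and> V \<subseteq> U" if U: "open U" "x \<in> U" for U x
      proof -
        obtain UU where UU: "UU \<subseteq> B" "U = \<Union>UU" using B(3)[OF U(1)] by blast
        then show ?thesis using U(2) by blast
      qed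
      then show ?thesis
        using B unfolding second_countable_def open_openin[symmetric] by (intro exI[of _ B]) simp
    qed
    then show "separable_space (Met_TC.mtopology :: real topology)"
      by (simp add: second_countable_imp_separable_space)
  qed simp
  interpret R: polish "UNIV :: real set" dist by (rule UP)
  define \<Phi> where "\<Phi> s = (if s < suminf a then - real (Suc (stepidx a s)) else s)" for s
  have "\<Phi> \<in> borel_measurable borel"
    unfolding \<Phi>_def using measurable_stepidx[OF a] by measurable
  have "\<Phi> \<in> measurable I01 R.borelM"
  proof (rule R.measurable_borelM_I)
    fix c r :: real
    have "{s \<in> space borel. dist c (\<Phi> s) < r} \<in> sets borel"
      using \<open>\<Phi> \<in> borel_measurable borel\<close> by measurable
    then have "{s. dist c (\<Phi> s) < r} \<inter> {0..<1} \<in> sets borel" by auto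
    then have "{s. dist c (\<Phi> s) < r} \<inter> {0..<1} \<in> sets I01" unfolding sets_I01 by blast
    moreover have "{s. dist c (\<Phi> s) < r} \<inter> {0..<1} = {s \<in> space I01. dist c (\<Phi> s) < r}" by auto
    ultimately show "{s \<in> space I01. dist c (\<Phi> s) < r} \<in> sets I01" by metis
  qed simp
  from mm_space_of_map[OF UP this] obtain Z \<phi>
    where Z: "mm_space Z" and \<phi>: "parametrization \<phi> Z" and eq: "AE s in I01. \<phi> s = \<Phi> s"
    by blast
  interpret Z: mm Z by standard fact
  define w where "w i = - real (Suc i)" for i
  have meas: "Z.prob {p} = measure I01 {s\<in>{0..<1}. \<Phi> s = p}" if p: "p \<in> mm_pts Z" for p
  proof -
    have P: "{p} \<in> Z.events" using p by (simp add: Z.sets_meas)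
    have "Z.prob {p} = measure I01 {s\<in>{0..<1}. \<phi> s \<in> {p}}" by (rule parametrization_measure(2)[OF \<phi> P])
    also have "\<dots> = measure I01 {s\<in>{0..<1}. \<Phi> s = p}"
    proof (rule I01.finite_measure_eq_AE)
      show "AE s in I01. (s \<in> {s\<in>{0..<1}. \<phi> s \<in> {p}}) = (s \<in> {s\<in>{0..<1}. \<Phi> s = p})"
        using eq by eventually_elim auto
      show "{s\<in>{0..<1}. \<phi> s \<in> {p}} \<in> sets I01" by (rule parametrization_measure(1)[OF \<phi> P])
      show "{s\<in>{0..<1}. \<Phi> s = p} \<in> sets I01"
        by (rule measurable_eq_sets_I01[OF \<open>\<Phi> \<in> borel_measurable borel\<close>])
    qed
    finally show ?thesis .
  qed
  have neg: "{s\<in>{0..<1}. \<Phi> s = w i} = stepint a i" for i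
    using stepint_iff[OF a] A_seq_total[OF a] by (auto simp: \<Phi>_def w_def)
  have "atoms_exact (mm_meas Z) a w"
    unfolding atoms_exact_def
  proof (intro conjI allI impI ballI)
    show "inj_on w {i. 0 < a i}" by (auto simp: inj_on_def w_def)
  next
    fix i assume ai: "0 < a i"
    have "\<exists>s\<in>stepint a i. \<phi> s = \<Phi> s"
      by (rule AE_stepint_ex[OF a ai eq])
    then obtain s where s0: "s \<in> stepint a i" "\<phi> s = \<Phi> s" by blast
    moreover have "\<Phi> s = w i" using s0(1) unfolding neg[symmetric] by simp
    ultimately have s: "s \<in> stepint a i" "\<phi> s = w i" by simp_all
    then show w: "w i \<in> space (mm_meas Z)"
      using \<phi> stepint_sets[OF a, of i] measurable_space[of \<phi> I01 "mm_meas Z" s]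
      by (auto simp: parametrization_def sets_I01)
    show "Z.prob {w i} = a i" using meas[of "w i"] w neg measure_stepint[OF a] by simp
  next
    fix p assume p: "p \<in> space (mm_meas Z) - w ` {i. 0 < a i}"
    show "Z.prob {p} = 0"
    proof (cases "p \<in> range w")
      case True
      then obtain i where i: "p = w i" by blast
      then have "a i = 0" using p A_seq_nonneg[OF a, of i] by force
      then show ?thesis using meas[of p] p i neg measure_stepint[OF a] by simp
    next
      case False
      then have "{s\<in>{0..<1}. \<Phi> s = p} \<subseteq> {p} \<inter> {0..<1}" by (auto simp: \<Phi>_def w_def split: if_splits)
      then have "measure I01 {s\<in>{0..<1}. \<Phi> s = p} \<le> measure I01 ({p} \<inter> {0..<1})"
        by (intro I01.finite_measure_mono) (auto simp: sets_I01)
      also have "\<dots> = 0" by (subst measure_I01) (auto simp: sets_I01 Int_insert_left)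
      finally show ?thesis using meas[of p] p by (simp add: order_antisym)
    qed
  qed
  then show ?thesis using Z by blast
qed

text \<open>Exactness says nothing about points of weight 0, whereas a fit wants every point in the
  space; these indices are sent to an arbitrary point z.\<close>

lemma atoms_exact_fit:
  assumes a: "a \<in> A_seq" and \<mu>: "prob_space \<mu>" and w: "atoms_exact \<mu> a w"
  shows "\<exists>x. atoms_fit \<mu> a x \<and> atoms_exact \<mu> a x"
proof -
  interpret prob_space \<mu> by fact
  obtain z where z: "z \<in> space \<mu>" using not_empty by blast
  define x where "x i = (if 0 < a i then w i else z)" for i
  have im: "x ` {i. 0 < a i} = w ` {i. 0 < a i}" by (auto simp: x_def)
  have ex: "atoms_exact \<mu> a x"
    using w unfolding atoms_exact_def im inj_on_def by (simp add: x_def)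
  have "atoms_fit \<mu> a x"
  proof (rule atoms_fit_I[OF a])
    show "x i \<in> space \<mu>" for i using ex z by (auto simp: atoms_exact_def x_def)
    fix I p assume I: "I \<noteq> {}" "\<And>i. i \<in> I \<Longrightarrow> 0 < a i \<and> x i = p"
    then obtain i where i: "i \<in> I" by blast
    have "I = {i}" using ex I(2) i unfolding atoms_exact_def inj_on_def by blast
    then show "sum a I \<le> prob {p}" using ex I(2)[OF i] by (auto simp: atoms_exact_def)
  qed
  then show ?thesis using ex by blast
qed

lemma dominated_I:
  assumes X: "mm_space X" and Z: "mm_space Z"
    and f: "\<And>u. u \<in> mm_pts Z \<Longrightarrow> f u \<in> mm_pts X"
    and lip: "\<And>u v. u \<in> mm_pts Z \<Longrightarrow> v \<in> mm_pts Z \<Longrightarrow> mm_dist X (f u) (f v) \<le> mm_dist Z u v"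
    and \<phi>: "parametrization \<phi> X" and \<zeta>: "parametrization \<zeta> Z" and eq: "AE s in I01. f (\<zeta> s) = \<phi> s"
  shows "dominated X Z"
proof -
  interpret X: mm X by standard fact
  interpret Z: mm Z by standard fact
  have fm: "f \<in> measurable (mm_meas Z) (mm_meas X)"
    using polish_lipschitz_measurable[OF Z.polish_axioms X.polish_axioms f lip]
    by (simp add: measurable_cong_sets[OF Z.sets_meas X.sets_meas])
  have "distr (mm_meas Z) (mm_meas X) f = distr (distr I01 (mm_meas Z) \<zeta>) (mm_meas X) f"
    using \<zeta> by (simp add: parametrization_def)
  also have "\<dots> = distr I01 (mm_meas X) (f \<circ> \<zeta>)"
    using fm \<zeta> by (intro distr_distr) (auto simp: parametrization_def)
  also have "\<dots> = distr I01 (mm_meas X) \<phi>"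
    using eq fm \<zeta> \<phi> by (intro distr_cong_AE) (auto simp: parametrization_def)
  also have "\<dots> = mm_meas X" using \<phi> by (simp add: parametrization_def)
  finally show ?thesis
    unfolding dominated_def using fm f lip by (intro exI[of _ f]) auto
qed

text \<open>Points of an mm-space are encoded as reals, so a product of two spaces must be encoded
  in the reals again.\<close>

lemma real_pairing_exists: "\<exists>e :: real \<times> real \<Rightarrow> real. bij e"
proof -
  have "\<exists>e. bij_betw e ((UNIV :: real set) \<times> (UNIV :: real set)) (UNIV :: real set)"
    unfolding card_of_ordIso by (rule card_of_Times_same_infinite) (simp add: infinite_UNIV_char_0)
  then show ?thesis by simp
qed

text \<open>Take parametrizations of X and Y that are constant on the intervals of a. Their joint
  law on the product with the maximum metric is then constant on these intervals too, so it keeps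
  the atoms, and both projections are 1-Lipschitz. A product measure would multiply the atoms
  instead.\<close>

lemma pyr_of_directed:
  assumes a: "a \<in> A_seq" and X: "X \<in> pyr_of a" and Y: "Y \<in> pyr_of a"
  shows "\<exists>Z\<in>pyr_of a. dominated X Z \<and> dominated Y Z"
proof -
  interpret X: mm X by standard (rule pyr_of_mm[OF X])
  interpret Y: mm Y by standard (rule pyr_of_mm[OF Y])
  obtain \<phi> x where \<phi>: "\<phi> \<in> measurable I01 X.borelM" "parametrization \<phi> X" "\<And>i s. s \<in> stepint a i \<Longrightarrow> \<phi> s = x i"
    using pyr_of_param[OF a X] by blast
  obtain \<psi> y where \<psi>: "\<psi> \<in> measurable I01 Y.borelM" "parametrization \<psi> Y" "\<And>i s. s \<in> stepint a i \<Longrightarrow> \<psi> s = y i"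
    using pyr_of_param[OF a Y] by blast
  obtain e :: "real \<times> real \<Rightarrow> real" where e: "bij e" using real_pairing_exists by blast
  define pr1 where "pr1 u = fst (inv e u)" for u
  define pr2 where "pr2 u = snd (inv e u)" for u
  have pr[simp]: "pr1 (e (p,q)) = p" "pr2 (e (p,q)) = q" for p q
    using e by (auto simp: pr1_def pr2_def bij_is_inj)
  have eq: "u = v" if "pr1 u = pr1 v" "pr2 u = pr2 v" for u v
  proof -
    have "inv e u = inv e v" using that by (simp add: pr1_def pr2_def prod_eq_iff)
    then show ?thesis using e by (metis bij_inv_eq_iff)
  qed
  define M where "M = {u. pr1 u \<in> mm_pts X \<and> pr2 u \<in> mm_pts Y}"
  define D where "D u v = max (mm_dist X (pr1 u) (pr1 v)) (mm_dist Y (pr2 u) (pr2 v))" for u v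
  interpret D: Metric_space M D
  proof
    show "0 \<le> D u v" for u v by (simp add: D_def le_max_iff_disj)
    show "D u v = D v u" for u v by (simp add: D_def X.commute Y.commute)
    show "D u v = 0 \<longleftrightarrow> u = v" if "u \<in> M" "v \<in> M" for u v
    proof
      assume "D u v = 0"
      then have "mm_dist X (pr1 u) (pr1 v) \<le> 0" "mm_dist Y (pr2 u) (pr2 v) \<le> 0"
        unfolding D_def by linarith+
      then have "mm_dist X (pr1 u) (pr1 v) = 0" "mm_dist Y (pr2 u) (pr2 v) = 0"
        using X.nonneg[of "pr1 u" "pr1 v"] Y.nonneg[of "pr2 u" "pr2 v"] by linarith+
      then have "pr1 u = pr1 v" "pr2 u = pr2 v"
        using that X.zero[of "pr1 u" "pr1 v"] Y.zero[of "pr2 u" "pr2 v"] by (simp_all add: M_def)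
      then show "u = v" by (rule eq)
    qed (use that in \<open>simp add: D_def M_def\<close>)
    show "D u w \<le> D u v + D v w" if "u \<in> M" "v \<in> M" "w \<in> M" for u v w
      using that X.triangle[of "pr1 u" "pr1 v" "pr1 w"] Y.triangle[of "pr2 u" "pr2 v" "pr2 w"]
      by (auto simp: D_def M_def)
  qed
  have "polish M D"
  proof
    show D.mcomplete
      unfolding D.mcomplete_def
    proof (intro allI impI)
      fix s assume s: "D.MCauchy s"
      then have sM: "s n \<in> M" for n by (auto simp: D.MCauchy_def)
      have c: "\<exists>N. \<forall>n n'. N \<le> n \<longrightarrow> N \<le> n' \<longrightarrow>
          mm_dist X (pr1 (s n)) (pr1 (s n')) < r \<and> mm_dist Y (pr2 (s n)) (pr2 (s n')) < r" if "0 < r" for r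
        using s that unfolding D.MCauchy_def D_def by (simp only: max_less_iff_conj)
      have "X.MCauchy (\<lambda>n. pr1 (s n))" "Y.MCauchy (\<lambda>n. pr2 (s n))"
        using c sM unfolding X.MCauchy_def Y.MCauchy_def M_def by blast+
      then obtain p q where p: "limitin X.mtopology (\<lambda>n. pr1 (s n)) p sequentially"
        and q: "limitin Y.mtopology (\<lambda>n. pr2 (s n)) q sequentially"
        using X.complete Y.complete unfolding X.mcomplete_def Y.mcomplete_def by blast
      have "limitin D.mtopology s (e (p,q)) sequentially"
        unfolding D.limitin_metric
      proof (intro conjI allI impI)
        show "e (p,q) \<in> M" using p q by (simp add: M_def X.limitin_metric Y.limitin_metric)
        fix r :: real assume "0 < r"
        then have "\<forall>\<^sub>F n in sequentially. mm_dist X (pr1 (s n)) p < r" "\<forall>\<^sub>F n in sequentially. mm_dist Y (pr2 (s n)) q < r"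
          using p q unfolding X.limitin_metric Y.limitin_metric by (auto elim!: eventually_mono)
        then show "\<forall>\<^sub>F n in sequentially. s n \<in> M \<and> D (s n) (e (p,q)) < r"
          by eventually_elim (simp add: sM D_def)
      qed
      then show "\<exists>l. limitin D.mtopology s l sequentially" by blast
    qed
    define C where "C = (\<lambda>(i,j). e (X.dense_seq i, Y.dense_seq j)) ` UNIV"
    show "separable_space D.mtopology"
      unfolding separable_space_def
    proof (intro exI conjI)
      show "countable C" by (simp add: C_def)
      have "e (X.dense_seq i, Y.dense_seq j) \<in> M" for i j by (simp add: M_def)
      then show "C \<subseteq> topspace D.mtopology" by (auto simp: C_def)
      show "D.mtopology closure_of C = topspace D.mtopology"
        unfolding D.metric_closure_of D.topspace_mtopology
      proof safe
        fix u r assume u: "u \<in> M" and r: "0 < (r::real)"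
        obtain i j where ij: "mm_dist X (X.dense_seq i) (pr1 u) < r" "mm_dist Y (Y.dense_seq j) (pr2 u) < r"
          using X.dense_seq_approx Y.dense_seq_approx u r unfolding M_def by blast
        have "e (X.dense_seq i, Y.dense_seq j) \<in> C" by (auto simp: C_def)
        moreover have "e (X.dense_seq i, Y.dense_seq j) \<in> D.mball u r"
          using u ij unfolding D.in_mball by (simp add: M_def D_def X.commute Y.commute)
        ultimately show "\<exists>y\<in>C. y \<in> D.mball u r" by blast
      qed
    qed
    have "e (X.dense_seq 0, Y.dense_seq 0) \<in> M" by (simp add: M_def)
    then show "M \<noteq> {}" by blast
  qed
  then interpret D: polish M D .
  have \<phi>M: "\<phi> s \<in> mm_pts X" "\<psi> s \<in> mm_pts Y" if "s \<in> {0..<1}" for s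
    using measurable_space[OF \<phi>(1), of s] measurable_space[OF \<psi>(1), of s] that by auto
  have "(\<lambda>s. e (\<phi> s, \<psi> s)) \<in> measurable I01 D.borelM"
  proof (rule D.measurable_borelM_I)
    fix c r assume c: "c \<in> M"
    have "{s \<in> space I01. D c (e (\<phi> s, \<psi> s)) < r} =
        {s\<in>{0..<1}. \<phi> s \<in> X.mball (pr1 c) r} \<inter> {s\<in>{0..<1}. \<psi> s \<in> Y.mball (pr2 c) r}"
      using c \<phi>M by (auto simp: D_def M_def)
    also have "\<dots> \<in> sets I01"
      using I01_preimage[OF \<phi>(1) X.mball_sets] I01_preimage[OF \<psi>(1) Y.mball_sets] by (intro sets.Int)
    finally show "{s \<in> space I01. D c (e (\<phi> s, \<psi> s)) < r} \<in> sets I01" .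
  qed (use \<phi>M in \<open>simp add: M_def\<close>)
  from mm_space_of_map[OF D.polish_axioms this] obtain Z \<zeta>
    where Z: "mm_space Z" "mm_pts Z \<subseteq> M" "mm_dist Z = D" "parametrization \<zeta> Z"
      and \<zeta>: "AE s in I01. \<zeta> s = e (\<phi> s, \<psi> s)" by blast
  have "Z \<in> pyr_of a"
  proof (rule pyr_of_I[OF a Z(1,4)])
    show "AE s in I01. s \<in> stepint a i \<longrightarrow> \<zeta> s = e (x i, y i)" for i
      using \<zeta> by eventually_elim (simp add: \<phi>(3) \<psi>(3))
  qed
  moreover have "dominated X Z"
    by (rule dominated_I[OF X.mm_space Z(1) _ _ \<phi>(2) Z(4), of pr1])
      (use Z \<zeta> in \<open>auto simp: M_def D_def\<close>)
  moreover have "dominated Y Z"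
    by (rule dominated_I[OF Y.mm_space Z(1) _ _ \<psi>(2) Z(4), of pr2])
      (use Z \<zeta> in \<open>auto simp: M_def D_def\<close>)
  ultimately show ?thesis by blast
qed

lemma pyramid_pyr_of:
  assumes a: "a \<in> A_seq" shows "pyramid (pyr_of a)"
  unfolding pyramid_def
proof (intro conjI ballI impI)
  show "pyr_of a \<subseteq> mmX" by (auto simp: pyr_of_def)
  obtain W w where W: "mm_space W" "atoms_exact (mm_meas W) a w" using exact_space_exists[OF a] by blast
  interpret W: mm W by standard fact
  show "pyr_of a \<noteq> {}"
  proof -
    have "W \<in> pyr_of a"
      using atoms_exact_fit[OF a W.prob_space_axioms W(2)] W(1) unfolding pyr_of_def mmX_def by blast
    then show ?thesis by blast
  qed
next
  fix X assume X: "X \<in> mmX" and lim: "\<forall>\<epsilon>>0. \<exists>Y\<in>pyr_of a. box X Y < \<epsilon>"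
  have "\<exists>Y\<in>pyr_of a. box X Y < 1 / real (Suc n)" for n using lim by simp
  then obtain Y where Y: "\<And>n. Y n \<in> pyr_of a" "\<And>n. box X (Y n) < 1 / real (Suc n)" by metis
  \<comment> \<open>Closedness is the limit lemma for a constant sequence of atom sequences.\<close>
  show "X \<in> pyr_of a"
  proof (rule pyr_of_limit[OF a, of "\<lambda>_. a"])
    show "box_rel (1 / real (Suc n)) X (Y n)" for n
      using X Y(2)[of n] pyr_of_mm[OF Y(1)[of n]] by (intro box_rel_of_less) (simp_all add: mmX_def)
    show "(\<lambda>n. 1 / real (Suc n)) \<longlonglongrightarrow> 0" by (rule LIMSEQ_Suc[OF lim_1_over_n])
  qed (use X Y a in \<open>auto simp: mmX_def\<close>)
next
  fix X Y assume "X \<in> pyr_of a" "Y \<in> mmX" "dominated Y X"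
  then show "Y \<in> pyr_of a" using pyr_of_dominated[OF a] by (simp add: mmX_def)
next
  fix X Y assume "X \<in> pyr_of a" "Y \<in> pyr_of a"
  then show "\<exists>Z\<in>pyr_of a. dominated X Z \<and> dominated Y Z" by (rule pyr_of_directed[OF a])
qed

section \<open>Approximation by changing the metric\<close>

context polish begin

text \<open>The function must equal the indicator off a small set, not merely be close to it: the
  exact values let the later embedding reproduce prescribed distances between cells.\<close>

definition lip_fit :: "'a measure \<Rightarrow> 'a set \<Rightarrow> real \<Rightarrow> ('a \<Rightarrow> real) \<Rightarrow> real \<Rightarrow> 'a set \<Rightarrow> bool" where
  "lip_fit \<mu> E \<epsilon> u L G \<longleftrightarrow> 0 \<le> L \<and> G \<in> sets borelM \<and> measure \<mu> (M - G) \<le> \<epsilon> \<and>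
     (\<forall>x\<in>M. \<forall>y\<in>M. \<bar>u x - u y\<bar> \<le> L * d x y) \<and> (\<forall>x\<in>G. u x = indicator E x)"

definition lip_approx :: "'a measure \<Rightarrow> 'a set \<Rightarrow> bool" where
  "lip_approx \<mu> E \<longleftrightarrow> (\<forall>\<epsilon>>0. \<exists>u L G. lip_fit \<mu> E \<epsilon> u L G)"

context
  fixes \<mu> assumes \<mu>: "prob_space \<mu>" "sets \<mu> = sets borelM"
begin

interpretation \<mu>: prob_space \<mu> by (fact \<mu>)

lemma lip_approx_empty: "lip_approx \<mu> {}"
  unfolding lip_approx_def
proof (intro allI impI)
  fix \<epsilon> :: real assume "\<epsilon> > 0"
  then show "\<exists>u L G. lip_fit \<mu> {} \<epsilon> u L G"
    unfolding lip_fit_def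
    using sets.top[of borelM] by (intro exI[of _ "\<lambda>_. 0"] exI[of _ 0] exI[of _ M]) auto
qed

text \<open>A linear cutoff in the distance to c, going from 1 to 0 between the radii r - 1/(m+1)
  and r, differs from the indicator only on the shell \<open>A m\<close>. The shells decrease to the
  empty set, so their measure tends to 0.\<close>

lemma lip_approx_mball: "lip_approx \<mu> (mball c r)"
proof (cases "c \<in> M")
  case False
  then have "mball c r = {}" by auto
  then show ?thesis using lip_approx_empty by simp
next
  case c: True
  show ?thesis
    unfolding lip_approx_def
  proof (intro allI impI)
    fix \<epsilon> :: real assume \<epsilon>: "\<epsilon> > 0"
    define A where "A m = mball c r - mcball c (r - 1 / real (Suc m))" for m
    have As: "A m \<in> sets \<mu>" for m unfolding A_def \<mu>(2) by (intro sets.Diff) auto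
    have "decseq A"
      unfolding A_def decseq_def
      by (intro allI impI Diff_mono mcball_subset_concentric diff_left_mono frac_le order_refl) auto
    then have "(\<lambda>m. \<mu>.prob (A m)) \<longlonglongrightarrow> \<mu>.prob (\<Inter>m. A m)"
      using As by (intro \<mu>.finite_Lim_measure_decseq) auto
    moreover have "(\<Inter>m. A m) = {}"
    proof (rule equals0I)
      fix x assume x: "x \<in> (\<Inter>m. A m)"
      then have "0 < r - d c x" by (auto simp: A_def)
      then obtain m where m: "1 / real (Suc m) < r - d c x" using nat_approx_posE by metis
      have "x \<in> A m" using x by blast
      moreover have "x \<in> M" using \<open>x \<in> A m\<close> by (simp add: A_def)
      then have "x \<in> mcball c (r - 1 / real (Suc m))" using m c by simp
      ultimately show False by (simp only: A_def) blast
    qed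
    ultimately have "(\<lambda>m. \<mu>.prob (A m)) \<longlonglongrightarrow> 0" by simp
    from order_tendstoD(2)[OF this \<epsilon>] obtain m where m: "\<mu>.prob (A m) < \<epsilon>"
      using eventually_happens'[OF trivial_limit_sequentially] by blast
    define u where "u x = max 0 (min 1 (real (Suc m) * (r - d c x)))" for x
    show "\<exists>u L G. lip_fit \<mu> (mball c r) \<epsilon> u L G"
      unfolding lip_fit_def
    proof (intro exI[of _ u] exI[of _ "real (Suc m)"] exI[of _ "M - A m"] conjI ballI)
      show "M - A m \<in> sets borelM" using As sets.top[of borelM] \<mu>(2) by auto
      have "M - (M - A m) = A m" by (auto simp: A_def)
      then show "\<mu>.prob (M - (M - A m)) \<le> \<epsilon>" using m by simp
      fix x y assume xy: "x \<in> M" "y \<in> M"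
      have "\<bar>u x - u y\<bar> \<le> \<bar>real (Suc m) * (r - d c x) - real (Suc m) * (r - d c y)\<bar>"
        unfolding u_def by linarith
      also have "\<dots> = real (Suc m) * \<bar>d c x - d c y\<bar>"
        unfolding right_diff_distrib[symmetric] abs_mult by (simp add: abs_minus_commute)
      also have "\<dots> \<le> real (Suc m) * d x y"
        using mdist_reverse_triangle[of x c y] xy c by (intro mult_left_mono) (auto simp: commute)
      finally show "\<bar>u x - u y\<bar> \<le> real (Suc m) * d x y" .
    next
      fix x assume x: "x \<in> M - A m"
      show "u x = indicator (mball c r) x"
      proof (cases "d c x < r")
        case True
        then have "d c x \<le> r - 1 / real (Suc m)" using x c by (auto simp: A_def)
        then have "1 \<le> real (Suc m) * (r - d c x)" by (simp add: field_simps)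
        then show ?thesis using True x c unfolding u_def by (simp add: indicator_def)
      next
        case False
        then have "real (Suc m) * (r - d c x) \<le> 0" by (intro mult_nonneg_nonpos) auto
        then show ?thesis using False unfolding u_def by (simp add: indicator_def)
      qed
    qed simp
  qed
qed

lemma lip_approx_compl:
  assumes "lip_approx \<mu> E" shows "lip_approx \<mu> (M - E)"
  unfolding lip_approx_def
proof (intro allI impI)
  fix \<epsilon> :: real assume "\<epsilon> > 0"
  then obtain u L G where G: "0 \<le> (L::real)" "G \<in> sets borelM" "measure \<mu> (M - G) \<le> \<epsilon>"
     "\<And>x y. x \<in> M \<Longrightarrow> y \<in> M \<Longrightarrow> \<bar>u x - u y\<bar> \<le> L * d x y" "\<And>x. x \<in> G \<Longrightarrow> u x = indicator E x"
    using assms unfolding lip_approx_def lip_fit_def by meson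
  have "G \<subseteq> M" using sets.sets_into_space[OF G(2)] by simp
  show "\<exists>u L G. lip_fit \<mu> (M - E) \<epsilon> u L G"
    unfolding lip_fit_def
  proof (intro exI[of _ "\<lambda>x. 1 - u x"] exI[of _ L] exI[of _ G] conjI ballI)
    show "\<bar>1 - u x - (1 - u y)\<bar> \<le> L * d x y" if "x \<in> M" "y \<in> M" for x y
      using G(4)[OF that] by linarith
    show "1 - u x = indicator (M - E) x" if "x \<in> G" for x
      using G(5)[OF that] \<open>G \<subseteq> M\<close> that by (auto simp: indicator_def)
  qed (use G in auto)
qed

lemma lip_approx_Un:
  assumes "lip_approx \<mu> E" "lip_approx \<mu> F" shows "lip_approx \<mu> (E \<union> F)"
  unfolding lip_approx_def
proof (intro allI impI)
  fix \<epsilon> :: real assume "\<epsilon> > 0"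
  then have \<epsilon>: "\<epsilon> / 2 > 0" by simp
  obtain u L G where G: "0 \<le> (L::real)" "G \<in> sets borelM" "measure \<mu> (M - G) \<le> \<epsilon> / 2"
     "\<And>x y. x \<in> M \<Longrightarrow> y \<in> M \<Longrightarrow> \<bar>u x - u y\<bar> \<le> L * d x y" "\<And>x. x \<in> G \<Longrightarrow> u x = indicator E x"
    using assms(1) \<epsilon> unfolding lip_approx_def lip_fit_def by meson
  obtain u' L' G' where G': "0 \<le> (L'::real)" "G' \<in> sets borelM" "measure \<mu> (M - G') \<le> \<epsilon> / 2"
     "\<And>x y. x \<in> M \<Longrightarrow> y \<in> M \<Longrightarrow> \<bar>u' x - u' y\<bar> \<le> L' * d x y" "\<And>x. x \<in> G' \<Longrightarrow> u' x = indicator F x"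
    using assms(2) \<epsilon> unfolding lip_approx_def lip_fit_def by meson
  show "\<exists>u L G. lip_fit \<mu> (E \<union> F) \<epsilon> u L G"
    unfolding lip_fit_def
  proof (intro exI[of _ "\<lambda>x. max (u x) (u' x)"] exI[of _ "L + L'"] exI[of _ "G \<inter> G'"] conjI ballI)
    have "measure \<mu> (M - G \<inter> G') = measure \<mu> ((M - G) \<union> (M - G'))" by (simp add: Diff_Int)
    also have "\<dots> \<le> measure \<mu> (M - G) + measure \<mu> (M - G')"
      using G(2) G'(2) \<mu>(2) sets.top[of borelM] by (intro measure_Un_le) auto
    finally show "measure \<mu> (M - G \<inter> G') \<le> \<epsilon>" using G(3) G'(3) by simp
    show "\<bar>max (u x) (u' x) - max (u y) (u' y)\<bar> \<le> (L + L') * d x y" if "x \<in> M" "y \<in> M" for x y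
    proof -
      have "0 \<le> L * d x y" "0 \<le> L' * d x y" using G(1) G'(1) by simp_all
      then show ?thesis using G(4)[OF that] G'(4)[OF that] unfolding distrib_right by linarith
    qed
    show "max (u x) (u' x) = indicator (E \<union> F) x" if "x \<in> G \<inter> G'" for x
      using G(5)[of x] G'(5)[of x] that by (auto simp: indicator_def)
  qed (use G G' in auto)
qed

text \<open>A finite partial union exhausts the union up to measure \<epsilon>/2; the rest R is
  added to the exceptional set.\<close>

lemma lip_approx_UN:
  fixes E :: "nat \<Rightarrow> 'a set"
  assumes E: "\<And>i. E i \<in> sets borelM" and app: "\<And>i. lip_approx \<mu> (E i)"
  shows "lip_approx \<mu> (\<Union>i. E i)"
  unfolding lip_approx_def
proof (intro allI impI)
  fix \<epsilon> :: real assume "\<epsilon> > 0"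
  then have \<epsilon>: "\<epsilon> / 2 > 0" by simp
  define U where "U n = (\<Union>i<n. E i)" for n
  have Us: "U n \<in> sets borelM" for n using E by (auto simp: U_def)
  have UEs: "(\<Union>i. E i) \<in> sets borelM" using E by auto
  have appU: "lip_approx \<mu> (U n)" for n
  proof (induction n)
    case (Suc n)
    have "U (Suc n) = U n \<union> E n" by (auto simp: U_def less_Suc_eq)
    then show ?case using lip_approx_Un[OF Suc app] by simp
  qed (simp add: U_def lip_approx_empty)
  have "(\<lambda>n. \<mu>.prob (U n)) \<longlonglongrightarrow> \<mu>.prob (\<Union>n. U n)"
    using Us \<mu>(2) by (intro \<mu>.finite_Lim_measure_incseq) (auto simp: incseq_def U_def intro: order.strict_trans2)
  moreover have "(\<Union>n. U n) = (\<Union>i. E i)" by (auto simp: U_def)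
  ultimately have "(\<lambda>n. \<mu>.prob (\<Union>i. E i) - \<mu>.prob (U n)) \<longlonglongrightarrow> \<mu>.prob (\<Union>i. E i) - \<mu>.prob (\<Union>i. E i)"
    by (intro tendsto_diff tendsto_const) simp
  then have "\<forall>\<^sub>F n in sequentially. \<mu>.prob (\<Union>i. E i) - \<mu>.prob (U n) < \<epsilon> / 2"
    using \<epsilon> by (intro order_tendstoD(2)) auto
  then obtain n where n: "\<mu>.prob (\<Union>i. E i) - \<mu>.prob (U n) < \<epsilon> / 2"
    using eventually_happens'[OF trivial_limit_sequentially] by blast
  define R where "R = (\<Union>i. E i) - U n"
  have Rs: "R \<in> sets borelM" unfolding R_def using Us UEs by blast
  have R: "\<mu>.prob R < \<epsilon> / 2"
    unfolding R_def using n Us[of n] UEs \<mu>(2) by (subst \<mu>.finite_measure_Diff) (auto simp: U_def)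
  obtain u L G where G: "0 \<le> (L::real)" "G \<in> sets borelM" "measure \<mu> (M - G) \<le> \<epsilon> / 2"
     "\<And>x y. x \<in> M \<Longrightarrow> y \<in> M \<Longrightarrow> \<bar>u x - u y\<bar> \<le> L * d x y" "\<And>x. x \<in> G \<Longrightarrow> u x = indicator (U n) x"
    using appU[of n] \<epsilon> unfolding lip_approx_def lip_fit_def by meson
  show "\<exists>u L G. lip_fit \<mu> (\<Union>i. E i) \<epsilon> u L G"
    unfolding lip_fit_def
  proof (intro exI[of _ u] exI[of _ L] exI[of _ "G - R"] conjI ballI)
    have "\<mu>.prob (M - (G - R)) \<le> \<mu>.prob ((M - G) \<union> R)"
      using G(2) Rs \<mu>(2) sets.top[of borelM] by (intro \<mu>.finite_measure_mono) auto
    also have "\<dots> \<le> \<mu>.prob (M - G) + \<mu>.prob R"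
      using G(2) Rs \<mu>(2) sets.top[of borelM] by (intro measure_Un_le) auto
    finally show "\<mu>.prob (M - (G - R)) \<le> \<epsilon>" using G(3) R by simp
    show "u x = indicator (\<Union>i. E i) x" if "x \<in> G - R" for x
      using G(5)[of x] that by (auto simp: indicator_def R_def U_def)
  qed (use G Rs in auto)
qed

text \<open>The approximable sets contain the balls and are closed under complements and countable
  unions; open sets are countable unions of base balls.\<close>

lemma lip_approx_borel:
  assumes "E \<in> sets borelM" shows "lip_approx \<mu> E"
proof -
  have "E \<in> sigma_sets M {U. openin mtopology U}"
    using assms open_sub_Pow by (simp add: borelM_def sets_measure_of)
  then show ?thesis
  proof (induction rule: sigma_sets.induct)
    case (Basic U)
    then have U: "openin mtopology U" by simp
    define C where "C n = (if base_ball n \<subseteq> U then base_ball n else {})" for n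
    have "U = (\<Union>n. C n)"
      using open_eq_Union_base_balls[OF U] by (auto simp: C_def split: if_splits)
    moreover have "lip_approx \<mu> (\<Union>n. C n)"
      by (rule lip_approx_UN) (simp_all add: C_def base_ball_def lip_approx_mball lip_approx_empty)
    ultimately show ?case by simp
  next
    case (Compl E)
    show ?case by (rule lip_approx_compl[OF Compl.IH])
  next
    case (Union E)
    have "E i \<in> sets borelM" for i
      using Union(1) open_sub_Pow by (simp add: borelM_def sets_measure_of)
    then show ?case using Union(2) by (rule lip_approx_UN)
  qed (rule lip_approx_empty)
qed

end

end

text \<open>Compose Lipschitz approximations of the indicators of the E j with the Kuratowski embedding
  of the finite space ({..<N}, D), and add a small multiple of the capped original metric so
  that the topology, hence the Borel structure, does not change.\<close>

lemma (in mm) finite_remetric: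
  fixes N :: nat and D :: "nat \<Rightarrow> nat \<Rightarrow> real"
  assumes E: "\<And>j. j < N \<Longrightarrow> E j \<in> sets borelM"
    and disj: "\<And>i j. i < N \<Longrightarrow> j < N \<Longrightarrow> i \<noteq> j \<Longrightarrow> E i \<inter> E j = {}"
    and D0: "\<And>i. D i i = 0" and Dc: "\<And>i j. D i j = D j i" and Dt: "\<And>i j k. D i k \<le> D i j + D j k"
    and \<eta>: "\<eta> > 0"
  shows "\<exists>\<rho> L G. 0 < L \<and> mm_space (mm_pts X, \<rho>, mm_meas X) \<and>
    (\<forall>x\<in>mm_pts X. \<forall>y\<in>mm_pts X. \<rho> x y \<le> L * mm_dist X x y) \<and>
    G \<in> events \<and> prob (mm_pts X - G) \<le> \<eta> \<and>
    (\<forall>i<N. \<forall>j<N. \<forall>x\<in>G \<inter> E i. \<forall>y\<in>G \<inter> E j. \<bar>\<rho> x y - D i j\<bar> \<le> \<eta>)"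
proof -
  \<comment> \<open>The N exceptional sets together may cost \<eta>; \<open>Suc\<close> avoids
    division by 0.\<close>
  define \<epsilon> where "\<epsilon> = \<eta> / real (Suc N)"
  have \<epsilon>: "\<epsilon> > 0" using \<eta> by (simp add: \<epsilon>_def)
  have "\<forall>j. \<exists>u L G. j < N \<longrightarrow> lip_fit (mm_meas X) (E j) \<epsilon> u L G"
    using lip_approx_borel[OF prob_space_axioms sets_meas E] \<epsilon> unfolding lip_approx_def by meson
  then obtain u L G where Q: "\<And>j. j < N \<Longrightarrow> lip_fit (mm_meas X) (E j) \<epsilon> (u j) (L j) (G j)" by metis
  have L0: "0 \<le> L j" and Gs: "G j \<in> sets borelM" and Gm: "prob (mm_pts X - G j) \<le> \<epsilon>"
    and lip: "\<And>x y. x \<in> mm_pts X \<Longrightarrow> y \<in> mm_pts X \<Longrightarrow> \<bar>u j x - u j y\<bar> \<le> L j * mm_dist X x y"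
    and uG: "\<And>x. x \<in> G j \<Longrightarrow> u j x = indicator (E j) x" if "j < N" for j
    using Q[OF that] unfolding lip_fit_def by auto
  define GG where "GG = mm_pts X - (\<Union>j<N. mm_pts X - G j)"
  have GGs: "GG \<in> events"
    unfolding GG_def sets_meas using Gs sets.top[of borelM] by (intro sets.Diff sets.finite_UN) auto
  have "prob (mm_pts X - GG) = prob (\<Union>j<N. mm_pts X - G j)"
    unfolding GG_def by (rule arg_cong[where f = prob]) auto
  also have "\<dots> \<le> (\<Sum>j<N. prob (mm_pts X - G j))"
    using Gs sets.top[of borelM] sets_meas by (intro measure_UNION_le) auto
  also have "\<dots> \<le> (\<Sum>j<N. \<epsilon>)" using Gm by (intro sum_mono) auto
  also have "\<dots> \<le> \<eta>" using \<eta> by (simp add: \<epsilon>_def field_simps)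
  finally have GGm: "prob (mm_pts X - GG) \<le> \<eta>" .
  have GG: "x \<in> G j" "x \<in> mm_pts X" if "x \<in> GG" "j < N" for x j using that by (auto simp: GG_def)
  \<comment> \<open>Coordinate z of the Kuratowski embedding, sending i to the vector of all D z i,
    extended to the whole space by a Lipschitz combination; on the good part of E i only the term j
    = i survives.\<close>
  define v where "v z x = (\<Sum>j<N. D z j * u j x)" for z x
  have vE: "v z x = D z i" if "x \<in> GG" "x \<in> E i" "i < N" for z x i
  proof -
    have "v z x = (\<Sum>j<N. if j = i then D z i else 0)"
      unfolding v_def
    proof (rule sum.cong)
      fix j assume "j \<in> {..<N}"
      then show "D z j * u j x = (if j = i then D z i else 0)"
        using uG[of j x] GG[OF that(1)] disj[of i j] that by (auto simp: indicator_def)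
    qed simp
    then show ?thesis using that by simp
  qed
  define Lv where "Lv z = (\<Sum>j<N. \<bar>D z j\<bar> * L j)" for z
  have Lv0: "0 \<le> Lv z" for z using L0 by (auto simp: Lv_def intro!: sum_nonneg)
  have vlip: "\<bar>v z x - v z y\<bar> \<le> Lv z * mm_dist X x y" if "x \<in> mm_pts X" "y \<in> mm_pts X" for z x y
  proof -
    have "\<bar>v z x - v z y\<bar> = \<bar>\<Sum>j<N. D z j * (u j x - u j y)\<bar>"
      by (simp add: v_def sum_subtractf right_diff_distrib)
    also have "\<dots> \<le> (\<Sum>j<N. \<bar>D z j * (u j x - u j y)\<bar>)" by (rule sum_abs)
    also have "\<dots> \<le> (\<Sum>j<N. \<bar>D z j\<bar> * (L j * mm_dist X x y))"
      unfolding abs_mult using lip that by (intro sum_mono mult_left_mono) auto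
    also have "\<dots> = Lv z * mm_dist X x y" by (simp add: Lv_def sum_distrib_right mult.assoc)
    finally show ?thesis .
  qed
  \<comment> \<open>The inserted 0 keeps the maximum meaningful when N = 0.\<close>
  define R where "R x y = insert 0 ((\<lambda>z. \<bar>v z x - v z y\<bar>) ` {..<N})" for x y
  define \<rho>0 where "\<rho>0 x y = Max (R x y)" for x y
  have Rfin: "finite (R x y)" "R x y \<noteq> {}" for x y by (auto simp: R_def)
  have \<rho>0_nonneg: "0 \<le> \<rho>0 x y" for x y unfolding \<rho>0_def by (rule Max_ge) (auto simp: R_def)
  have \<rho>0_ge: "\<bar>v z x - v z y\<bar> \<le> \<rho>0 x y" if "z < N" for z x y
    unfolding \<rho>0_def by (rule Max_ge) (use that in \<open>auto simp: R_def\<close>)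
  have \<rho>0_le: "\<rho>0 x y \<le> b" if "0 \<le> b" "\<And>z. z < N \<Longrightarrow> \<bar>v z x - v z y\<bar> \<le> b" for x y b
    unfolding \<rho>0_def using Rfin that by (simp add: R_def)
  have \<rho>0_commute: "\<rho>0 x y = \<rho>0 y x" for x y by (simp add: \<rho>0_def R_def abs_minus_commute)
  have \<rho>0_tri: "\<rho>0 x w \<le> \<rho>0 x y + \<rho>0 y w" for x y w
  proof (rule \<rho>0_le)
    fix z assume "z < N"
    then show "\<bar>v z x - v z w\<bar> \<le> \<rho>0 x y + \<rho>0 y w"
      using \<rho>0_ge[of z x y] \<rho>0_ge[of z y w] by linarith
  qed (simp add: \<rho>0_nonneg)
  have \<rho>0_self: "\<rho>0 x x = 0" for x
    using \<rho>0_le[of 0 x x] \<rho>0_nonneg[of x x] by simp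
  define L1 where "L1 = (\<Sum>z<N. Lv z)"
  have L10: "0 \<le> L1" using Lv0 by (simp add: L1_def sum_nonneg)
  have \<rho>0_lip: "\<rho>0 x y \<le> L1 * mm_dist X x y" if xy: "x \<in> mm_pts X" "y \<in> mm_pts X" for x y
  proof (rule \<rho>0_le)
    show "0 \<le> L1 * mm_dist X x y" using L10 by simp
    fix z assume "z < N"
    then have "Lv z \<le> L1" unfolding L1_def using Lv0 by (intro member_le_sum) auto
    then have "Lv z * mm_dist X x y \<le> L1 * mm_dist X x y" by (rule mult_right_mono) simp
    then show "\<bar>v z x - v z y\<bar> \<le> L1 * mm_dist X x y" using vlip[OF xy, of z] by linarith
  qed
  \<comment> \<open>\<rho>0 may vanish between distinct points. The second term separates them, and
    the cap at 1 keeps its contribution at most \<eta>.\<close>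
  define \<rho> where "\<rho> x y = \<rho>0 x y + \<eta> * min 1 (mm_dist X x y)" for x y
  have \<rho>_lip: "\<rho> x y \<le> (L1 + \<eta>) * mm_dist X x y" if "x \<in> mm_pts X" "y \<in> mm_pts X" for x y
  proof -
    have "\<eta> * min 1 (mm_dist X x y) \<le> \<eta> * mm_dist X x y" using \<eta> by (intro mult_left_mono) auto
    then show ?thesis using \<rho>0_lip[OF that] by (simp add: \<rho>_def distrib_right)
  qed
  have \<rho>_ge: "\<eta> * min 1 (mm_dist X x y) \<le> \<rho> x y" for x y using \<rho>0_nonneg by (simp add: \<rho>_def)
  have min0: "0 \<le> min 1 (mm_dist X x y)" for x y by simp
  have "mm_space (mm_pts X, \<rho>, mm_meas X)"
  proof (rule mm_space_remetric[OF mm_space])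
    show "Metric_space (mm_pts X) \<rho>"
    proof
      show "0 \<le> \<rho> x y" for x y using \<rho>0_nonneg min0 \<eta> by (simp add: \<rho>_def)
      show "\<rho> x y = \<rho> y x" for x y using \<rho>0_commute commute by (simp add: \<rho>_def)
      show "\<rho> x y = 0 \<longleftrightarrow> x = y" if xy: "x \<in> mm_pts X" "y \<in> mm_pts X" for x y
      proof
        assume "\<rho> x y = 0"
        then have "\<eta> * min 1 (mm_dist X x y) \<le> 0" using \<rho>_ge[of x y] by simp
        then have "min 1 (mm_dist X x y) \<le> 0" using \<eta> by (simp add: mult_le_0_iff)
        then have "mm_dist X x y = 0" using nonneg[of x y] by linarith
        then show "x = y" using xy by simp
      qed (use xy \<rho>0_self in \<open>simp add: \<rho>_def\<close>)
      show "\<rho> x w \<le> \<rho> x y + \<rho> y w" if "x \<in> mm_pts X" "y \<in> mm_pts X" "w \<in> mm_pts X" for x y w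
      proof -
        have "min 1 (mm_dist X x w) \<le> min 1 (mm_dist X x y) + min 1 (mm_dist X y w)"
          using triangle[OF that] nonneg[of x y] nonneg[of y w] by linarith
        then have "\<eta> * min 1 (mm_dist X x w) \<le> \<eta> * (min 1 (mm_dist X x y) + min 1 (mm_dist X y w))"
          using \<eta> by (intro mult_left_mono) auto
        then show ?thesis using \<rho>0_tri[of x w y] by (simp add: \<rho>_def distrib_left)
      qed
    qed
    fix e :: real assume e: "e > 0"
    show "\<exists>\<delta>>0. \<forall>x\<in>mm_pts X. \<forall>y\<in>mm_pts X. mm_dist X x y < \<delta> \<longrightarrow> \<rho> x y < e"
    proof (intro exI[of _ "e / (L1 + \<eta>)"] conjI ballI impI)
      show "0 < e / (L1 + \<eta>)" using e L10 \<eta> by simp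
      fix x y assume xy: "x \<in> mm_pts X" "y \<in> mm_pts X" "mm_dist X x y < e / (L1 + \<eta>)"
      then have "(L1 + \<eta>) * mm_dist X x y < e" using L10 \<eta> by (simp add: field_simps)
      then show "\<rho> x y < e" using \<rho>_lip[OF xy(1,2)] by simp
    qed
    show "\<exists>\<delta>>0. \<forall>x\<in>mm_pts X. \<forall>y\<in>mm_pts X. \<rho> x y < \<delta> \<longrightarrow> mm_dist X x y < e"
    proof (intro exI[of _ "\<eta> * min 1 e"] conjI ballI impI)
      show "0 < \<eta> * min 1 e" using e \<eta> by simp
      fix x y assume "\<rho> x y < \<eta> * min 1 e"
      then have "\<eta> * min 1 (mm_dist X x y) < \<eta> * min 1 e" using \<rho>_ge[of x y] by simp
      then have "min 1 (mm_dist X x y) < min 1 e" using \<eta> by simp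
      then show "mm_dist X x y < e" by linarith
    qed
  qed
  moreover have "\<bar>\<rho> x y - D i j\<bar> \<le> \<eta>"
    if ij: "i < N" "j < N" and xy: "x \<in> GG \<inter> E i" "y \<in> GG \<inter> E j" for i j x y
  proof -
    have eq: "v z x = D z i" "v z y = D z j" for z using vE ij xy by auto
    \<comment> \<open>The Kuratowski embedding is isometric: the triangle inequality bounds every
      coordinate difference by D i j, and coordinate z = i attains it.\<close>
    have "\<rho>0 x y = D i j"
    proof (rule antisym)
      have Dnn: "0 \<le> D i j" using Dt[of i i j] D0[of i] Dc[of i j] by simp
      show "\<rho>0 x y \<le> D i j"
      proof (rule \<rho>0_le[OF Dnn])
        show "\<bar>v z x - v z y\<bar> \<le> D i j" for z
          unfolding eq using Dt[of z i j] Dt[of z j i] Dc[of i j] by linarith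
      qed
      show "D i j \<le> \<rho>0 x y" using \<rho>0_ge[OF ij(1), of x y] D0[of i] unfolding eq by linarith
    qed
    moreover have "0 \<le> \<eta> * min 1 (mm_dist X x y)" "\<eta> * min 1 (mm_dist X x y) \<le> \<eta>"
      using \<eta> min0 by (simp_all add: mult_left_le)
    ultimately show ?thesis by (simp add: \<rho>_def)
  qed
  ultimately show ?thesis
    using \<rho>_lip GGs GGm L10 \<eta> by (intro exI[of _ \<rho>] exI[of _ "L1 + \<eta>"] exI[of _ GG]) auto
qed

section \<open>Separated cells on the parameter interval and the box approximation\<close>

lemma I01_inner_closed:
  assumes T: "T \<in> sets I01" and e: "e > 0"
  shows "\<exists>K. compact K \<and> K \<subseteq> T \<and> K \<in> sets I01 \<and> measure I01 (T - K) < e"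
proof -
  have Tb: "T \<in> sets borel" "T \<subseteq> {0..<1}" using T by (auto simp: sets_I01)
  then have "T \<in> sets lebesgue" by simp
  then obtain K where K: "closed K" "K \<subseteq> T" "T - K \<in> lmeasurable" "emeasure lebesgue (T - K) < ennreal e"
    using e by (rule sets_lebesgue_inner_closed)
  have "K \<subseteq> {0..1}" using K(2) Tb(2) by fastforce
  then have "bounded K" by (rule bounded_subset[OF bounded_closed_interval])
  then have "compact K" using K(1) by (simp add: compact_eq_bounded_closed)
  have Ks: "K \<in> sets I01" using K Tb by (auto simp: sets_I01)
  have D: "T - K \<in> sets I01" using T Ks by blast
  then have "T - K \<in> sets lborel" by (simp add: sets_I01)
  then have "emeasure I01 (T - K) < ennreal e"
    using K(4) emeasure_I01[OF D] by simp
  then have "measure I01 (T - K) < e"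
    using e by (simp add: I01.emeasure_eq_measure ennreal_less_iff)
  then show ?thesis using \<open>compact K\<close> K(2) Ks by blast
qed

text \<open>J splits X into cells, each point being \<epsilon>-close to the centre p of its cell.
  The sets K j are shrunken parameter sets of the cells: giving up measure \<epsilon> buys a
  positive gap \<delta> between the first N of them.\<close>

definition cell_approx ::
  "mm \<Rightarrow> (real \<Rightarrow> real) \<Rightarrow> real \<Rightarrow> nat \<Rightarrow> (nat \<Rightarrow> real) \<Rightarrow> (real \<Rightarrow> nat) \<Rightarrow> real \<Rightarrow> (nat \<Rightarrow> real set) \<Rightarrow> bool" where
  "cell_approx X \<psi> \<epsilon> N p J \<delta> K \<longleftrightarrow>
    (\<forall>j. p j \<in> mm_pts X) \<and> (\<forall>j. {x\<in>mm_pts X. J x = j} \<in> sets (mm_meas X)) \<and>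
    (\<forall>x\<in>mm_pts X. mm_dist X (p (J x)) x < \<epsilon>) \<and> 0 < \<delta> \<and>
    (\<forall>j. K j \<in> sets I01 \<and> (\<forall>s\<in>K j. J (\<psi> s) = j)) \<and>
    1 - \<epsilon> \<le> measure I01 (\<Union>j<N. K j) \<and>
    (\<forall>i<N. \<forall>j<N. i \<noteq> j \<longrightarrow> (\<forall>s\<in>K i. \<forall>t\<in>K j. \<delta> \<le> \<bar>s - t\<bar>))"

text \<open>A point belongs to the cell of the first dense point within \<epsilon>. Finitely many
  cells carry almost all parameters; inner regularity replaces their parameter sets by compact ones,
  and disjoint compact sets have positive distance.\<close>

lemma (in mm) cell_approx_exists:
  assumes \<psi>: "\<psi> \<in> measurable I01 borelM" and \<epsilon>: "\<epsilon> > 0"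
  shows "\<exists>N p J \<delta> K. cell_approx X \<psi> \<epsilon> N p J \<delta> K"
proof -
  define J where "J x = (LEAST j. mm_dist X (dense_seq j) x < \<epsilon>)" for x
  have near: "mm_dist X (dense_seq (J x)) x < \<epsilon>" if "x \<in> mm_pts X" for x
    unfolding J_def by (rule LeastI_ex) (rule dense_seq_approx[OF that \<epsilon>])
  have [measurable]: "mm_dist X (dense_seq j) \<in> borel_measurable borelM" for j
    by (rule dist_measurable) simp
  have "J \<in> measurable borelM (count_space UNIV)" unfolding J_def by measurable
  then have Js: "{x\<in>mm_pts X. J x = j} \<in> sets borelM" for j
    using measurable_sets[of J borelM "count_space UNIV" "{j}"] by (simp add: vimage_def Int_def conj_commute)
  have \<psi>M: "\<psi> s \<in> mm_pts X" if "s \<in> {0..<1}" for s using measurable_space[OF \<psi>, of s] that by simp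
  define T where "T j = {s\<in>{0..<1}. \<psi> s \<in> {x\<in>mm_pts X. J x = j}}" for j
  have Ts: "T j \<in> sets I01" for j unfolding T_def by (rule I01_preimage[OF \<psi> Js])
  have "(\<lambda>n. measure I01 (\<Union>j<n. T j)) \<longlonglongrightarrow> measure I01 (\<Union>n. \<Union>j<n. T j)"
    using Ts by (intro I01.finite_Lim_measure_incseq)
      (auto simp: incseq_def intro: order.strict_trans2)
  moreover have "(\<Union>n. \<Union>j<n. T j) = space I01" using \<psi>M by (auto simp: T_def)
  ultimately have "(\<lambda>n. measure I01 (\<Union>j<n. T j)) \<longlonglongrightarrow> 1" using I01.prob_space by simp
  from order_tendstoD(1)[OF this, of "1 - \<epsilon> / 2"] \<epsilon>
  have "\<forall>\<^sub>F n in sequentially. 1 - \<epsilon> / 2 < measure I01 (\<Union>j<n. T j)" by simp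
  then obtain N where N: "1 - \<epsilon> / 2 < measure I01 (\<Union>j<N. T j)"
    using eventually_happens'[OF trivial_limit_sequentially] by blast
  \<comment> \<open>Half of \<epsilon> was spent on the discarded cells; the other half is shared by
    the N shrinkings.\<close>
  define \<epsilon>' where "\<epsilon>' = \<epsilon> / (2 * real (Suc N))"
  have \<epsilon>': "\<epsilon>' > 0" using \<epsilon> by (simp add: \<epsilon>'_def)
  have "\<forall>j. \<exists>K. compact K \<and> K \<subseteq> T j \<and> K \<in> sets I01 \<and> measure I01 (T j - K) < \<epsilon>'"
    using I01_inner_closed[OF Ts \<epsilon>'] by blast
  then obtain K where K: "\<And>j. compact (K j)" "\<And>j. K j \<subseteq> T j" "\<And>j. K j \<in> sets I01" "\<And>j. measure I01 (T j - K j) < \<epsilon>'"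
    by metis
  have "measure I01 (\<Union>j<N. T j) \<le> measure I01 ((\<Union>j<N. K j) \<union> (\<Union>j<N. T j - K j))"
    using K(3) Ts by (intro I01.finite_measure_mono) auto
  also have "\<dots> \<le> measure I01 (\<Union>j<N. K j) + measure I01 (\<Union>j<N. T j - K j)"
    using K(3) Ts by (intro measure_Un_le) auto
  also have "measure I01 (\<Union>j<N. T j - K j) \<le> (\<Sum>j<N. measure I01 (T j - K j))"
    using K(3) Ts by (intro measure_UNION_le) auto
  also have "\<dots> \<le> (\<Sum>j<N. \<epsilon>')" using K(4) by (intro sum_mono) (simp add: less_imp_le)
  also have "\<dots> \<le> \<epsilon> / 2" using \<epsilon> by (simp add: \<epsilon>'_def field_simps)
  finally have meas: "1 - \<epsilon> \<le> measure I01 (\<Union>j<N. K j)" using N by simp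
  have "\<forall>i j. \<exists>d>0. i \<noteq> j \<longrightarrow> (\<forall>s\<in>K i. \<forall>t\<in>K j. d \<le> \<bar>s - t\<bar>)"
  proof (intro allI)
    fix i j
    show "\<exists>d>0. i \<noteq> j \<longrightarrow> (\<forall>s\<in>K i. \<forall>t\<in>K j. d \<le> \<bar>s - t\<bar>)"
    proof (cases "i = j")
      case False
      have "K i \<inter> K j = {}" using K(2)[of i] K(2)[of j] False unfolding T_def by blast
      then have "\<exists>d>0. \<forall>s\<in>K i. \<forall>t\<in>K j. d \<le> dist s t"
        using K(1) by (intro separate_compact_closed compact_imp_closed) auto
      then show ?thesis unfolding dist_real_def by blast
    qed (auto intro: exI[of _ 1])
  qed
  then obtain dd where dd: "\<And>i j. 0 < dd i j"
    "\<And>i j s t. i \<noteq> j \<Longrightarrow> s \<in> K i \<Longrightarrow> t \<in> K j \<Longrightarrow> dd i j \<le> \<bar>s - t\<bar>" by metis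
  define \<delta> where "\<delta> = Min (insert 1 ((\<lambda>(i,j). dd i j) ` ({..<N} \<times> {..<N})))"
  have "\<delta> > 0" unfolding \<delta>_def using dd(1) by (subst Min_gr_iff) auto
  moreover have "\<delta> \<le> dd i j" if "i < N" "j < N" for i j
    unfolding \<delta>_def using that by (intro Min_le) auto
  ultimately show ?thesis
    unfolding cell_approx_def sets_meas
  proof (intro exI[of _ N] exI[of _ dense_seq] exI[of _ J] exI[of _ \<delta>] exI[of _ K] conjI allI ballI impI)
    show "J (\<psi> s) = j" if "s \<in> K j" for j s using that K(2)[of j] by (auto simp: T_def)
    show "\<delta> \<le> \<bar>s - t\<bar>" if "i < N" "j < N" "i \<noteq> j" "s \<in> K i" "t \<in> K j" for i j s t
      using dd(2)[OF that(3-5)] \<open>\<And>i j. i < N \<Longrightarrow> j < N \<Longrightarrow> \<delta> \<le> dd i j\<close>[OF that(1,2)] by simp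
  qed (use Js near K(3) meas in simp_all)
qed

text \<open>X is replaced by a step function on compact sets K j at mutual distance at least \<delta>. An
  atom interval of W shorter than \<delta> meets at most one K j, so the step function is almost
  constant on it; the long atom intervals are matched with those of X. On the diffuse part,
  the left inverse k of the parametrization allows any prescribed assignment.\<close>

lemma box_approx_core:
  fixes K :: "nat \<Rightarrow> real set"
  assumes X: "mm_space X" and \<psi>: "parametrization \<psi> X" and a: "a \<in> A_seq"
    and \<psi>x: "\<And>i s. s \<in> stepint a i \<Longrightarrow> \<psi> s = x i"
    and cells: "cell_approx X \<psi> \<epsilon> N p J \<delta> K"
    and \<epsilon>: "\<epsilon> > 0"
    and b: "b \<in> A_seq" and W: "mm_space W" and w: "atoms_exact (mm_meas W) b w"
    and N1: "\<And>i. N1 \<le> i \<Longrightarrow> b i < \<delta>"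
    and bad: "(\<Sum>i<N1. measure I01 (stepint b i - stepint a i)) \<le> \<epsilon>"
  shows "\<exists>\<rho> L. 0 < L \<and> mm_space (mm_pts W, \<rho>, mm_meas W) \<and>
    (\<forall>x\<in>mm_pts W. \<forall>y\<in>mm_pts W. \<rho> x y \<le> L * mm_dist W x y) \<and>
    box_rel (4 * \<epsilon>) X (mm_pts W, \<rho>, mm_meas W)"
proof -
  interpret X: mm X by standard fact
  interpret W: mm W by standard fact
  have p: "p j \<in> mm_pts X" and J: "{x\<in>mm_pts X. J x = j} \<in> sets (mm_meas X)"
    and near: "x \<in> mm_pts X \<Longrightarrow> mm_dist X (p (J x)) x < \<epsilon>"
    and K: "K j \<in> sets I01" "s \<in> K j \<Longrightarrow> J (\<psi> s) = j"
      "1 - \<epsilon> \<le> measure I01 (\<Union>j<N. K j)"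
      "i < N \<Longrightarrow> j < N \<Longrightarrow> i \<noteq> j \<Longrightarrow> s \<in> K i \<Longrightarrow> t \<in> K j \<Longrightarrow> \<delta> \<le> \<bar>s - t\<bar>" for i j x s t
    using cells unfolding cell_approx_def by blast+
  obtain y where y: "atoms_fit (mm_meas W) b y" "atoms_exact (mm_meas W) b y"
    using atoms_exact_fit[OF b W.prob_space_axioms w] by blast
  obtain \<phi> k where \<phi>: "parametrization \<phi> W" "\<phi> \<in> measurable I01 W.borelM"
    and k: "k \<in> borel_measurable W.borelM" "\<And>i s. s \<in> stepint b i \<Longrightarrow> k (\<phi> s) = psum b i"
      "AE s in I01. suminf b \<le> s \<longrightarrow> k (\<phi> s) = s"
    using W.nice_param[OF W.prob_space_axioms W.sets_meas b y(1)] y(2) W.parametrization_iff by blast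
  have \<phi>M: "\<phi> s \<in> mm_pts W" if "s \<in> {0..<1}" for s using measurable_space[OF \<phi>(2), of s] that by simp
  have \<psi>M: "\<psi> s \<in> mm_pts X" if "s \<in> {0..<1}" for s
    using \<psi> measurable_space[of \<psi> I01 "mm_meas X" s] that by (simp add: parametrization_def)
  \<comment> \<open>The cell assigned to atom i of W: for the first N1 indices the cell of the
    matching atom of X, for the others the one cell whose K j the interval can meet.\<close>
  define sel where "sel i = (if i < N1 then J (x i) else SOME j. j < N \<and> stepint b i \<inter> K j \<noteq> {})" for i
  \<comment> \<open>Values of k that belong to cell j: left ends of the atom intervals assigned to
    j, and diffuse parameters that \<psi> sends into cell j. Pulling R j back along k gives the
    subset E j of W.\<close>
  define R where "R j = psum b ` {i. 0 < b i \<and> sel i = j} \<union> {s\<in>{suminf b..<1}. J (\<psi> s) = j}" for j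
  have Rs: "R j \<in> sets borel" for j
  proof -
    have "{s\<in>{0..<1}. \<psi> s \<in> {x\<in>mm_pts X. J x = j}} \<in> sets borel"
      using parametrization_measure(1)[OF \<psi> J[of j]] by (simp add: sets_I01)
    moreover have "{s\<in>{suminf b..<1}. J (\<psi> s) = j} = {s\<in>{0..<1}. \<psi> s \<in> {x\<in>mm_pts X. J x = j}} \<inter> {suminf b..<1}"
      using \<psi>M psum_le[OF b, of 0] by auto
    moreover have "psum b ` {i. 0 < b i \<and> sel i = j} \<in> sets borel"
      by (rule sets.countable) auto
    ultimately show ?thesis unfolding R_def by simp
  qed
  have psumin: "psum b i \<in> stepint b i" if "0 < b i" for i
    using that by (simp add: stepint_def psum_Suc)
  \<comment> \<open>Left ends of nonempty atom intervals determine their index and lie below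
    \<open>suminf b\<close>, so the two kinds of parameters cannot collide.\<close>
  have Rdisj: "R i \<inter> R j = {}" if "i \<noteq> j" for i j
  proof -
    have inj: "i' = j'" if "psum b i' = psum b j'" "0 < b i'" "0 < b j'" for i' j'
      using stepidx_eq[OF b psumin[OF that(2)]] stepidx_eq[OF b psumin[OF that(3)]]
      unfolding that(1) by (rule trans[OF sym])
    have lt: "psum b i' < suminf b" if "0 < b i'" for i'
      using psumin[OF that] unfolding stepint_iff[OF b] by simp
    have cases: "(\<exists>m. 0 < b m \<and> sel m = l \<and> r = psum b m) \<or> (suminf b \<le> r \<and> J (\<psi> r) = l)" if "r \<in> R l" for r l
      using that by (auto simp: R_def)
    show ?thesis
    proof (rule equals0I)
      fix r assume "r \<in> R i \<inter> R j"
      then have "r \<in> R i" "r \<in> R j" by simp_all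
      from cases[OF this(1)] cases[OF this(2)] show False
        using inj lt \<open>i \<noteq> j\<close> by (metis not_less)
    qed
  qed
  define E where "E j = {u\<in>mm_pts W. k u \<in> R j}" for j
  have Es: "E j \<in> sets W.borelM" for j
    using measurable_sets[OF k(1) Rs, of j] by (simp add: E_def vimage_def Int_def conj_commute)
  have Edisj: "E i \<inter> E j = {}" if "i \<noteq> j" for i j using Rdisj[OF that] by (auto simp: E_def)
  define D where "D i j = mm_dist X (p i) (p j)" for i j
  have "D i i = 0" for i by (simp add: D_def p)
  moreover have "D i j = D j i" for i j by (simp add: D_def X.commute)
  moreover have "D i l \<le> D i j + D j l" for i j l unfolding D_def by (rule X.triangle) (rule p)+
  ultimately obtain \<rho> L G where L: "0 < L" and \<rho>: "mm_space (mm_pts W, \<rho>, mm_meas W)"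
    "\<forall>x\<in>mm_pts W. \<forall>y\<in>mm_pts W. \<rho> x y \<le> L * mm_dist W x y"
    and G: "G \<in> W.events" "W.prob (mm_pts W - G) \<le> \<epsilon>"
    and \<rho>D: "\<And>i j x y. i < N \<Longrightarrow> j < N \<Longrightarrow> x \<in> G \<inter> E i \<Longrightarrow> y \<in> G \<inter> E j \<Longrightarrow> \<bar>\<rho> x y - D i j\<bar> \<le> \<epsilon>"
    using W.finite_remetric[of N E D \<epsilon>] Es Edisj \<epsilon> by (metis (no_types, lifting))
  obtain B where B: "B \<in> sets I01" "emeasure I01 B = 0" "{s\<in>{0..<1}. \<not> (suminf b \<le> s \<longrightarrow> k (\<phi> s) = s)} \<subseteq> B"
    using k(3) by (rule AE_E) auto
  define KK where "KK = (\<Union>j<N. K j)"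
  \<comment> \<open>Parameters in an interval of W with index below N1 that the interval of X with
    the same index misses.\<close>
  define V where "V = (\<Union>i<N1. stepint b i - stepint a i)"
  define H where "H = {s\<in>{0..<1}. \<phi> s \<in> mm_pts W - G}"
  have KKs: "KK \<in> sets I01" using K(1) by (auto simp: KK_def)
  have Vs: "V \<in> sets I01" using stepint_sets[OF a] stepint_sets[OF b] by (auto simp: V_def)
  have WG: "mm_pts W - G \<in> W.events" using G(1) sets.compl_sets[OF G(1)] by simp
  have Hs: "H \<in> sets I01" unfolding H_def by (rule parametrization_measure(1)[OF \<phi>(1) WG])
  define I0 where "I0 = KK - (V \<union> B \<union> H)"
  have I0s: "I0 \<in> sets I01" unfolding I0_def using KKs Vs B(1) Hs by blast
  have I0: "\<exists>j<N. J (\<psi> s) = j \<and> \<phi> s \<in> G \<inter> E j \<and> s \<in> {0..<1}" if s: "s \<in> I0" for s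
  proof -
    obtain j where j: "j < N" "s \<in> K j" using s by (auto simp: I0_def KK_def)
    have s01: "s \<in> {0..<1}" using j K(1)[of j] by (auto simp: sets_I01)
    have Jj: "J (\<psi> s) = j" by (rule K(2)[OF j(2)])
    have "k (\<phi> s) \<in> R j"
    proof (cases "suminf b \<le> s")
      case True
      have "s \<notin> B" using s by (simp add: I0_def)
      then have "k (\<phi> s) = s" using B(3) True s01 by blast
      then show ?thesis using True s01 Jj by (simp add: R_def)
    next
      case False
      define i where "i = stepidx b s"
      have si: "s \<in> stepint b i" unfolding i_def using False s01 by (intro stepint_cover[OF b]) auto
      then have bi: "0 < b i" by (simp add: stepint_def psum_Suc)
      have "sel i = j"
      proof (cases "i < N1")
        case True
        have "s \<in> stepint a i" using s si True by (auto simp: I0_def V_def)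
        then have "\<psi> s = x i" by (rule \<psi>x)
        then show ?thesis using Jj True by (simp add: sel_def)
      next
        case False
        have "j < N \<and> stepint b i \<inter> K j \<noteq> {}" using j si by blast
        moreover have "j' = j" if "j' < N \<and> stepint b i \<inter> K j' \<noteq> {}" for j'
        proof (rule ccontr)
          assume ne: "j' \<noteq> j"
          obtain t where t: "t \<in> stepint b i" "t \<in> K j'" using \<open>j' < N \<and> _\<close> by blast
          have "\<delta> \<le> \<bar>t - s\<bar>" using K(4)[OF _ j(1) ne t(2) j(2)] \<open>j' < N \<and> _\<close> by blast
          moreover have "\<bar>t - s\<bar> < b i" using t(1) si by (auto simp: stepint_def psum_Suc)
          ultimately show False using N1[of i] False by simp
        qed
        ultimately have "(SOME j. j < N \<and> stepint b i \<inter> K j \<noteq> {}) = j" by (rule some_equality)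
        then show ?thesis using False by (simp add: sel_def)
      qed
      then show ?thesis using k(2)[OF si] bi by (auto simp: R_def)
    qed
    moreover have "\<phi> s \<in> G" using s s01 \<phi>M[OF s01] by (simp add: I0_def H_def)
    ultimately show ?thesis using j(1) Jj \<phi>M[OF s01] s01 by (simp add: E_def)
  qed
  have "measure I01 KK \<le> measure I01 (I0 \<union> (V \<union> B \<union> H))"
    using I0s Vs B(1) Hs KKs by (intro I01.finite_measure_mono) (auto simp: I0_def)
  also have "\<dots> \<le> measure I01 I0 + measure I01 (V \<union> B \<union> H)"
    using I0s Vs B(1) Hs by (intro measure_Un_le) auto
  also have "measure I01 (V \<union> B \<union> H) \<le> measure I01 (V \<union> B) + measure I01 H"
    using Vs B(1) Hs by (intro measure_Un_le) auto
  also have "measure I01 (V \<union> B) \<le> measure I01 V + measure I01 B"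
    using Vs B(1) by (intro measure_Un_le) auto
  also have "measure I01 B = 0" using B(2) by (simp add: measure_def)
  also have "measure I01 H \<le> \<epsilon>"
    unfolding H_def parametrization_measure(2)[OF \<phi>(1) WG, symmetric] by (rule G(2))
  also have "measure I01 V \<le> (\<Sum>i<N1. measure I01 (stepint b i - stepint a i))"
    unfolding V_def using stepint_sets[OF a] stepint_sets[OF b] by (intro measure_UNION_le) auto
  also note bad
  \<comment> \<open>Losing \<epsilon> each for KK, V and H leaves 1 - 3 * \<epsilon>. The distances
    also cost 3 * \<epsilon>, two for the cell centres and one for \<rho>, so 4 * \<epsilon> covers
    both.\<close>
  finally have I0m: "1 - 4 * \<epsilon> \<le> measure I01 I0" using K(3) \<epsilon> by (simp add: KK_def)
  have "box_rel (4 * \<epsilon>) X (mm_pts W, \<rho>, mm_meas W)"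
    unfolding box_rel_def
  proof (rule conjI[OF _ exI[of _ \<psi>, OF exI[of _ \<phi>, OF exI[of _ I0]]]], goal_cases)
    case 2
    show ?case
    proof (intro conjI ballI)
      show "parametrization \<phi> (mm_pts W, \<rho>, mm_meas W)"
        using \<phi>(1) by (simp add: parametrization_def mm_meas_def)
      fix s t assume st: "s \<in> I0" "t \<in> I0"
      obtain i where i: "i < N" "J (\<psi> s) = i" "\<phi> s \<in> G \<inter> E i" "s \<in> {0..<1}" using I0[OF st(1)] by blast
      obtain j where j: "j < N" "J (\<psi> t) = j" "\<phi> t \<in> G \<inter> E j" "t \<in> {0..<1}" using I0[OF st(2)] by blast
      have n1: "mm_dist X (p i) (\<psi> s) < \<epsilon>" using near[OF \<psi>M[OF i(4)]] i(2) by simp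
      have n2: "mm_dist X (p j) (\<psi> t) < \<epsilon>" using near[OF \<psi>M[OF j(4)]] j(2) by simp
      have "\<bar>mm_dist X (\<psi> s) (\<psi> t) - D i j\<bar> \<le> mm_dist X (p i) (\<psi> s) + mm_dist X (p j) (\<psi> t)"
      proof -
        note M = \<psi>M[OF i(4)] \<psi>M[OF j(4)] p[of i] p[of j]
        have "mm_dist X (\<psi> s) (\<psi> t) \<le> mm_dist X (\<psi> s) (p i) + mm_dist X (p i) (\<psi> t)"
          "mm_dist X (p i) (\<psi> t) \<le> D i j + mm_dist X (p j) (\<psi> t)"
          "D i j \<le> mm_dist X (p i) (\<psi> s) + mm_dist X (\<psi> s) (p j)"
          "mm_dist X (\<psi> s) (p j) \<le> mm_dist X (\<psi> s) (\<psi> t) + mm_dist X (\<psi> t) (p j)"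
          unfolding D_def by (auto intro!: X.triangle M)
        then show ?thesis
          using X.commute[of "\<psi> s" "p i"] X.commute[of "\<psi> t" "p j"] by linarith
      qed
      moreover have "\<bar>\<rho> (\<phi> s) (\<phi> t) - D i j\<bar> \<le> \<epsilon>" by (rule \<rho>D[OF i(1) j(1) i(3) j(3)])
      ultimately show "\<bar>mm_dist X (\<psi> s) (\<psi> t) - mm_dist (mm_pts W, \<rho>, mm_meas W) (\<phi> s) (\<phi> t)\<bar> \<le> 4 * \<epsilon>"
        using n1 n2 \<epsilon> by (simp add: mm_dist_def)
    qed (use \<psi> I0s I0m in auto)
  qed (use \<epsilon> in simp)
  then show ?thesis using L \<rho> by blast
qed

text \<open>The excess of one interval over the other lies in two pieces, one at each end, no longer
  than the shifts of the end points.\<close>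

lemma measure_stepint_diff:
  assumes a: "a \<in> A_seq" and b: "b \<in> A_seq"
  shows "measure I01 (stepint b i - stepint a i) \<le> \<bar>psum b i - psum a i\<bar> + \<bar>psum b (Suc i) - psum a (Suc i)\<bar>"
proof -
  define P where "P = {psum b i..<psum a i}"
  define Q where "Q = {psum a (Suc i)..<psum b (Suc i)}"
  have Ps: "P \<in> sets I01" "Q \<in> sets I01"
    using psum_nonneg[OF b, of i] psum_le_1[OF a, of i] psum_nonneg[OF a, of "Suc i"] psum_le_1[OF b, of "Suc i"]
    by (auto simp: sets_I01 P_def Q_def)
  have "measure I01 (stepint b i - stepint a i) \<le> measure I01 (P \<union> Q)"
    using Ps by (intro I01.finite_measure_mono) (auto simp: stepint_def P_def Q_def)
  also have "\<dots> \<le> measure I01 P + measure I01 Q" using Ps by (rule measure_Un_le)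
  also have "\<dots> \<le> \<bar>psum b i - psum a i\<bar> + \<bar>psum b (Suc i) - psum a (Suc i)\<bar>"
  proof (rule add_mono)
    show "measure I01 P \<le> \<bar>psum b i - psum a i\<bar>"
      unfolding measure_I01[OF Ps(1)] unfolding P_def by (cases "psum b i \<le> psum a i") auto
    show "measure I01 Q \<le> \<bar>psum b (Suc i) - psum a (Suc i)\<bar>"
      unfolding measure_I01[OF Ps(2)] unfolding Q_def by (cases "psum a (Suc i) \<le> psum b (Suc i)") auto
  qed
  finally show ?thesis .
qed

text \<open>X fixes the cells and the gap \<delta>, and the uniform bound 1/(i+1) then fixes N1
  before n is chosen; only the first N1 intervals must converge. The spaces W n are free, so the
  lemma serves both convergent sequences of atom sequences and, with constant sequences, a single
  space.\<close>

lemma box_approx: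
  assumes a: "a \<in> A_seq" and b: "\<And>n. b n \<in> A_seq" and lim: "\<And>i. (\<lambda>n. b n i) \<longlonglongrightarrow> a i"
    and X: "X \<in> pyr_of a" and W: "\<And>n. mm_space (W n)" and w: "\<And>n. atoms_exact (mm_meas (W n)) (b n) (w n)"
    and \<epsilon>: "\<epsilon> > 0"
  shows "\<forall>\<^sub>F n in sequentially. \<exists>\<rho> L. 0 < L \<and> mm_space (mm_pts (W n), \<rho>, mm_meas (W n)) \<and>
    (\<forall>x\<in>mm_pts (W n). \<forall>y\<in>mm_pts (W n). \<rho> x y \<le> L * mm_dist (W n) x y) \<and>
    box_rel \<epsilon> X (mm_pts (W n), \<rho>, mm_meas (W n))"
proof -
  interpret X: mm X by standard (rule pyr_of_mm[OF X])
  obtain \<psi> x where \<psi>: "\<psi> \<in> measurable I01 X.borelM" "parametrization \<psi> X" "\<And>i s. s \<in> stepint a i \<Longrightarrow> \<psi> s = x i"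
    using pyr_of_param[OF a X] by blast
  define \<epsilon>' where "\<epsilon>' = \<epsilon> / 4"
  have \<epsilon>': "\<epsilon>' > 0" "4 * \<epsilon>' = \<epsilon>" using \<epsilon> by (auto simp: \<epsilon>'_def)
  obtain N p J \<delta> K where cells: "cell_approx X \<psi> \<epsilon>' N p J \<delta> K"
    using X.cell_approx_exists[OF \<psi>(1) \<epsilon>'(1)] by blast
  then have \<delta>: "0 < \<delta>" by (simp add: cell_approx_def)
  obtain N1 where N1: "1 / real (Suc N1) < \<delta>" using nat_approx_posE[OF \<delta>] by blast
  have small: "b n i < \<delta>" if "N1 \<le> i" for n i
  proof -
    have "b n i \<le> 1 / real (Suc i)" by (rule A_seq_le_inverse[OF b])
    also have "\<dots> \<le> 1 / real (Suc N1)" using that by (intro frac_le) auto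
    finally show ?thesis using N1 by simp
  qed
  have ps: "(\<lambda>n. psum (b n) i) \<longlonglongrightarrow> psum a i" for i
    unfolding psum_def using lim by (intro tendsto_sum)
  have "(\<lambda>n. \<Sum>i<N1. \<bar>psum (b n) i - psum a i\<bar> + \<bar>psum (b n) (Suc i) - psum a (Suc i)\<bar>)
      \<longlonglongrightarrow> (\<Sum>i<N1. \<bar>psum a i - psum a i\<bar> + \<bar>psum a (Suc i) - psum a (Suc i)\<bar>)"
    by (intro tendsto_intros ps)
  then have "\<forall>\<^sub>F n in sequentially. (\<Sum>i<N1. \<bar>psum (b n) i - psum a i\<bar> + \<bar>psum (b n) (Suc i) - psum a (Suc i)\<bar>) < \<epsilon>'"
    using \<epsilon>' by (intro order_tendstoD(2)) auto
  then show ?thesis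
  proof eventually_elim
    case (elim n)
    have "(\<Sum>i<N1. measure I01 (stepint (b n) i - stepint a i)) \<le>
        (\<Sum>i<N1. \<bar>psum (b n) i - psum a i\<bar> + \<bar>psum (b n) (Suc i) - psum a (Suc i)\<bar>)"
      by (intro sum_mono measure_stepint_diff a b)
    then have bad: "(\<Sum>i<N1. measure I01 (stepint (b n) i - stepint a i)) \<le> \<epsilon>'" using elim by simp
    show ?case
      unfolding \<epsilon>'(2)[symmetric]
      by (rule box_approx_core[OF X.mm_space \<psi>(2) a \<psi>(3) cells \<epsilon>'(1) b W w small bad])
  qed
qed

section \<open>Classification of the fixed pyramids\<close>

text \<open>The largest index in a set of n + 1 indices is at least n, so its entry is at most a n;
  remove it and induct.\<close>

lemma A_seq_sum_le_psum:
  assumes a: "a \<in> A_seq" and I: "finite I"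
  shows "sum a I \<le> psum a (card I)"
  using I
proof (induction "card I" arbitrary: I)
  case 0
  then show ?case by simp
next
  case (Suc n)
  then have "I \<noteq> {}" by auto
  define m where "m = Max I"
  have m: "m \<in> I" unfolding m_def using Suc \<open>I \<noteq> {}\<close> by simp
  have "I \<subseteq> {..m}" unfolding m_def using Suc.prems by auto
  then have "Suc n \<le> Suc m" using card_mono[of "{..m}" I] Suc.hyps(2) by simp
  then have "a m \<le> a n" by (intro A_seq_antimono[OF a]) simp
  moreover have "n = card (I - {m})" using Suc m by simp
  then have "sum a (I - {m}) \<le> psum a n" using Suc.hyps(1)[of "I - {m}"] Suc.prems by simp
  moreover have "sum a I = a m + sum a (I - {m})" using m Suc.prems by (simp add: sum.remove)
  ultimately show ?case unfolding Suc.hyps(2)[symmetric] psum_Suc by simp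
qed

lemma A_seq_I:
  assumes "\<And>i. 0 \<le> a i" "decseq a" "\<And>n. psum a n \<le> 1"
  shows "a \<in> A_seq"
proof -
  have "summable a"
    by (rule summableI_nonneg_bounded[of _ 1]) (use assms in \<open>auto simp: psum_def\<close>)
  moreover have "suminf a \<le> 1"
    by (rule suminf_le_const[OF \<open>summable a\<close>]) (use assms(3) in \<open>simp add: psum_def\<close>)
  ultimately show ?thesis using assms by (simp add: A_seq_def)
qed

text \<open>Mass may escape to infinity in a coordinatewise limit, but the bound by 1 passes through
  the finite partial sums. This is what makes A closed.\<close>

lemma A_seq_limit:
  assumes b: "\<And>n. b n \<in> A_seq" and lim: "\<And>i. (\<lambda>n. b n i) \<longlonglongrightarrow> a i"
  shows "a \<in> A_seq"
proof (rule A_seq_I)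
  show "0 \<le> a i" for i
    by (rule LIMSEQ_le_const[OF lim]) (use A_seq_nonneg[OF b] in blast)
  show "decseq a" unfolding decseq_def
    using A_seq_antimono[OF b] by (intro allI impI LIMSEQ_le[OF lim lim]) blast
  have "(\<lambda>n. psum (b n) k) \<longlonglongrightarrow> psum a k" for k unfolding psum_def using lim by (intro tendsto_sum)
  then show "psum a k \<le> 1" for k
    by (rule LIMSEQ_le_const2) (use psum_le_1[OF b] in blast)
qed

lemma psum_inject: "(\<And>k. psum a k = psum b k) \<Longrightarrow> a = b"
  using psum_Suc by (metis add_diff_cancel_left' ext)

text \<open>The atoms are listed greedily; choosing the candidates among all reals (points outside
  the space having measure 0) lets the selection go on forever.\<close>

lemma (in mm) exact_atoms_exist: "\<exists>a w. a \<in> A_seq \<and> atoms_exact (mm_meas X) a w"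
proof -
  define m where "m x = prob {x}" for x
  have m0: "0 \<le> m x" for x by (simp add: m_def)
  have mout: "m x = 0" if "x \<notin> mm_pts X" for x
  proof -
    have "{x} \<notin> events" using sets.sets_into_space[of "{x}" "mm_meas X"] that by auto
    then show ?thesis by (simp add: m_def measure_notin_sets)
  qed
  have msum: "sum m F \<le> 1" if "finite F" for F
  proof -
    have "sum m F = sum m (F \<inter> mm_pts X)"
      using that mout by (intro sum.mono_neutral_right) auto
    also have "\<dots> = prob (F \<inter> mm_pts X)"
      unfolding m_def using that sets_meas by (intro finite_measure_eq_sum_singleton[symmetric]) auto
    also have "\<dots> \<le> 1" by (rule prob_le_1)
    finally show ?thesis .
  qed
  \<comment> \<open>A heaviest point outside S exists because at most 1 / m y0 points have mass at
    least m y0.\<close>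
  have pick_ex: "\<exists>x. x \<notin> S \<and> (\<forall>y. y \<notin> S \<longrightarrow> m y \<le> m x)" if S: "finite S" for S
  proof (cases "\<exists>y. y \<notin> S \<and> 0 < m y")
    case False
    obtain x where "x \<notin> S" using ex_new_if_finite[OF infinite_UNIV_char_0 S] by blast
    then show ?thesis using False m0 by (metis order_trans not_less)
  next
    case True
    then obtain y0 where y0: "y0 \<notin> S" "0 < m y0" by blast
    define T where "T = {y. y \<notin> S \<and> m y0 \<le> m y}"
    have "finite T \<and> card T \<le> nat \<lceil>1 / m y0\<rceil>"
    proof (rule finite_if_finite_subsets_card_bdd)
      fix G assume G: "G \<subseteq> T" "finite G"
      have "real (card G) * m y0 = (\<Sum>y\<in>G. m y0)" by simp
      also have "\<dots> \<le> sum m G" using G by (intro sum_mono) (auto simp: T_def)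
      also have "\<dots> \<le> 1" by (rule msum[OF G(2)])
      finally have "real (card G) \<le> 1 / m y0" using y0 by (simp add: field_simps)
      then show "card G \<le> nat \<lceil>1 / m y0\<rceil>" by linarith
    qed
    then have T: "finite T" "y0 \<in> T" using y0 by (auto simp: T_def)
    obtain x where x: "x \<in> T" "m x = Max (m ` T)"
      using T Max_in[of "m ` T"] by fastforce
    have "m y \<le> m x" if "y \<notin> S" for y
    proof (cases "y \<in> T")
      case True
      then show ?thesis using x T by simp
    next
      case False
      then have "m y \<le> m y0" using that by (simp add: T_def)
      also have "\<dots> \<le> m x" using x(1) by (simp add: T_def)
      finally show ?thesis .
    qed
    then show ?thesis using x(1) by (auto simp: T_def)
  qed
  define pick where "pick S = (SOME x. x \<notin> S \<and> (\<forall>y. y \<notin> S \<longrightarrow> m y \<le> m x))" for S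
  define U where "U n = ((\<lambda>S. insert (pick S) S) ^^ n) {}" for n
  define w where "w n = pick (U n)" for n
  define a where "a n = m (w n)" for n
  have U0: "U 0 = {}" and US: "U (Suc n) = insert (w n) (U n)" for n
    by (simp_all add: U_def w_def)
  have Ufin: "finite (U n)" for n by (induction n) (simp_all add: U0 US)
  have w: "w n \<notin> U n" "\<And>y. y \<notin> U n \<Longrightarrow> m y \<le> m (w n)" for n
    using someI_ex[OF pick_ex[OF Ufin, of n]] unfolding w_def pick_def by blast+
  have Ueq: "U n = w ` {..<n}" for n
    by (induction n) (simp_all add: U0 US lessThan_Suc)
  have inj: "inj w"
  proof (rule linorder_injI)
    fix i j :: nat assume "i < j"
    then have "w i \<in> U j" by (simp add: Ueq)
    then show "w i \<noteq> w j" using w(1)[of j] by auto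
  qed
  have psum: "psum a n = sum m (U n)" for n
    unfolding psum_def Ueq a_def using inj by (subst sum.reindex) (auto intro: inj_on_subset)
  have a: "a \<in> A_seq"
  proof (rule A_seq_I)
    show "0 \<le> a i" for i by (simp add: a_def m0)
    show "decseq a"
    proof (rule decseq_SucI)
      fix n
      have "w (Suc n) \<notin> U n" using w(1)[of "Suc n"] by (simp add: US)
      then show "a (Suc n) \<le> a n" unfolding a_def by (rule w(2))
    qed
    show "psum a n \<le> 1" for n unfolding psum by (rule msum[OF Ufin])
  qed
  \<comment> \<open>An atom that is never picked would be at most as heavy as every picked one, but
    the picked masses are summable and tend to 0.\<close>
  have allw: "p \<in> range w" if p: "0 < m p" for p
  proof (rule ccontr)
    assume "p \<notin> range w"
    then have "p \<notin> U n" for n by (auto simp: Ueq)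
    then have "m p \<le> a n" for n unfolding a_def by (rule w(2))
    moreover have "a \<longlonglongrightarrow> 0" using A_seq_summable[OF a] by (rule summable_LIMSEQ_zero)
    ultimately have "m p \<le> 0" by (intro LIMSEQ_le_const) auto
    then show False using p by simp
  qed
  have "atoms_exact (mm_meas X) a w"
    unfolding atoms_exact_def
  proof (intro conjI allI impI ballI)
    show "inj_on w {i. 0 < a i}" using inj by (rule inj_on_subset) simp
    show "w i \<in> space (mm_meas X)" if "0 < a i" for i using that mout[of "w i"] by (force simp: a_def)
    show "prob {w i} = a i" for i by (simp add: a_def m_def)
    fix p assume p: "p \<in> space (mm_meas X) - w ` {i. 0 < a i}"
    show "prob {p} = 0"
    proof (rule ccontr)
      assume "prob {p} \<noteq> 0"
      then have mp: "0 < m p" using m0[of p] unfolding m_def by linarith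
      then obtain i where i: "p = w i" using allw by blast
      then show False using p mp by (auto simp: a_def)
    qed
  qed
  then show ?thesis using a by blast
qed

text \<open>A finite set contains at most as many atoms as it has points, and the heaviest atoms
  come first in the list.\<close>

lemma atoms_exact_prob_le:
  assumes X: "mm_space X" and a: "a \<in> A_seq" and w: "atoms_exact (mm_meas X) a w"
    and F: "finite F" "F \<subseteq> mm_pts X"
  shows "measure (mm_meas X) F \<le> psum a (card F)"
proof -
  interpret mm X by standard fact
  define I where "I = {i. 0 < a i \<and> w i \<in> F}"
  have inj: "inj_on w I" using w by (auto simp: atoms_exact_def I_def inj_on_def)
  have wI: "w ` I \<subseteq> F" by (auto simp: I_def)
  have Ifin: "finite I" using inj wI F(1) by (meson finite_imageD finite_subset)
  have "prob F = (\<Sum>p\<in>F. prob {p})"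
    using F sets_meas by (intro finite_measure_eq_sum_singleton) auto
  also have "\<dots> = (\<Sum>p\<in>w ` I. prob {p})"
    using F wI w by (intro sum.mono_neutral_right) (auto simp: atoms_exact_def I_def)
  also have "\<dots> = sum a I"
    using w inj by (subst sum.reindex) (auto simp: atoms_exact_def I_def intro: sum.cong)
  also have "\<dots> \<le> psum a (card I)" by (rule A_seq_sum_le_psum[OF a Ifin])
  also have "\<dots> \<le> psum a (card F)"
    using card_mono[OF F(1) wI] card_image[OF inj] by (intro psum_mono[OF a]) simp
  finally show ?thesis .
qed

text \<open>The points carrying the first k entries of b number at most k and have mass at least
  \<open>psum b k\<close>, while \<open>psum a k\<close> bounds the mass of any k points of
  X.\<close>

lemma exact_psum_le:
  assumes X: "mm_space X" and a: "a \<in> A_seq" and w: "atoms_exact (mm_meas X) a w"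
    and b: "X \<in> pyr_of b"
  shows "psum b k \<le> psum a k"
proof -
  interpret mm X by standard fact
  obtain x where x: "atoms_fit (mm_meas X) b x" using b by (auto simp: pyr_of_def)
  have xM: "x i \<in> mm_pts X" for i using x by (simp add: atoms_fit_def)
  have F: "finite (x ` {..<k})" "x ` {..<k} \<subseteq> mm_pts X" using xM by auto
  have "psum b k \<le> prob (x ` {..<k})"
    unfolding psum_def using F countable_sets[of "x ` {..<k}"]
    by (intro sum_atoms_le[OF prob_space_axioms sets_meas x]) (auto simp: sets_meas countable_finite)
  also have "\<dots> \<le> psum a (card (x ` {..<k}))" by (rule atoms_exact_prob_le[OF X a w F])
  also have "\<dots> \<le> psum a k" using card_image_le[of "{..<k}" x] by (intro psum_mono[OF a]) simp
  finally show ?thesis .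
qed

lemma exact_in_pyr_of:
  assumes "mm_space X" "a \<in> A_seq" "atoms_exact (mm_meas X) a w" shows "X \<in> pyr_of a"
proof -
  interpret mm X by standard fact
  show ?thesis
    using atoms_exact_fit[OF assms(2) prob_space_axioms assms(3)] assms(1) unfolding pyr_of_def mmX_def by blast
qed

text \<open>Test the inclusion on a space whose atoms are exactly a. Applied in both directions this
  recovers a from its pyramid.\<close>

lemma pyr_of_psum_le:
  assumes a: "a \<in> A_seq" and sub: "pyr_of a \<subseteq> pyr_of b"
  shows "psum b k \<le> psum a k"
proof -
  obtain W w where W: "mm_space W" "atoms_exact (mm_meas W) a w" using exact_space_exists[OF a] by blast
  then have "W \<in> pyr_of b" using exact_in_pyr_of a sub by blast
  then show ?thesis by (rule exact_psum_le[OF W(1) a W(2)])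
qed

lemma inj_on_pyr_of: "inj_on pyr_of A_seq"
proof (rule inj_onI)
  fix a b assume "a \<in> A_seq" "b \<in> A_seq" "pyr_of a = pyr_of b"
  then show "a = b"
    using pyr_of_psum_le[of a b] pyr_of_psum_le[of b a] by (intro psum_inject antisym) auto
qed

section \<open>Box distance to a pyramid and weak convergence\<close>

lemma box_set_le:
  assumes "mm_space X" "P \<subseteq> mmX" "Y \<in> P" shows "box_set X P \<le> box X Y"
  unfolding box_set_def
proof (rule cINF_lower)
  show "bdd_below (box X ` P)"
    by (rule bdd_belowI2[of _ 0]) (use assms box_nonneg in \<open>unfold mmX_def, blast\<close>)
qed (rule assms)

lemma box_set_nonneg:
  assumes "mm_space X" "P \<subseteq> mmX" "P \<noteq> {}" shows "0 \<le> box_set X P"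
  unfolding box_set_def
  by (rule cINF_greatest[OF assms(3)]) (use assms(1,2) box_nonneg in \<open>unfold mmX_def, blast\<close>)

lemma box_set_lessD:
  assumes "P \<noteq> {}" "box_set X P < e" shows "\<exists>Y\<in>P. box X Y < e"
  using assms cInf_lessD[of "box X ` P" e] unfolding box_set_def by auto

lemma pyr_of_subset: "pyr_of a \<subseteq> mmX" by (auto simp: pyr_of_def)

lemma pyr_of_nonempty: "a \<in> A_seq \<Longrightarrow> pyr_of a \<noteq> {}"
  using pyramid_pyr_of by (simp add: pyramid_def)

text \<open>Model spaces with atoms exactly b n remain in \<open>pyr_of (b n)\<close> under any
  admissible change of metric, and such a change brings them close to X.\<close>

lemma box_set_pyr_of_tendsto:
  assumes a: "a \<in> A_seq" and b: "\<And>n. b n \<in> A_seq" and lim: "\<And>i. (\<lambda>n. b n i) \<longlonglongrightarrow> a i"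
    and X: "X \<in> pyr_of a"
  shows "(\<lambda>n. box_set X (pyr_of (b n))) \<longlonglongrightarrow> 0"
proof (rule order_tendstoI)
  have Xmm: "mm_space X" by (rule pyr_of_mm[OF X])
  fix c :: real assume c: "c < 0"
  then show "\<forall>\<^sub>F n in sequentially. c < box_set X (pyr_of (b n))"
    using box_set_nonneg[OF Xmm pyr_of_subset pyr_of_nonempty[OF b]]
    by (intro always_eventually allI) (rule less_le_trans)
next
  have Xmm: "mm_space X" by (rule pyr_of_mm[OF X])
  fix c :: real assume c: "0 < c"
  have "\<forall>n. \<exists>W w. mm_space W \<and> atoms_exact (mm_meas W) (b n) w" using exact_space_exists[OF b] by blast
  then obtain W w where W: "\<And>n. mm_space (W n)" and w: "\<And>n. atoms_exact (mm_meas (W n)) (b n) (w n)"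
    by metis
  have "0 < c / 2" using c by simp
  from box_approx[OF a b lim X W w this]
  show "\<forall>\<^sub>F n in sequentially. box_set X (pyr_of (b n)) < c"
  proof eventually_elim
    case (elim n)
    then obtain \<rho> where \<rho>: "mm_space (mm_pts (W n), \<rho>, mm_meas (W n))"
      "box_rel (c / 2) X (mm_pts (W n), \<rho>, mm_meas (W n))" by blast
    have "(mm_pts (W n), \<rho>, mm_meas (W n)) \<in> pyr_of (b n)"
      by (rule exact_in_pyr_of[OF \<rho>(1) b, of _ "w n"]) (use w[of n] in \<open>simp add: mm_meas_def\<close>)
    then have "box_set X (pyr_of (b n)) \<le> box X (mm_pts (W n), \<rho>, mm_meas (W n))"
      by (rule box_set_le[OF Xmm pyr_of_subset])
    also have "\<dots> \<le> c / 2" by (rule box_le[OF \<rho>(2)])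
    finally show ?case using c by simp
  qed
qed

text \<open>A space outside \<open>pyr_of a\<close> with liminf 0 would be a box limit of members of
  \<open>pyr_of (b n)\<close> along indices tending to infinity, which \<open>pyr_of_limit\<close>
  excludes.\<close>

lemma weak_conv_pyr_of:
  assumes a: "a \<in> A_seq" and b: "\<And>n. b n \<in> A_seq" and lim: "\<And>i. (\<lambda>n. b n i) \<longlonglongrightarrow> a i"
  shows "weak_conv (\<lambda>n. pyr_of (b n)) (pyr_of a)"
  unfolding weak_conv_def
proof (intro conjI ballI)
  fix X assume "X \<in> pyr_of a"
  then show "(\<lambda>n. box_set X (pyr_of (b n))) \<longlonglongrightarrow> 0" by (rule box_set_pyr_of_tendsto[OF a b lim])
next
  fix X assume X: "X \<in> mmX - pyr_of a"
  then have Xmm: "mm_space X" by (simp add: mmX_def)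
  show "0 < liminf (\<lambda>n. ereal (box_set X (pyr_of (b n))))"
  proof (rule ccontr)
    assume neg: "\<not> 0 < liminf (\<lambda>n. ereal (box_set X (pyr_of (b n))))"
    have freq: "\<exists>n\<ge>k. box_set X (pyr_of (b n)) < 1 / real (Suc k)" for k
    proof (rule ccontr)
      assume "\<not> ?thesis"
      then have "\<forall>\<^sub>F n in sequentially. ereal (1 / real (Suc k)) \<le> ereal (box_set X (pyr_of (b n)))"
        unfolding eventually_sequentially by (intro exI[of _ k]) (auto simp: not_less)
      then have "ereal (1 / real (Suc k)) \<le> liminf (\<lambda>n. ereal (box_set X (pyr_of (b n))))"
        by (rule Liminf_bounded)
      moreover have "0 < ereal (1 / real (Suc k))" by simp
      ultimately show False using neg by (meson less_le_trans)
    qed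
    then obtain r where r: "\<And>k. k \<le> r k" "\<And>k. box_set X (pyr_of (b (r k))) < 1 / real (Suc k)" by metis
    have "\<exists>Y\<in>pyr_of (b (r k)). box X Y < 1 / real (Suc k)" for k
      by (rule box_set_lessD[OF pyr_of_nonempty[OF b] r(2)])
    then obtain Y where Y: "\<And>k. Y k \<in> pyr_of (b (r k))" "\<And>k. box X (Y k) < 1 / real (Suc k)" by metis
    \<comment> \<open>The indices r k need not increase; k \<le> r k suffices for coordinatewise
      limits along them.\<close>
    have rlim: "filterlim r sequentially sequentially"
      by (rule filterlim_at_top_mono[OF filterlim_ident]) (simp add: r(1))
    have "X \<in> pyr_of a"
    proof (rule pyr_of_limit[OF a _ _ Xmm Y(1)])
      show "b (r n) \<in> A_seq" for n by (rule b)
      show "(\<lambda>n. b (r n) i) \<longlonglongrightarrow> a i" for i by (rule filterlim_compose[OF lim rlim])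
      show "box_rel (1 / real (Suc n)) X (Y n)" for n
        by (rule box_rel_of_less[OF Xmm pyr_of_mm[OF Y(1)] Y(2)])
      show "(\<lambda>n. 1 / real (Suc n)) \<longlonglongrightarrow> 0" by (rule LIMSEQ_Suc[OF lim_1_over_n])
    qed
    then show False using X by simp
  qed
qed

lemma pyr_of_subset_pyramid:
  assumes P: "pyramid P" and scale: "\<And>t. t > 0 \<Longrightarrow> scale_mm t ` P = P"
    and X: "X \<in> P" and a: "a \<in> A_seq" and w: "atoms_exact (mm_meas X) a w"
  shows "pyr_of a \<subseteq> P"
proof
  fix Y assume Y: "Y \<in> pyr_of a"
  have Xmm: "mm_space X" using P X by (auto simp: pyramid_def mmX_def)
  have "\<exists>Z\<in>P. box Y Z < \<epsilon>" if \<epsilon>: "\<epsilon> > 0" for \<epsilon>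
  proof -
    have "0 < \<epsilon> / 2" using \<epsilon> by simp
    have "\<forall>\<^sub>F n in sequentially. \<exists>\<rho> L. 0 < L \<and> mm_space (mm_pts X, \<rho>, mm_meas X) \<and>
        (\<forall>x\<in>mm_pts X. \<forall>y\<in>mm_pts X. \<rho> x y \<le> L * mm_dist X x y) \<and>
        box_rel (\<epsilon> / 2) Y (mm_pts X, \<rho>, mm_meas X)"
      using box_approx[of a "\<lambda>_::nat. a" Y "\<lambda>_. X" "\<lambda>_. w" "\<epsilon> / 2"] a Y Xmm w \<epsilon> by simp
    then obtain \<rho> L where L: "0 < L" and Z: "mm_space (mm_pts X, \<rho>, mm_meas X)"
      and lip: "\<forall>x\<in>mm_pts X. \<forall>y\<in>mm_pts X. \<rho> x y \<le> L * mm_dist X x y"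
      and box: "box_rel (\<epsilon> / 2) Y (mm_pts X, \<rho>, mm_meas X)"
      by (auto simp: eventually_sequentially)
    have "scale_mm L X \<in> P" using scale[OF L] X by blast
    \<comment> \<open>The identity is 1-Lipschitz from L times the old metric to \<rho>. Here
      invariance under arbitrary factors L is used.\<close>
    moreover have "dominated (mm_pts X, \<rho>, mm_meas X) (scale_mm L X)"
      unfolding dominated_def using lip
      by (intro exI[of _ "\<lambda>x. x"]) (simp add: mm_pts_def mm_dist_def mm_meas_def scale_mm_def distr_id)
    ultimately have "(mm_pts X, \<rho>, mm_meas X) \<in> P"
      using P Z unfolding pyramid_def mmX_def by blast
    moreover have "box Y (mm_pts X, \<rho>, mm_meas X) < \<epsilon>" using box_le[OF box] \<epsilon> by simp
    ultimately show ?thesis by blast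
  qed
  moreover have "Y \<in> mmX" using pyr_of_subset Y by blast
  ultimately show "Y \<in> P" using P unfolding pyramid_def by blast
qed

lemma Fix_Pyr_pyr_of: "a \<in> A_seq \<Longrightarrow> pyr_of a \<in> Fix_Pyr"
  by (simp add: Fix_Pyr_def Pyr_def pyramid_pyr_of scale_pyr_of)

text \<open>Passing to a dominating space decreases the partial sums of the sorted atoms, so by
  directedness all of them can be brought simultaneously close to their infima over P; the
  increments of the infima are the sequence sought.\<close>

lemma Fix_Pyr_is_pyr_of:
  assumes "P \<in> Fix_Pyr" shows "\<exists>a\<in>A_seq. P = pyr_of a"
proof -
  have P: "pyramid P" and scale: "\<And>t. t > 0 \<Longrightarrow> scale_mm t ` P = P"
    using assms by (auto simp: Fix_Pyr_def Pyr_def)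
  have Pmm: "mm_space X" if "X \<in> P" for X using P that by (auto simp: pyramid_def mmX_def)
  define prof where "prof X a \<longleftrightarrow> X \<in> P \<and> a \<in> A_seq \<and> (\<exists>w. atoms_exact (mm_meas X) a w)" for X a
  have prof_ex: "\<exists>a. prof X a" if "X \<in> P" for X
  proof -
    interpret mm X by standard (rule Pmm[OF that])
    show ?thesis using exact_atoms_exist that by (auto simp: prof_def)
  qed
  have prof_in: "X \<in> pyr_of a" if "prof X a" for X a
    using that exact_in_pyr_of Pmm unfolding prof_def by blast
  have prof_le: "psum c k \<le> psum a k" if "prof X a" "X \<in> pyr_of c" for X a c k
    using that exact_psum_le[of X a _ c k] Pmm unfolding prof_def by blast
  have dom: "X \<in> pyr_of c" if "prof Z c" "X \<in> P" "dominated X Z" for X Z c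
    using that pyr_of_dominated[OF _ prof_in Pmm] unfolding prof_def by blast
  have direct: "\<exists>Z c. prof Z c \<and> X \<in> pyr_of c \<and> Y \<in> pyr_of c" if "X \<in> P" "Y \<in> P" for X Y
  proof -
    obtain Z where Z: "Z \<in> P" "dominated X Z" "dominated Y Z" using P \<open>X \<in> P\<close> \<open>Y \<in> P\<close> unfolding pyramid_def by blast
    obtain c where "prof Z c" using prof_ex[OF Z(1)] by blast
    then show ?thesis using dom Z that by blast
  qed
  define Q where "Q = {a. \<exists>X. prof X a}"
  have QA: "a \<in> A_seq" if "a \<in> Q" for a using that unfolding Q_def prof_def by blast
  obtain X0 where "X0 \<in> P" using P by (auto simp: pyramid_def)
  then have Qne: "Q \<noteq> {}" using prof_ex unfolding Q_def by blast
  define s where "s k = (INF a\<in>Q. psum a k)" for k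
  have s_le: "s k \<le> psum a k" if "a \<in> Q" for a k
    unfolding s_def using that psum_nonneg[OF QA] by (intro cINF_lower bdd_belowI2[of _ 0]) auto
  \<comment> \<open>Take a common dominating space for the one good below n and the one good at n;
    its partial sums are no larger than either, so all bounds survive.\<close>
  have near: "\<exists>a\<in>Q. \<forall>k<n. psum a k < s k + e" if e: "e > 0" for n e
  proof (induction n)
    case 0
    then show ?case using Qne by auto
  next
    case (Suc n)
    then obtain a where a: "a \<in> Q" "\<forall>k<n. psum a k < s k + e" by blast
    have "Inf ((\<lambda>a. psum a n) ` Q) < s n + e" using e by (simp add: s_def)
    then obtain b where b: "b \<in> Q" "psum b n < s n + e"
      using cInf_lessD[of "(\<lambda>a. psum a n) ` Q"] Qne by blast
    obtain X Y where XY: "prof X a" "prof Y b" using a b unfolding Q_def by blast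
    then have "X \<in> P" "Y \<in> P" by (simp_all add: prof_def)
    then obtain Z c where c: "prof Z c" "X \<in> pyr_of c" "Y \<in> pyr_of c"
      using direct by blast
    have "psum c k < s k + e" if "k < Suc n" for k
    proof (cases "k = n")
      case True
      then show ?thesis using prof_le[OF XY(2) c(3), of n] b(2) by simp
    next
      case False
      then have "psum a k < s k + e" using a(2) that by simp
      then show ?thesis using prof_le[OF XY(1) c(2), of k] by simp
    qed
    then show ?case using c(1) unfolding Q_def by blast
  qed
  have "\<exists>a. a \<in> Q \<and> (\<forall>k<n. psum a k < s k + 1 / real (Suc n))" for n
    using near[of "1 / real (Suc n)" n] by auto
  then obtain \<alpha> where \<alpha>: "\<And>n. \<alpha> n \<in> Q" "\<And>n k. k < n \<Longrightarrow> psum (\<alpha> n) k < s k + 1 / real (Suc n)" by metis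
  \<comment> \<open>Used twice: for \<alpha> itself, and for sequences below \<alpha> that come from
    spaces dominating a given member of P. Both have the same limit.\<close>
  have squeeze: "(\<lambda>n. \<gamma> n i) \<longlonglongrightarrow> s (Suc i) - s i"
    if \<gamma>: "\<And>n. \<gamma> n \<in> Q" "\<And>n k. psum (\<gamma> n) k \<le> psum (\<alpha> n) k" for \<gamma> i
  proof -
    have "(\<lambda>n. psum (\<gamma> n) k) \<longlonglongrightarrow> s k" for k
    proof (rule tendsto_sandwich)
      show "\<forall>\<^sub>F n in sequentially. s k \<le> psum (\<gamma> n) k" using s_le[OF \<gamma>(1)] by simp
      show "\<forall>\<^sub>F n in sequentially. psum (\<gamma> n) k \<le> s k + 1 / real (Suc n)"
        using eventually_gt_at_top[of k]
      proof eventually_elim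
        case (elim n)
        then show ?case using \<alpha>(2)[OF elim] \<gamma>(2)[of n k] by linarith
      qed
      have "(\<lambda>n. s k + 1 / real (Suc n)) \<longlonglongrightarrow> s k + 0"
        by (intro tendsto_add tendsto_const LIMSEQ_Suc[OF lim_1_over_n])
      then show "(\<lambda>n. s k + 1 / real (Suc n)) \<longlonglongrightarrow> s k" by simp
    qed simp
    then have "(\<lambda>n. psum (\<gamma> n) (Suc i) - psum (\<gamma> n) i) \<longlonglongrightarrow> s (Suc i) - s i" by (intro tendsto_diff)
    then show ?thesis by (simp add: psum_Suc)
  qed
  define a where "a i = s (Suc i) - s i" for i
  have lim: "(\<lambda>n. \<alpha> n i) \<longlonglongrightarrow> a i" for i unfolding a_def by (rule squeeze[OF \<alpha>(1)]) simp
  have aA: "a \<in> A_seq" by (rule A_seq_limit[OF QA[OF \<alpha>(1)] lim])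
  have "pyr_of a \<subseteq> P"
  proof
    fix X assume X: "X \<in> pyr_of a"
    have lim0: "(\<lambda>n. box_set X (pyr_of (\<alpha> n))) \<longlonglongrightarrow> 0"
      by (rule box_set_pyr_of_tendsto[OF aA QA[OF \<alpha>(1)] lim X])
    have "\<exists>Y\<in>P. box X Y < \<epsilon>" if \<epsilon>: "\<epsilon> > 0" for \<epsilon>
    proof -
      obtain n where n: "box_set X (pyr_of (\<alpha> n)) < \<epsilon>"
        using eventually_happens'[OF trivial_limit_sequentially order_tendstoD(2)[OF lim0 \<epsilon>]] by blast
      obtain Y where Y: "Y \<in> pyr_of (\<alpha> n)" "box X Y < \<epsilon>"
        using box_set_lessD[OF pyr_of_nonempty[OF QA[OF \<alpha>(1)]] n] by blast
      obtain Z where "prof Z (\<alpha> n)" using \<alpha>(1)[of n] unfolding Q_def by blast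
      then have "pyr_of (\<alpha> n) \<subseteq> P" using pyr_of_subset_pyramid[OF P scale] unfolding prof_def by blast
      then show ?thesis using Y by blast
    qed
    moreover have "X \<in> mmX" using pyr_of_subset X by blast
    ultimately show "X \<in> P" using P unfolding pyramid_def by blast
  qed
  moreover have "P \<subseteq> pyr_of a"
  proof
    fix X assume X: "X \<in> P"
    \<comment> \<open>A common dominator of X and of the space behind \<alpha> n has a profile below
      \<alpha> n, while X stays in the corresponding pyramid. The limit lemma is then applied to the
      constant sequence X with error 0.\<close>
    have "\<exists>c. c \<in> Q \<and> X \<in> pyr_of c \<and> (\<forall>k. psum c k \<le> psum (\<alpha> n) k)" for n
    proof -
      obtain A where A: "prof A (\<alpha> n)" using \<alpha>(1)[of n] unfolding Q_def by blast
      then have "A \<in> P" by (simp add: prof_def)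
      then obtain Z c where c: "prof Z c" "X \<in> pyr_of c" "A \<in> pyr_of c" using direct[OF X] by blast
      then show ?thesis using prof_le[OF A] unfolding Q_def by blast
    qed
    then obtain \<gamma> where \<gamma>: "\<And>n. \<gamma> n \<in> Q" "\<And>n. X \<in> pyr_of (\<gamma> n)" "\<And>n k. psum (\<gamma> n) k \<le> psum (\<alpha> n) k" by metis
    show "X \<in> pyr_of a"
    proof (rule pyr_of_limit[OF aA QA[OF \<gamma>(1)] _ Pmm[OF X] \<gamma>(2) box_rel_refl[OF Pmm[OF X]] tendsto_const])
      show "(\<lambda>n. \<gamma> n i) \<longlonglongrightarrow> a i" for i unfolding a_def by (rule squeeze[OF \<gamma>(1,3)])
    qed
  qed
  ultimately show ?thesis using aA by blast
qed

lemma pyr_of_image: "pyr_of ` A_seq = Fix_Pyr"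
  using Fix_Pyr_pyr_of Fix_Pyr_is_pyr_of by blast

section \<open>Topology\<close>

lemma coord_tendsto:
  fixes x :: "nat \<Rightarrow> nat \<Rightarrow> real"
  assumes "x \<longlonglongrightarrow> l" shows "(\<lambda>n. x n i) \<longlonglongrightarrow> l i"
proof -
  have "isCont (\<lambda>x :: nat \<Rightarrow> real. x i) l"
    using continuous_on_product_coordinates[of i] continuous_on_eq_continuous_at[OF open_UNIV] by blast
  then show ?thesis using assms by (rule isCont_tendsto_compose)
qed

lemma continuous_coord: "continuous_on UNIV (\<lambda>x :: nat \<Rightarrow> real. x i)"
  by (rule continuous_on_product_coordinates)

lemma closed_A_seq: "closed A_seq"
proof (subst closed_sequential_limits, intro allI impI, elim conjE)
  fix x :: "nat \<Rightarrow> nat \<Rightarrow> real" and l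
  assume "\<forall>n. x n \<in> A_seq" "x \<longlonglongrightarrow> l"
  then show "l \<in> A_seq" using A_seq_limit[of x l] coord_tendsto by blast
qed

text \<open>A closed subset of the cube of sequences in [0,1], which is compact by
  Tychonoff.\<close>

lemma compact_A_seq: "compact A_seq"
proof -
  have "compactin (product_topology (\<lambda>_::nat. euclidean :: real topology) UNIV) (PiE UNIV (\<lambda>_. {0..1}))"
    by (simp add: compactin_PiE)
  then have K: "compact (PiE UNIV (\<lambda>_. {0..1}) :: (nat \<Rightarrow> real) set)"
    by (simp add: euclidean_product_topology)
  have "A_seq \<subseteq> PiE UNIV (\<lambda>_. {0..1})"
  proof
    fix a assume a: "a \<in> A_seq"
    show "a \<in> PiE UNIV (\<lambda>_. {0..1})" using A_seq_nonneg[OF a] A_seq_le_1[OF a] by (simp add: PiE_iff)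
  qed
  then have "A_seq = PiE UNIV (\<lambda>_. {0..1}) \<inter> A_seq" by blast
  then show ?thesis using compact_Int_closed[OF K closed_A_seq] by simp
qed

lemma A_seq_subset_l2: "A_seq \<subseteq> l2"
proof
  fix a assume a: "a \<in> A_seq"
  have "(a i)\<^sup>2 \<le> a i" for i
    using A_seq_nonneg[OF a, of i] A_seq_le_1[OF a, of i] by (simp add: power2_eq_square mult_left_le)
  then show "a \<in> l2"
    unfolding l2_def by (auto intro!: summable_comparison_test'[OF A_seq_summable[OF a], of 0])
qed

text \<open>The tail of the inner product from n on is at most the supremum of the later |y i| times
  the mass of x, which is at most 1. Hence the finite partial sums converge uniformly on
  \<open>A_seq\<close>.\<close>

lemma continuous_on_l2_inner:
  assumes y: "y \<in> l2" shows "continuous_on A_seq (\<lambda>x. l2_inner x y)"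
proof (rule uniform_limit_theorem)
  have "(\<lambda>i. (y i)\<^sup>2) \<longlonglongrightarrow> 0" using y by (intro summable_LIMSEQ_zero) (simp add: l2_def)
  then have y0: "y \<longlonglongrightarrow> 0" by (simp add: power_tendsto_0_iff)
  show "\<forall>\<^sub>F n in sequentially. continuous_on A_seq (\<lambda>x. \<Sum>i<n. x i * y i)"
    by (intro always_eventually allI continuous_intros continuous_on_subset[OF continuous_coord]) auto
  show "uniform_limit A_seq (\<lambda>n x. \<Sum>i<n. x i * y i) (\<lambda>x. l2_inner x y) sequentially"
  proof (rule uniform_limitI)
    fix e :: real assume e: "e > 0"
    then have "\<forall>\<^sub>F i in sequentially. \<bar>y i\<bar> < e / 2"
      using order_tendstoD(2)[OF tendsto_rabs_zero[OF y0], of "e / 2"] by simp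
    then obtain N where N: "\<And>i. N \<le> i \<Longrightarrow> \<bar>y i\<bar> < e / 2" unfolding eventually_sequentially by blast
    show "\<forall>\<^sub>F n in sequentially. \<forall>x\<in>A_seq. dist (\<Sum>i<n. x i * y i) (l2_inner x y) < e"
      using eventually_ge_at_top[of N]
    proof eventually_elim
      case (elim n)
      show ?case
      proof
        fix x assume x: "x \<in> A_seq"
        have le: "\<bar>x (i + n) * y (i + n)\<bar> \<le> e / 2 * x (i + n)" for i
          using N[of "i + n"] elim A_seq_nonneg[OF x, of "i + n"] mult_left_mono[of "\<bar>y (i + n)\<bar>" "e / 2" "x (i + n)"]
          by (simp add: abs_mult mult.commute)
        have sx: "summable (\<lambda>i. e / 2 * x (i + n))"
          by (intro summable_mult summable_ignore_initial_segment A_seq_summable[OF x])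
        have sabs: "summable (\<lambda>i. \<bar>x (i + n) * y (i + n)\<bar>)"
          by (rule summable_comparison_test'[OF sx, of 0]) (use le in simp)
        then have "summable (\<lambda>i. x (i + n) * y (i + n))" by (rule summable_rabs_cancel)
        then have s: "summable (\<lambda>i. x i * y i)" by (subst (asm) summable_iff_shift)
        have "l2_inner x y - (\<Sum>i<n. x i * y i) = (\<Sum>i. x (i + n) * y (i + n))"
          unfolding l2_inner_def using suminf_split_initial_segment[OF s, of n] by simp
        also have "\<bar>\<dots>\<bar> \<le> (\<Sum>i. \<bar>x (i + n) * y (i + n)\<bar>)" by (rule summable_rabs[OF sabs])
        also have "\<dots> \<le> (\<Sum>i. e / 2 * x (i + n))" by (rule suminf_le[OF le sabs sx])
        also have "\<dots> = e / 2 * (\<Sum>i. x (i + n))"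
          by (intro suminf_mult summable_ignore_initial_segment A_seq_summable[OF x])
        also have "\<dots> \<le> e / 2 * 1"
        proof (rule mult_left_mono)
          have "(\<Sum>i. x (i + n)) = suminf x - psum x n"
            using suminf_split_initial_segment[OF A_seq_summable[OF x], of n] by (simp add: psum_def)
          then show "(\<Sum>i. x (i + n)) \<le> 1" using A_seq_total[OF x] psum_nonneg[OF x, of n] by simp
        qed (use e in simp)
        finally show "dist (\<Sum>i<n. x i * y i) (l2_inner x y) < e"
          using e by (simp add: dist_real_def abs_minus_commute)
      qed
    qed
  qed
qed simp

lemma topspace_weak_l2 [simp]: "topspace weak_l2_topology = l2"
proof -
  have "l2 = {x \<in> l2. l2_inner x (\<lambda>_. 0) \<in> UNIV}" by simp
  moreover have "(\<lambda>_. 0) \<in> l2" by (simp add: l2_def)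
  ultimately have "l2 \<in> {{x \<in> l2. l2_inner x y \<in> U} | y U. y \<in> l2 \<and> open U}" by blast
  then show ?thesis unfolding weak_l2_topology_def topology_generated_by_topspace by blast
qed

text \<open>One direction is continuity of all inner products on \<open>A_seq\<close> in the product
  topology; for the other, inner products with unit vectors are the coordinates.\<close>

lemma weak_l2_topology_A_seq: "subtopology weak_l2_topology A_seq = top_of_set A_seq"
proof -
  have fwd: "continuous_map (top_of_set A_seq) (subtopology weak_l2_topology A_seq) (\<lambda>x. x)"
    unfolding continuous_map_in_subtopology
  proof
    show "continuous_map (top_of_set A_seq) weak_l2_topology (\<lambda>x. x)"
      unfolding weak_l2_topology_def
    proof (rule continuous_on_generated_topo)
      fix V assume "V \<in> {{x \<in> l2. l2_inner x y \<in> U} | y U. y \<in> l2 \<and> open U}"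
      then obtain y U where V: "V = {x \<in> l2. l2_inner x y \<in> U}" "y \<in> l2" "open U" by blast
      have "openin (top_of_set A_seq) (A_seq \<inter> (\<lambda>x. l2_inner x y) -` U)"
        by (rule continuous_openin_preimage_gen[OF continuous_on_l2_inner[OF V(2)] V(3)])
      moreover have "A_seq \<inter> (\<lambda>x. l2_inner x y) -` U = (\<lambda>x. x) -` V \<inter> topspace (top_of_set A_seq)"
        using A_seq_subset_l2 V(1) by auto
      ultimately show "openin (top_of_set A_seq) ((\<lambda>x. x) -` V \<inter> topspace (top_of_set A_seq))" by simp
    next
      show "(\<lambda>x. x) ` topspace (top_of_set A_seq) \<subseteq> \<Union>{{x \<in> l2. l2_inner x y \<in> U} | y U. y \<in> l2 \<and> open U}"
        using topspace_weak_l2 A_seq_subset_l2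
        unfolding weak_l2_topology_def topology_generated_by_topspace by simp
    qed
  qed simp
  have coord: "continuous_map weak_l2_topology euclideanreal (\<lambda>x. x i)" for i
  proof -
    define ei where "ei = (\<lambda>j. if j = i then 1 else 0 :: real)"
    have "ei \<in> l2" unfolding l2_def ei_def
      by (auto intro!: summable_finite[of "{i}"] split: if_splits)
    have inner: "l2_inner x ei = x i" for x
    proof -
      have "l2_inner x ei = (\<Sum>j\<in>{i}. x j * ei j)"
        unfolding l2_inner_def by (rule suminf_finite) (auto simp: ei_def)
      then show ?thesis by (simp add: ei_def)
    qed
    show ?thesis
      unfolding continuous_map_def
    proof (intro conjI allI impI)
      fix U :: "real set" assume U: "openin euclideanreal U"
      have "{x \<in> topspace weak_l2_topology. x i \<in> U} = {x \<in> l2. l2_inner x ei \<in> U}" by (simp add: inner)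
      also have "openin weak_l2_topology \<dots>"
        unfolding weak_l2_topology_def
        by (rule topology_generated_by_Basis) (use U \<open>ei \<in> l2\<close> in auto)
      finally show "openin weak_l2_topology {x \<in> topspace weak_l2_topology. x i \<in> U}" .
    qed auto
  qed
  have "continuous_map weak_l2_topology (product_topology (\<lambda>_::nat. euclideanreal) UNIV) (\<lambda>x. x)"
    by (rule continuous_map_coordinatewise_then_product) (use coord in auto)
  then have "continuous_map weak_l2_topology euclidean (\<lambda>x. x)"
    by (simp add: euclidean_product_topology)
  then have bwd: "continuous_map (subtopology weak_l2_topology A_seq) (top_of_set A_seq) (\<lambda>x. x)"
    unfolding continuous_map_in_subtopology by (auto intro: continuous_map_from_subtopology)
  have ts: "topspace (subtopology weak_l2_topology A_seq) = A_seq" using A_seq_subset_l2 by auto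
  show ?thesis
    unfolding topology_eq
  proof (intro allI iffI)
    fix S assume S: "openin (subtopology weak_l2_topology A_seq) S"
    then have "S \<subseteq> A_seq" using openin_subset ts by metis
    then have "{x \<in> topspace (top_of_set A_seq). x \<in> S} = S" by auto
    then show "openin (top_of_set A_seq) S"
      using openin_continuous_map_preimage[OF fwd S] by simp
  next
    fix S assume S: "openin (top_of_set A_seq) S"
    then have "S \<subseteq> A_seq" using openin_subset by fastforce
    then have "{x \<in> topspace (subtopology weak_l2_topology A_seq). x \<in> S} = S" using ts by auto
    then show "openin (subtopology weak_l2_topology A_seq) S"
      using openin_continuous_map_preimage[OF bwd S] by simp
  qed
qed

section \<open>The sequential topology on pyramids and the homeomorphism\<close>

lemma openin_Pyr_topology:
  "openin Pyr_topology U \<longleftrightarrow> U \<subseteq> Pyr \<and>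
     (\<forall>Ps P. (\<forall>n. Ps n \<in> Pyr) \<and> P \<in> U \<and> weak_conv Ps P \<longrightarrow> eventually (\<lambda>n. Ps n \<in> U) sequentially)"
  unfolding Pyr_topology_def using topology_inverse'[OF istopology_Pyr_topology_pred] by simp

lemma topspace_Pyr_topology [simp]: "topspace Pyr_topology = Pyr"
proof
  show "topspace Pyr_topology \<subseteq> Pyr" using openin_Pyr_topology openin_topspace by blast
  have "openin Pyr_topology Pyr" unfolding openin_Pyr_topology by simp
  then show "Pyr \<subseteq> topspace Pyr_topology" by (rule openin_subset)
qed

lemma weak_conv_subseq:
  assumes "weak_conv Ps P" "strict_mono r" shows "weak_conv (\<lambda>n. Ps (r n)) P"
  unfolding weak_conv_def
proof (intro conjI ballI)
  fix X assume "X \<in> P"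
  then have "(\<lambda>n. box_set X (Ps n)) \<longlonglongrightarrow> 0" using assms(1) by (simp add: weak_conv_def)
  from LIMSEQ_subseq_LIMSEQ[OF this assms(2)] show "(\<lambda>n. box_set X (Ps (r n))) \<longlonglongrightarrow> 0" by (simp add: o_def)
next
  fix X assume "X \<in> mmX - P"
  then have "0 < liminf (\<lambda>n. ereal (box_set X (Ps n)))" using assms(1) by (simp add: weak_conv_def)
  also have "\<dots> \<le> liminf ((\<lambda>n. ereal (box_set X (Ps n))) \<circ> r)" by (rule liminf_subseq_mono[OF assms(2)])
  finally show "0 < liminf (\<lambda>n. ereal (box_set X (Ps (r n))))" by (simp add: o_def)
qed

text \<open>A space in P but not in P' would have distances to Ps n tending to 0 and also with
  positive liminf.\<close>

lemma weak_conv_unique_subset: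
  assumes "weak_conv Ps P" "weak_conv Ps P'" "P \<subseteq> mmX" shows "P \<subseteq> P'"
proof
  fix X assume X: "X \<in> P"
  show "X \<in> P'"
  proof (rule ccontr)
    assume "X \<notin> P'"
    then have pos: "0 < liminf (\<lambda>n. ereal (box_set X (Ps n)))" using assms(2,3) X by (auto simp: weak_conv_def)
    have "(\<lambda>n. box_set X (Ps n)) \<longlonglongrightarrow> 0" using assms(1) X by (simp add: weak_conv_def)
    then have "(\<lambda>n. ereal (box_set X (Ps n))) \<longlonglongrightarrow> ereal 0" by simp
    from lim_imp_Liminf[OF trivial_limit_sequentially this] pos show False by (simp add: zero_ereal_def)
  qed
qed

text \<open>Sequences of reals form a first countable space, so the complement of a preimage can be
  tested for closedness by sequences, which is the form in which openness of sets of pyramids is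
  given.\<close>

lemma continuous_map_pyr_of: "continuous_map (top_of_set A_seq) (subtopology Pyr_topology Fix_Pyr) pyr_of"
  unfolding continuous_map_in_subtopology
proof
  show "pyr_of \<in> topspace (top_of_set A_seq) \<rightarrow> Fix_Pyr" using Fix_Pyr_pyr_of by simp
  show "continuous_map (top_of_set A_seq) Pyr_topology pyr_of"
    unfolding continuous_map_def
  proof (intro conjI allI impI)
    show "pyr_of \<in> topspace (top_of_set A_seq) \<rightarrow> topspace Pyr_topology"
      using pyramid_pyr_of by (simp add: Pyr_def)
    fix U assume U: "openin Pyr_topology U"
    define V where "V = {a \<in> A_seq. pyr_of a \<in> U}"
    have "closed (A_seq - V)"
      unfolding closed_sequential_limits
    proof (intro allI impI, elim conjE)
      fix x :: "nat \<Rightarrow> nat \<Rightarrow> real" and l assume x: "\<forall>n. x n \<in> A_seq - V" and lim: "x \<longlonglongrightarrow> l"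
      have xA: "x n \<in> A_seq" for n using x by blast
      have lA: "l \<in> A_seq" by (rule A_seq_limit[OF xA coord_tendsto[OF lim]])
      have wc: "weak_conv (\<lambda>n. pyr_of (x n)) (pyr_of l)"
        by (rule weak_conv_pyr_of[OF lA xA coord_tendsto[OF lim]])
      have "l \<notin> V"
      proof
        assume "l \<in> V"
        then have "pyr_of l \<in> U" by (simp add: V_def)
        moreover have "\<forall>n. pyr_of (x n) \<in> Pyr" using pyramid_pyr_of[OF xA] by (simp add: Pyr_def)
        ultimately have "\<forall>\<^sub>F n in sequentially. pyr_of (x n) \<in> U"
          using U[unfolded openin_Pyr_topology, THEN conjunct2, rule_format, of "\<lambda>n. pyr_of (x n)" "pyr_of l"] wc
          by simp
        then obtain n where "pyr_of (x n) \<in> U" using eventually_happens'[OF trivial_limit_sequentially] by blast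
        then show False using x by (auto simp: V_def)
      qed
      then show "l \<in> A_seq - V" using lA by blast
    qed
    then have "closedin (top_of_set A_seq) (A_seq - V)" by (rule closed_subset[rotated]) blast
    then have "openin (top_of_set A_seq) (A_seq - (A_seq - V))" by (simp add: closedin_def)
    moreover have "A_seq - (A_seq - V) = {x \<in> topspace (top_of_set A_seq). pyr_of x \<in> U}"
      by (auto simp: V_def)
    ultimately show "openin (top_of_set A_seq) {x \<in> topspace (top_of_set A_seq). pyr_of x \<in> U}" by simp
  qed
qed

text \<open>The image of a closed (hence compact) set of sequences is sequentially closed among all
  pyramids, because weak limits are unique.\<close>

lemma closed_map_pyr_of: "closed_map (top_of_set A_seq) (subtopology Pyr_topology Fix_Pyr) pyr_of"
  unfolding closed_map_def
proof (intro allI impI)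
  fix C assume "closedin (top_of_set A_seq) C"
  then have CA: "C \<subseteq> A_seq" and "closed C"
    using closedin_subset[of "top_of_set A_seq" C] closedin_closed_trans[OF _ closed_A_seq] by auto
  have "compact (A_seq \<inter> C)" by (rule compact_Int_closed[OF compact_A_seq \<open>closed C\<close>])
  then have comp: "compact C" using CA by (simp add: Int_absorb1)
  have FC: "pyr_of ` C \<subseteq> Fix_Pyr" using CA Fix_Pyr_pyr_of by blast
  have FP: "Fix_Pyr \<subseteq> Pyr" by (auto simp: Fix_Pyr_def)
  \<comment> \<open>Openness is tested on arbitrary sequences of pyramids with arbitrary limits,
    fixed or not. The limit is identified as some \<open>pyr_of l\<close> only through
    uniqueness.\<close>
  have "openin Pyr_topology (Pyr - pyr_of ` C)"
    unfolding openin_Pyr_topology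
  proof (intro conjI allI impI, goal_cases)
    case (2 Ps P)
    then have Ps: "\<And>n. Ps n \<in> Pyr" and P: "P \<in> Pyr" "P \<notin> pyr_of ` C" and wc: "weak_conv Ps P" by auto
    show ?case
    proof (rule ccontr)
      assume "\<not> (\<forall>\<^sub>F n in sequentially. Ps n \<in> Pyr - pyr_of ` C)"
      then have "\<exists>\<^sub>F n in sequentially. Ps n \<in> pyr_of ` C"
        using Ps unfolding frequently_def by (simp add: not_eventually)
      then have "infinite {n. Ps n \<in> pyr_of ` C}"
        unfolding cofinite_eq_sequentially[symmetric] frequently_cofinite .
      from infinite_enumerate[OF this] obtain r :: "nat \<Rightarrow> nat"
        where r: "strict_mono r" "\<forall>n. Ps (r n) \<in> pyr_of ` C" by auto
      then have "\<forall>n. \<exists>c. c \<in> C \<and> Ps (r n) = pyr_of c" by blast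
      then obtain c where c: "\<And>n. c n \<in> C" "\<And>n. Ps (r n) = pyr_of (c n)" by metis
      obtain l q where l: "l \<in> C" and q: "strict_mono q" and lim: "(c \<circ> q) \<longlonglongrightarrow> l"
        using compact_imp_seq_compact[OF comp] c(1) unfolding seq_compact_def by meson
      have lA: "l \<in> A_seq" using l CA by blast
      have cA: "(c \<circ> q) n \<in> A_seq" for n using c(1) CA by auto
      have "weak_conv (\<lambda>n. pyr_of ((c \<circ> q) n)) (pyr_of l)"
        by (rule weak_conv_pyr_of[OF lA cA coord_tendsto[OF lim]])
      then have wl: "weak_conv (\<lambda>n. Ps (r (q n))) (pyr_of l)" by (simp add: c(2))
      have wP: "weak_conv (\<lambda>n. Ps (r (q n))) P"
        using weak_conv_subseq[OF weak_conv_subseq[OF wc r(1)] q] .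
      have "P \<subseteq> mmX" using P(1) by (simp add: Pyr_def pyramid_def)
      then have "P = pyr_of l"
        using weak_conv_unique_subset[OF wP wl] weak_conv_unique_subset[OF wl wP] pyr_of_subset by blast
      then show False using P(2) l by blast
    qed
  qed auto
  then have "closedin Pyr_topology (pyr_of ` C)" using FC FP by (simp add: closedin_def order_trans[OF FC FP])
  then show "closedin (subtopology Pyr_topology Fix_Pyr) (pyr_of ` C)"
    by (rule closedin_subset_topspace) (rule FC)
qed

theorem theorem1p4:
  shows "subtopology Pyr_topology Fix_Pyr homeomorphic_space subtopology weak_l2_topology A_seq"
proof -
  have "Fix_Pyr \<subseteq> Pyr" by (auto simp: Fix_Pyr_def)
  then have "homeomorphic_map (top_of_set A_seq) (subtopology Pyr_topology Fix_Pyr) pyr_of"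
    using pyr_of_image inj_on_pyr_of
    by (intro bijective_closed_imp_homeomorphic_map continuous_map_pyr_of closed_map_pyr_of) auto
  then show ?thesis
    unfolding weak_l2_topology_A_seq
    using homeomorphic_map_imp_homeomorphic_space homeomorphic_space_sym by blast
qed

end
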